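(* There exist a fixed constant $d\in\mathbb{N}$ and a fixed list of four abelian subgroups $G_1,G_2,G_3,G_4\leq H_3(\mathbb{Z})^d$ such that membership in the product $G_1G_2G_3G_4$ is undecidable; that is, there is no algorithm that, given $g\in H_3(\mathbb{Z})^d$, decides whether $g\in G_1G_2G_3G_4=\{a_1a_2a_3a_4\mid a_i\in G_i,\ 1\le i\le 4\}$.
   Context: $H_3(\mathbb{Z})$, the discrete Heisenberg group, is the group of all upper triangular $3\times3$ integer matrices with all diagonal entries equal to $1$, under matrix multiplication; $H_3(\mathbb{Z})^d$ is the direct product of $d$ copies. Input elements are represented by finite words over a fixed finite generating set of $H_3(\mathbb{Z})^d$ and inverses of generators. *)

theory Defs
  imports
    "HOL-Analysis.Cartesian_Space"
    "HOL-Algebra.Product_Groups"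
    "HOL-Library.Nat_Bijection"
begin

section \<open>The groups\<close>

(* In the index type 3 the numeral 3 equals 0, so its linear order does not list the indices as
   1, 2, 3. Hence the positions below the diagonal are written out. *)
definition heisenberg :: "(int ^ 3 ^ 3) monoid"
  where "heisenberg =
    \<lparr>carrier = {A. A $ 1 $ 1 = 1 \<and> A $ 2 $ 2 = 1 \<and> A $ 3 $ 3 = 1 \<and>
                   A $ 2 $ 1 = 0 \<and> A $ 3 $ 1 = 0 \<and> A $ 3 $ 2 = 0},
     mult = (**), one = mat 1\<rparr>"

definition heisenberg_power :: "nat \<Rightarrow> (nat \<Rightarrow> int ^ 3 ^ 3) monoid"
  where "heisenberg_power d = product_group {..<d} (\<lambda>_. heisenberg)"

lemma group_heisenberg: "group heisenberg"
proof (rule groupI)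
  fix x y assume "x \<in> carrier heisenberg" "y \<in> carrier heisenberg"
  then show "x \<otimes>\<^bsub>heisenberg\<^esub> y \<in> carrier heisenberg"
    by (simp add: heisenberg_def matrix_matrix_mult_def sum_3)
next
  show "\<one>\<^bsub>heisenberg\<^esub> \<in> carrier heisenberg"
    by (simp add: heisenberg_def mat_def)
next
  fix x y z
  show "x \<otimes>\<^bsub>heisenberg\<^esub> y \<otimes>\<^bsub>heisenberg\<^esub> z = x \<otimes>\<^bsub>heisenberg\<^esub> (y \<otimes>\<^bsub>heisenberg\<^esub> z)"
    by (simp add: heisenberg_def matrix_mul_assoc)
next
  fix x
  show "\<one>\<^bsub>heisenberg\<^esub> \<otimes>\<^bsub>heisenberg\<^esub> x = x"
    by (simp add: heisenberg_def)
next
  fix x assume x: "x \<in> carrier heisenberg"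
  define y :: "int ^ 3 ^ 3" where "y = vector
    [vector [1, - x $ 1 $ 2, x $ 1 $ 2 * x $ 2 $ 3 - x $ 1 $ 3],
     vector [0, 1, - x $ 2 $ 3], vector [0, 0, 1]]"
  have "y \<in> carrier heisenberg"
    by (simp add: heisenberg_def y_def)
  moreover have "y \<otimes>\<^bsub>heisenberg\<^esub> x = \<one>\<^bsub>heisenberg\<^esub>"
    using x
    by (simp add: heisenberg_def y_def vec_eq_iff forall_3 matrix_matrix_mult_def sum_3 mat_def)
  ultimately show "\<exists>y\<in>carrier heisenberg. y \<otimes>\<^bsub>heisenberg\<^esub> x = \<one>\<^bsub>heisenberg\<^esub>"
    by blast
qed

lemma group_heisenberg_power: "group (heisenberg_power d)"
  by (simp add: heisenberg_power_def group_heisenberg)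


section \<open>Words over a list of generators\<close>

(* The letter Inl i stands for the i-th generator, Inr i for its inverse. *)
type_synonym word = "(nat + nat) list"

fun letter_value :: "('a, 'b) monoid_scheme \<Rightarrow> 'a list \<Rightarrow> nat + nat \<Rightarrow> 'a"
  where
    "letter_value G gs (Inl i) = gs ! i"
  | "letter_value G gs (Inr i) = inv\<^bsub>G\<^esub> (gs ! i)"

definition word_value :: "('a, 'b) monoid_scheme \<Rightarrow> 'a list \<Rightarrow> word \<Rightarrow> 'a"
  where "word_value G gs w = foldr (\<lambda>l x. letter_value G gs l \<otimes>\<^bsub>G\<^esub> x) w \<one>\<^bsub>G\<^esub>"

definition words_over :: "'a list \<Rightarrow> word set"
  where "words_over gs = lists ({..<length gs} <+> {..<length gs})"

definition generating_list :: "('a, 'b) monoid_scheme \<Rightarrow> 'a list \<Rightarrow> bool"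
  where "generating_list G gs \<longleftrightarrow> set gs \<subseteq> carrier G \<and> generate G (set gs) = carrier G"

(* The statement quantifies over all finite generating lists; at least one exists. *)
lemma generating_list_heisenberg_power: "\<exists>gs. generating_list (heisenberg_power d) gs"
proof -
  define U :: "int \<Rightarrow> int \<Rightarrow> int \<Rightarrow> int ^ 3 ^ 3"
    where "U a b c = vector [vector [1, a, c], vector [0, 1, b], vector [0, 0, 1]]" for a b c
  define emb where "emb i A = (\<lambda>j\<in>{..<d}. if j = i then A else mat 1)"
    for i and A :: "int ^ 3 ^ 3"
  define M where "M = [U 1 0 0, U (-1) 0 0, U 0 1 0, U 0 (-1) 0, U 0 0 1, U 0 0 (-1)]"
  define gs where "gs = map (\<lambda>(i, A). emb i A) (List.product [0..<d] M)"
  let ?G = "heisenberg_power d"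
  interpret G: group ?G
    by (rule group_heisenberg_power)
  have U_mult: "U a b c ** U a' b' c' = U (a + a') (b + b') (c + c' + a * b')" for a b c a' b' c'
    by (simp add: U_def vec_eq_iff forall_3 matrix_matrix_mult_def sum_3)
  have U_0: "U 0 0 0 = mat 1"
    by (simp add: U_def vec_eq_iff forall_3 mat_def)
  have U_carrier: "U a b c \<in> carrier heisenberg" for a b c
    by (simp add: U_def heisenberg_def)
  have U_ex: "\<exists>a b c. A = U a b c" if "A \<in> carrier heisenberg" for A
    using that
    by (intro exI[of _ "A $ 1 $ 2"] exI[of _ "A $ 2 $ 3"] exI[of _ "A $ 1 $ 3"])
      (simp add: U_def heisenberg_def vec_eq_iff forall_3)
  have one_carrier: "mat 1 \<in> carrier heisenberg"
    using U_carrier[of 0 0 0] U_0 by simp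
  have emb_carrier: "emb i A \<in> carrier ?G" if "A \<in> carrier heisenberg" for i A
    using that one_carrier by (auto simp: emb_def heisenberg_power_def)
  have emb_mult: "emb i (A ** B) = emb i A \<otimes>\<^bsub>?G\<^esub> emb i B" for i A B
    by (auto simp: emb_def heisenberg_power_def heisenberg_def fun_eq_iff restrict_def)
  have emb_one: "emb i (mat 1) = \<one>\<^bsub>?G\<^esub>" for i
    by (auto simp: emb_def heisenberg_power_def heisenberg_def fun_eq_iff restrict_def)
  have sub: "set gs \<subseteq> carrier ?G"
    using U_carrier by (auto simp: gs_def M_def intro!: emb_carrier)
  define K where "K = generate ?G (set gs)"
  have K_mult: "x \<otimes>\<^bsub>?G\<^esub> y \<in> K" if "x \<in> K" "y \<in> K" for x y
    using that by (auto simp: K_def intro: generate.eng)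
  have K_one: "\<one>\<^bsub>?G\<^esub> \<in> K"
    by (auto simp: K_def intro: generate.one)
  have K_emb: "emb i A \<in> K" if "i < d" "A \<in> carrier heisenberg" for i A
  proof -
    have gen: "emb i B \<in> K" if "B \<in> set M" for B
    proof -
      have "emb i B \<in> set gs"
        using that \<open>i < d\<close> by (force simp: gs_def)
      then show ?thesis
        by (simp add: K_def generate.incl)
    qed
    have 1: "emb i (U a 0 0) \<in> K" for a
    proof (induction a rule: int_induct[where k = 0])
      case base
      then show ?case by (simp add: U_0 emb_one K_one)
    next
      case (step1 a)
      then show ?case
        using K_mult[OF _ gen, of "emb i (U a 0 0)" "U 1 0 0"]
        by (simp add: M_def U_mult flip: emb_mult)
    next
      case (step2 a)
      then show ?case
        using K_mult[OF _ gen, of "emb i (U a 0 0)" "U (-1) 0 0"]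
        by (simp add: M_def U_mult flip: emb_mult)
    qed
    have 2: "emb i (U 0 a 0) \<in> K" for a
    proof (induction a rule: int_induct[where k = 0])
      case base
      then show ?case by (simp add: U_0 emb_one K_one)
    next
      case (step1 a)
      then show ?case
        using K_mult[OF _ gen, of "emb i (U 0 a 0)" "U 0 1 0"]
        by (simp add: M_def U_mult flip: emb_mult)
    next
      case (step2 a)
      then show ?case
        using K_mult[OF _ gen, of "emb i (U 0 a 0)" "U 0 (-1) 0"]
        by (simp add: M_def U_mult flip: emb_mult)
    qed
    have 3: "emb i (U 0 0 a) \<in> K" for a
    proof (induction a rule: int_induct[where k = 0])
      case base
      then show ?case by (simp add: U_0 emb_one K_one)
    next
      case (step1 a)
      then show ?case
        using K_mult[OF _ gen, of "emb i (U 0 0 a)" "U 0 0 1"]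
        by (simp add: M_def U_mult flip: emb_mult)
    next
      case (step2 a)
      then show ?case
        using K_mult[OF _ gen, of "emb i (U 0 0 a)" "U 0 0 (-1)"]
        by (simp add: M_def U_mult flip: emb_mult)
    qed
    obtain a b c where "A = U a b c"
      using U_ex \<open>A \<in> carrier heisenberg\<close> by blast
    then have "A = (U 0 b 0 ** U a 0 0) ** U 0 0 c"
      by (simp add: U_mult)
    then show ?thesis
      using 1 2 3 by (simp add: emb_mult K_mult)
  qed
  have "x \<in> K" if x: "x \<in> carrier ?G" for x
  proof -
    have "(\<lambda>j\<in>{..<d}. if j < k then x j else mat 1) \<in> K" if "k \<le> d" for k
      using that
    proof (induction k)
      case 0
      have "(\<lambda>j\<in>{..<d}. mat 1) = \<one>\<^bsub>?G\<^esub>"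
        by (simp add: heisenberg_power_def heisenberg_def)
      then show ?case
        using K_one by simp
    next
      case (Suc k)
      have "x k \<in> carrier heisenberg"
        using x Suc.prems by (simp add: heisenberg_power_def PiE_iff)
      then have "(\<lambda>j\<in>{..<d}. if j < k then x j else mat 1) \<otimes>\<^bsub>?G\<^esub> emb k (x k) \<in> K"
        using Suc.prems by (intro K_mult K_emb Suc.IH) simp_all
      moreover have "(\<lambda>j\<in>{..<d}. if j < k then x j else mat 1) \<otimes>\<^bsub>?G\<^esub> emb k (x k) =
          (\<lambda>j\<in>{..<d}. if j < Suc k then x j else mat 1)"
        by (rule ext) (simp add: emb_def heisenberg_power_def heisenberg_def less_Suc_eq)
      ultimately show ?case
        by metis
    qed
    from this[of d] have "(\<lambda>j\<in>{..<d}. if j < d then x j else mat 1) \<in> K"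
      by blast
    moreover have "(\<lambda>j\<in>{..<d}. if j < d then x j else mat 1) = x"
      using x by (intro ext) (simp add: heisenberg_power_def PiE_iff extensional_def)
    ultimately show ?thesis
      by metis
  qed
  then have "generate ?G (set gs) = carrier ?G"
    using G.generate_incl[OF sub] by (auto simp: K_def)
  then show ?thesis
    using sub by (auto simp: generating_list_def)
qed

definition word_code :: "word \<Rightarrow> nat"
  where "word_code w = list_encode (map sum_encode w)"


section \<open>Partial recursive functions and decidability\<close>

datatype recf =
    Zero
  | Succ
  | Proj nat
  | Comp recf "recf list"
  | PrimRec recf recf
  | Mu recf

(* computes f xs y: the partial recursive function denoted by f is defined at xs, with value y. *)
inductive computes :: "recf \<Rightarrow> nat list \<Rightarrow> nat \<Rightarrow> bool"
  where
    zero: "computes Zero xs 0"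
  | succ: "computes Succ [x] (Suc x)"
  | proj: "i < length xs \<Longrightarrow> computes (Proj i) xs (xs ! i)"
  | comp: "list_all2 (\<lambda>g y. computes g xs y) gs ys \<Longrightarrow> computes f ys z \<Longrightarrow>
           computes (Comp f gs) xs z"
  | primrec_0: "computes f xs y \<Longrightarrow> computes (PrimRec f g) (0 # xs) y"
  | primrec_Suc: "computes (PrimRec f g) (n # xs) y \<Longrightarrow> computes g (n # y # xs) z \<Longrightarrow>
           computes (PrimRec f g) (Suc n # xs) z"
  | mu: "computes f (n # xs) 0 \<Longrightarrow> (\<forall>m<n. \<exists>y. y \<noteq> 0 \<and> computes f (m # xs) y) \<Longrightarrow>
           computes (Mu f) xs n"

lemma computes_deterministic: "computes f xs y \<Longrightarrow> computes f xs z \<Longrightarrow> y = z"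
proof (induction f xs y arbitrary: z rule: computes.induct)
  case (comp xs gs ys f z z')
  from comp.prems obtain ys' where ys': "list_all2 (\<lambda>g y. computes g xs y) gs ys'"
    and z': "computes f ys' z'"
    by cases
  have "ys = ys'"
    using comp.IH(1) ys' by (auto simp: list_all2_conv_all_nth intro!: nth_equalityI)
  then show ?case
    using comp.IH(2) z' by simp
next
  case (primrec_0 f xs y g)
  from primrec_0.prems show ?case
    by cases (use primrec_0.IH in auto)
next
  case (primrec_Suc f g n xs y z z')
  from primrec_Suc.prems show ?case
    by cases (use primrec_Suc.IH in blast)
next
  case (mu f n xs z)
  from mu.prems show ?case
  proof cases
    case mu
    then show ?thesis
      using mu.IH by (metis linorder_neqE_nat)
  qed
qed (auto elim: computes.cases)

(* An algorithm may rely on its input being the code of an element of X. *)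
definition decidable_on :: "('a \<Rightarrow> nat) \<Rightarrow> 'a set \<Rightarrow> ('a \<Rightarrow> bool) \<Rightarrow> bool"
  where "decidable_on code X P \<longleftrightarrow>
    (\<exists>f. \<forall>x\<in>X. computes f [code x] (if P x then 1 else 0))"

end

theory Submission
  imports Defs "HOL-Number_Theory.Cong"
begin

text \<open>The set of codes of those recursive functions that return 0 on their own code is undecidable.
  It is Diophantine: a run of a recursive function is a finite derivation with rules of at most two
  premises, a derivation is a sequence of digits, and exponentiation (by Pell equations) as well as
  bounded universal quantification (by the Chinese remainder theorem) preserve the Diophantine
  sets. By Lagrange's theorem, natural unknowns can be replaced by integers, and a polynomial equation
  by a system of equations \<open>x a * x b = x c\<close> and \<open>x a + x b = x c\<close>. In a product
  of four abelian subgroups, alternately of elements whose first or second superdiagonal entry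
  vanishes, an element of the centre forces the third and fourth factor to undo the first and second
  one up to a commutator, whose central entry is a product. Each copy of the Heisenberg group
  therefore expresses one equation of the system.\<close>

section \<open>Diophantine predicates\<close>

text \<open>The subgroups have to be fixed before the parameter \<open>n\<close> is known. So the
  system of equations is fixed, and \<open>n\<close> enters only through the target, which is
  \<open>g [^] n \<otimes> h\<close> with two fixed central elements. The obstacle on the group side
  is that each factor brings its own free integers: a coordinate sees
  \<open>l x * m y + k z\<close>, with \<open>x\<close> from the first factor, \<open>y\<close> from
  the second and \<open>z\<close> from the centre of the fourth. Nothing ties these vectors
  together, and the forms \<open>l\<close>, \<open>m\<close>, \<open>k\<close> are homomorphisms, so
  they offer no constants. Therefore 1 is represented by an unknown \<open>u\<close>, and extra
  coordinates link the vectors through it; one coordinate demands \<open>x u * y u = 1\<close>,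
  which fixes the unit up to a sign. On the recursion side, the self-referential set is described by
  derivability between codes, so its undecidability is a short self-application, and the only
  recursive functions built explicitly are those that write the word for
  \<open>g [^] n \<otimes> h\<close>.\<close>

datatype 'a tm = Var 'a | Cst nat | Add "'a tm" "'a tm" | Mul "'a tm" "'a tm"

primrec tval :: "('a \<Rightarrow> 'b::comm_semiring_1) \<Rightarrow> 'a tm \<Rightarrow> 'b" where
  "tval e (Var x) = e x"
| "tval e (Cst c) = of_nat c"
| "tval e (Add s t) = tval e s + tval e t"
| "tval e (Mul s t) = tval e s * tval e t"

lemma tval_map_tm: "tval e (map_tm g t) = tval (\<lambda>x. e (g x)) t"
  by (induction t) auto

lemma finite_set_tm: "finite (set_tm t)"
  by (induction t) auto

lemma tval_mono:
  fixes e :: "'a \<Rightarrow> nat"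
  shows "(\<And>x. x \<in> set_tm t \<Longrightarrow> e x \<le> e' x) \<Longrightarrow> tval e t \<le> tval e' t"
  by (induction t) (auto intro!: add_mono mult_mono)

lemma tval_mod:
  fixes e :: "'a \<Rightarrow> nat"
  shows "(\<And>x. x \<in> set_tm t \<Longrightarrow> [e x = e' x] (mod m)) \<Longrightarrow> [tval e t = tval e' t] (mod m)"
  by (induction t) (auto intro!: cong_add cong_mult)

text \<open>Environments assign values to countably many parameters; in the defining equation the
  parameters are \<^term>\<open>Inl i\<close> and the unknowns are \<^term>\<open>Inr i\<close>.\<close>

definition dioph :: "((nat \<Rightarrow> nat) \<Rightarrow> bool) \<Rightarrow> bool" where
  "dioph P \<longleftrightarrow> (\<exists>p q :: (nat + nat) tm. \<forall>v. P v \<longleftrightarrow> (\<exists>w. tval (case_sum v w) p = tval (case_sum v w) q))"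

text \<open>Parameters behave like de Bruijn indices: the value of the function is pushed as
  parameter 0 and the arguments move up by one, exactly as under a quantifier.\<close>

definition dfun :: "((nat \<Rightarrow> nat) \<Rightarrow> nat) \<Rightarrow> bool" where
  "dfun f \<longleftrightarrow> dioph (\<lambda>v. v 0 = f (\<lambda>i. v (Suc i)))"

lemma dioph_iff: "dioph P \<Longrightarrow> (\<And>v. P v \<longleftrightarrow> Q v) \<Longrightarrow> dioph Q"
  by (simp add: dioph_def)

lemma dioph_rename: "dioph P \<Longrightarrow> dioph (\<lambda>v. P (\<lambda>i. v (\<sigma> i)))"
proof -
  assume "dioph P"
  then obtain p q :: "(nat + nat) tm" where pq: "\<And>v. P v \<longleftrightarrow> (\<exists>w. tval (case_sum v w) p = tval (case_sum v w) q)"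
    by (auto simp: dioph_def)
  have *: "(\<lambda>x. case_sum v w (map_sum \<sigma> id x)) = case_sum (\<lambda>i. v (\<sigma> i)) w" for v w :: "nat \<Rightarrow> nat"
    by (auto simp: fun_eq_iff split: sum.split)
  show ?thesis
    unfolding dioph_def
    by (rule exI[of _ "map_tm (map_sum \<sigma> id) p"], rule exI[of _ "map_tm (map_sum \<sigma> id) q"])
      (simp add: pq tval_map_tm *)
qed

text \<open>The bound variable becomes unknown 0, and the previous unknowns move up by one.\<close>

lemma dioph_ex: "dioph (\<lambda>v. P (v 0) (\<lambda>i. v (Suc i))) \<Longrightarrow> dioph (\<lambda>v. \<exists>x. P x v)"
proof -
  assume "dioph (\<lambda>v. P (v 0) (\<lambda>i. v (Suc i)))"
  then obtain p q :: "(nat + nat) tm" where pq: "\<And>v. P (v 0) (\<lambda>i. v (Suc i)) \<longleftrightarrow> (\<exists>w. tval (case_sum v w) p = tval (case_sum v w) q)"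
    by (auto simp: dioph_def)
  define g :: "nat + nat \<Rightarrow> nat + nat" where
    "g = case_sum (case_nat (Inr 0) Inl) (\<lambda>i. Inr (Suc i))"
  have *: "(\<lambda>x. case_sum v w (g x)) = case_sum (case_nat (w 0) v) (\<lambda>i. w (Suc i))" for v w :: "nat \<Rightarrow> nat"
    by (auto simp: fun_eq_iff g_def split: sum.split nat.split)
  have "(\<exists>x. P x v) \<longleftrightarrow> (\<exists>w. tval (case_sum v w) (map_tm g p) = tval (case_sum v w) (map_tm g q))" for v
  proof
    assume "\<exists>x. P x v"
    then obtain x where "P x v" by blast
    then obtain w where "tval (case_sum (case_nat x v) w) p = tval (case_sum (case_nat x v) w) q"
      using pq[of "case_nat x v"] by auto
    then show "\<exists>w. tval (case_sum v w) (map_tm g p) = tval (case_sum v w) (map_tm g q)"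
      by (intro exI[of _ "case_nat x w"]) (simp add: tval_map_tm *)
  next
    assume "\<exists>w. tval (case_sum v w) (map_tm g p) = tval (case_sum v w) (map_tm g q)"
    then obtain w where "tval (case_sum v w) (map_tm g p) = tval (case_sum v w) (map_tm g q)"
      by blast
    then show "\<exists>x. P x v"
      using pq[of "case_nat (w 0) v"] by (auto simp: tval_map_tm *)
  qed
  then show ?thesis
    unfolding dioph_def by blast
qed

text \<open>A whole sequence can be quantified at once because the unknowns already form a sequence:
  its entries take the even unknowns, the previous unknowns the odd ones. This serves formulas whose
  number of variables depends on a given term.\<close>

lemma dioph_ex_fun:
  assumes "dioph (\<lambda>v. P (\<lambda>i. v (2 * i + 1)) (\<lambda>i. v (2 * i)))"
  shows "dioph (\<lambda>v. \<exists>a. P a v)"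
proof -
  obtain p q :: "(nat + nat) tm" where pq: "\<And>v. P (\<lambda>i. v (2 * i + 1)) (\<lambda>i. v (2 * i)) \<longleftrightarrow>
      (\<exists>w. tval (case_sum v w) p = tval (case_sum v w) q)"
    using assms by (auto simp: dioph_def)
  define g :: "nat + nat \<Rightarrow> nat + nat" where
    "g = case_sum (\<lambda>i. if even i then Inl (i div 2) else Inr (2 * (i div 2))) (\<lambda>i. Inr (2 * i + 1))"
  define mrg where "mrg a b i = (if even i then b (i div 2) else a (i div 2))"
    for a b :: "nat \<Rightarrow> nat" and i
  have mrg: "mrg a b (2 * i) = b i" "mrg a b (Suc (2 * i)) = a i" for a b i
    by (auto simp: mrg_def)
  have *: "(\<lambda>x. case_sum v w (g x)) = case_sum (mrg (\<lambda>i. w (2 * i)) v) (\<lambda>i. w (2 * i + 1))"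
    for v w :: "nat \<Rightarrow> nat"
    by (auto simp: fun_eq_iff g_def mrg_def split: sum.split)
  have "(\<exists>a. P a v) \<longleftrightarrow> (\<exists>w. tval (case_sum v w) (map_tm g p) = tval (case_sum v w) (map_tm g q))" for v
  proof
    assume "\<exists>a. P a v"
    then obtain a where "P a v" by blast
    then obtain w where "tval (case_sum (mrg a v) w) p = tval (case_sum (mrg a v) w) q"
      using pq[of "mrg a v"] by (auto simp: mrg)
    then show "\<exists>w. tval (case_sum v w) (map_tm g p) = tval (case_sum v w) (map_tm g q)"
      by (intro exI[of _ "mrg w a"]) (simp add: tval_map_tm * mrg)
  next
    assume "\<exists>w. tval (case_sum v w) (map_tm g p) = tval (case_sum v w) (map_tm g q)"
    then obtain w where "tval (case_sum v w) (map_tm g p) = tval (case_sum v w) (map_tm g q)"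
      by blast
    then show "\<exists>a. P a v"
      using pq[of "mrg (\<lambda>i. w (2 * i)) v"] by (auto simp: tval_map_tm * mrg)
  qed
  then show ?thesis
    unfolding dioph_def by blast
qed

text \<open>The two equations get disjoint unknowns, even and odd ones; only then do two existential
  quantifiers over unknowns merge into one under a conjunction.\<close>

lemma dioph_pair:
  assumes "dioph P" "dioph Q"
  obtains p q p' q' :: "(nat + nat) tm"
  where "\<And>v. P v \<longleftrightarrow> (\<exists>w. tval (case_sum v w) p = tval (case_sum v w) q)"
    "\<And>v. Q v \<longleftrightarrow> (\<exists>w. tval (case_sum v w) p' = tval (case_sum v w) q')"
    "\<And>v. P v \<and> Q v \<longleftrightarrow> (\<exists>w. tval (case_sum v w) p = tval (case_sum v w) q \<and>
      tval (case_sum v w) p' = tval (case_sum v w) q')"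
proof -
  obtain p q :: "(nat + nat) tm" where pq: "\<And>v. P v \<longleftrightarrow> (\<exists>w. tval (case_sum v w) p = tval (case_sum v w) q)"
    using assms by (auto simp: dioph_def)
  obtain p' q' :: "(nat + nat) tm" where pq': "\<And>v. Q v \<longleftrightarrow> (\<exists>w. tval (case_sum v w) p' = tval (case_sum v w) q')"
    using assms by (auto simp: dioph_def)
  define f :: "nat + nat \<Rightarrow> nat + nat" where "f = map_sum id (\<lambda>i. 2 * i)"
  define g :: "nat + nat \<Rightarrow> nat + nat" where "g = map_sum id (\<lambda>i. 2 * i + 1)"
  have f: "(\<lambda>x. case_sum v w (f x)) = case_sum v (\<lambda>i. w (2 * i))" for v w :: "nat \<Rightarrow> nat"
    by (auto simp: fun_eq_iff f_def split: sum.split)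
  have g: "(\<lambda>x. case_sum v w (g x)) = case_sum v (\<lambda>i. w (2 * i + 1))" for v w :: "nat \<Rightarrow> nat"
    by (auto simp: fun_eq_iff g_def split: sum.split)
  define mrg where "mrg a b i = (if even i then b (i div 2) else a (i div 2))"
    for a b :: "nat \<Rightarrow> nat" and i
  have mrg: "mrg a b (2 * i) = b i" "mrg a b (Suc (2 * i)) = a i" for a b i
    by (auto simp: mrg_def)
  have 1: "(\<exists>w. R (\<lambda>i. w (2 * i))) \<longleftrightarrow> (\<exists>w. R w)" for R :: "(nat \<Rightarrow> nat) \<Rightarrow> bool"
  proof -
    have "R (\<lambda>i. mrg w w (2 * i)) \<longleftrightarrow> R w" for w
      by (simp add: mrg)
    then show ?thesis
      by metis
  qed
  have 2: "(\<exists>w. R (\<lambda>i. w (2 * i + 1))) \<longleftrightarrow> (\<exists>w. R w)" for R :: "(nat \<Rightarrow> nat) \<Rightarrow> bool"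
  proof -
    have "R (\<lambda>i. mrg w w (2 * i + 1)) \<longleftrightarrow> R w" for w
      by (simp add: mrg)
    then show ?thesis
      by metis
  qed
  have 3: "(\<exists>w. R (\<lambda>i. w (2 * i)) \<and> R' (\<lambda>i. w (2 * i + 1))) \<longleftrightarrow> (\<exists>w. R w) \<and> (\<exists>w. R' w)"
    for R R' :: "(nat \<Rightarrow> nat) \<Rightarrow> bool"
  proof -
    have "R (\<lambda>i. mrg w' w (2 * i)) \<and> R' (\<lambda>i. mrg w' w (2 * i + 1)) \<longleftrightarrow> R w \<and> R' w'" for w w'
      by (simp add: mrg)
    then show ?thesis
      by metis
  qed
  show ?thesis
    by (rule that[of "map_tm f p" "map_tm f q" "map_tm g p'" "map_tm g q'"];
        unfold tval_map_tm f g pq pq')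
      (rule 1[symmetric] 2[symmetric] 3[symmetric])+
qed

text \<open>This is \<open>(a - b)^2 + (c - d)^2 = 0\<close> with the negative terms moved to the
  other side; \<open>prod_zero_eq\<close> treats \<open>(a - b) * (c - d) = 0\<close>
  likewise.\<close>

lemma sq_sum_eq:
  fixes a b c d :: nat
  shows "a * a + b * b + (c * c + d * d) = 2 * (a * b) + 2 * (c * d) \<longleftrightarrow> a = b \<and> c = d"
proof
  assume "a * a + b * b + (c * c + d * d) = 2 * (a * b) + 2 * (c * d)"
  then have "int (a * a + b * b + (c * c + d * d)) = int (2 * (a * b) + 2 * (c * d))" by simp
  then have "(int a - int b)\<^sup>2 + (int c - int d)\<^sup>2 = 0" by (simp add: power2_eq_square algebra_simps)
  then show "a = b \<and> c = d" by (simp add: sum_power2_eq_zero_iff)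
qed simp

lemma prod_zero_eq:
  fixes a b c d :: nat
  shows "a * c + b * d = a * d + b * c \<longleftrightarrow> a = b \<or> c = d"
proof
  assume "a * c + b * d = a * d + b * c"
  then have "int (a * c + b * d) = int (a * d + b * c)" by simp
  then have "(int a - int b) * (int c - int d) = 0" by (simp add: algebra_simps)
  then show "a = b \<or> c = d" by simp
qed auto

lemma dioph_conj: "dioph P \<Longrightarrow> dioph Q \<Longrightarrow> dioph (\<lambda>v. P v \<and> Q v)"
proof -
  assume "dioph P" "dioph Q"
  then obtain p q p' q' :: "(nat + nat) tm" where pq: "\<And>v. P v \<and> Q v \<longleftrightarrow>
      (\<exists>w. tval (case_sum v w) p = tval (case_sum v w) q \<and> tval (case_sum v w) p' = tval (case_sum v w) q')"
    using dioph_pair by metis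
  define T where "T a b = Add (Mul a a) (Mul b b)" for a b :: "(nat + nat) tm"
  define U where "U a b = Mul (Cst 2) (Mul a b)" for a b :: "(nat + nat) tm"
  show ?thesis
    unfolding dioph_def
    by (rule exI[of _ "Add (T p q) (T p' q')"], rule exI[of _ "Add (U p q) (U p' q')"])
      (simp add: pq T_def U_def sq_sum_eq)
qed

lemma dioph_disj: "dioph P \<Longrightarrow> dioph Q \<Longrightarrow> dioph (\<lambda>v. P v \<or> Q v)"
proof -
  assume "dioph P" "dioph Q"
  then obtain p q p' q' :: "(nat + nat) tm" where pq: "\<And>v. P v \<longleftrightarrow> (\<exists>w. tval (case_sum v w) p = tval (case_sum v w) q)"
    "\<And>v. Q v \<longleftrightarrow> (\<exists>w. tval (case_sum v w) p' = tval (case_sum v w) q')"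
    using dioph_pair by metis
  show ?thesis
    unfolding dioph_def
    by (rule exI[of _ "Add (Mul p p') (Mul q q')"], rule exI[of _ "Add (Mul p q') (Mul q p')"])
      (auto simp: pq prod_zero_eq)
qed

lemma dioph_tm_eq: "dioph (\<lambda>v. tval v p = tval v q)"
  unfolding dioph_def
  by (rule exI[of _ "map_tm Inl p"], rule exI[of _ "map_tm Inl q"]) (simp add: tval_map_tm)

text \<open>Naming a function value by an unknown gives closure under composition. So later rules
  need a proof for plain variables only.\<close>

lemma dioph_app1: "dioph (\<lambda>v. R (v 0)) \<Longrightarrow> dfun f \<Longrightarrow> dioph (\<lambda>v. R (f v))"
proof -
  assume R: "dioph (\<lambda>v. R (v 0))" and f: "dfun f"
  have "dioph (\<lambda>v. \<exists>x. x = f v \<and> R x)"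
    by (rule dioph_ex, rule dioph_conj[OF f[unfolded dfun_def] R])
  then show ?thesis by simp
qed

lemma dfun_rename: "dfun f \<Longrightarrow> dfun (\<lambda>v. f (\<lambda>i. v (\<sigma> i)))"
proof -
  assume "dfun f"
  then have "dioph (\<lambda>v. v (case_nat 0 (\<lambda>i. Suc (\<sigma> i)) 0) = f (\<lambda>i. v (case_nat 0 (\<lambda>i. Suc (\<sigma> i)) (Suc i))))"
    unfolding dfun_def by (rule dioph_rename)
  then show ?thesis by (simp add: dfun_def)
qed

lemma dioph_app2:
  assumes R: "dioph (\<lambda>v. R (v 0) (v 1))" and f: "dfun f" and g: "dfun g"
  shows "dioph (\<lambda>v. R (f v) (g v))"
proof -
  have 1: "dioph (\<lambda>v. v 1 = f (\<lambda>i. v (Suc (Suc i))))"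
    using dioph_rename[OF f[unfolded dfun_def], of "case_nat 1 (\<lambda>i. Suc (Suc i))"] by simp
  have 2: "dioph (\<lambda>v. v 0 = g (\<lambda>i. v (Suc (Suc i))))"
    using dioph_rename[OF g[unfolded dfun_def], of "case_nat 0 (\<lambda>i. Suc (Suc i))"] by simp
  have 3: "dioph (\<lambda>v. R (v 1) (v 0))"
    using dioph_rename[OF R, of "case_nat 1 (\<lambda>i. 0)"] by simp
  have "dioph (\<lambda>v. \<exists>x y. x = f v \<and> y = g v \<and> R x y)"
    using 1 2 3 by (intro dioph_ex dioph_conj) simp_all
  then show ?thesis by simp
qed

lemma dioph_app3:
  assumes R: "dioph (\<lambda>v. R (v 0) (v 1) (v 2))" and f: "dfun f" and g: "dfun g" and h: "dfun h"
  shows "dioph (\<lambda>v. R (f v) (g v) (h v))"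
proof -
  have 1: "dioph (\<lambda>v. v 2 = f (\<lambda>i. v (Suc (Suc (Suc i)))))"
    using dioph_rename[OF f[unfolded dfun_def], of "case_nat 2 (\<lambda>i. Suc (Suc (Suc i)))"] by simp
  have 2: "dioph (\<lambda>v. v 1 = g (\<lambda>i. v (Suc (Suc (Suc i)))))"
    using dioph_rename[OF g[unfolded dfun_def], of "case_nat 1 (\<lambda>i. Suc (Suc (Suc i)))"] by simp
  have 3: "dioph (\<lambda>v. v 0 = h (\<lambda>i. v (Suc (Suc (Suc i)))))"
    using dioph_rename[OF h[unfolded dfun_def], of "case_nat 0 (\<lambda>i. Suc (Suc (Suc i)))"] by simp
  have 4: "dioph (\<lambda>v. R (v 2) (v 1) (v 0))"
    using dioph_rename[OF R, of "\<lambda>i. 2 - i"] by simp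
  have "dioph (\<lambda>v. \<exists>x y z. x = f v \<and> y = g v \<and> z = h v \<and> R x y z)"
    using 1 2 3 4 by (intro dioph_ex dioph_conj) (simp_all add: numeral_2_eq_2)
  then show ?thesis by simp
qed

section \<open>Closure rules for Diophantine functions and predicates\<close>

lemma dfun_var: "dfun (\<lambda>v. v i)"
  using dioph_tm_eq[of "Var 0" "Var (Suc i)"] by (simp add: dfun_def)

lemma dfun_app2:
  assumes "dfun (\<lambda>v. F (v 0) (v 1))" "dfun f" "dfun g"
  shows "dfun (\<lambda>v. F (f v) (g v))"
proof -
  have "dioph (\<lambda>v. v 0 = F (v 1) (v 2))"
    using assms(1) by (simp add: dfun_def numeral_2_eq_2)
  then show ?thesis
    unfolding dfun_def
    by (rule dioph_app3[of "\<lambda>x y z. x = F y z"]) (intro dfun_var dfun_rename[of _ Suc] assms)+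
qed

lemma dfun_tm: "dfun (\<lambda>v. tval v t)"
  using dioph_tm_eq[of "Var 0" "map_tm Suc t"] by (simp add: dfun_def tval_map_tm)

named_theorems dioph_intros

lemma dfun_const [dioph_intros]: "dfun (\<lambda>v. c)"
  using dfun_tm[of "Cst c"] by simp

lemmas [dioph_intros] = dfun_var dioph_ex dioph_conj dioph_disj

lemma dfun_add [dioph_intros]: "dfun f \<Longrightarrow> dfun g \<Longrightarrow> dfun (\<lambda>v. f v + g v)"
  using dfun_app2[of "(+)"] dfun_tm[of "Add (Var 0) (Var 1)"] by simp

lemma dfun_Suc [dioph_intros]: "dfun f \<Longrightarrow> dfun (\<lambda>v. Suc (f v))"
  using dfun_add[of f "\<lambda>_. 1"] dfun_const by simp

lemma dfun_mult [dioph_intros]: "dfun f \<Longrightarrow> dfun g \<Longrightarrow> dfun (\<lambda>v. f v * g v)"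
  using dfun_app2[of "(*)"] dfun_tm[of "Mul (Var 0) (Var 1)"] by simp

lemma dioph_eq [dioph_intros]: "dfun f \<Longrightarrow> dfun g \<Longrightarrow> dioph (\<lambda>v. f v = g v)"
  by (rule dioph_app2[of "(=)"]) (use dioph_tm_eq[of "Var 0" "Var 1"] in auto)

lemma dioph_const [dioph_intros]: "dioph (\<lambda>v. b)"
  by (rule dioph_iff[OF dioph_tm_eq[of "Cst 0" "Cst (if b then 0 else 1)"]]) simp

lemma dioph_le [dioph_intros]: "dfun f \<Longrightarrow> dfun g \<Longrightarrow> dioph (\<lambda>v. f v \<le> g v)"
proof -
  have "dioph (\<lambda>v. \<exists>z. v 1 = v 0 + z)"
    by (intro dioph_intros)
  then have "dioph (\<lambda>v. v 0 \<le> v 1)"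
    by (rule dioph_iff) (simp add: le_iff_add)
  then show "dfun f \<Longrightarrow> dfun g \<Longrightarrow> ?thesis"
    by (rule dioph_app2)
qed

lemma dioph_less [dioph_intros]: "dfun f \<Longrightarrow> dfun g \<Longrightarrow> dioph (\<lambda>v. f v < g v)"
  by (simp only: less_eq_Suc_le) (intro dioph_intros)

lemma dioph_dvd [dioph_intros]: "dfun f \<Longrightarrow> dfun g \<Longrightarrow> dioph (\<lambda>v. f v dvd g v)"
proof -
  have "dioph (\<lambda>v. \<exists>z. v 1 = v 0 * z)"
    by (intro dioph_intros)
  then have "dioph (\<lambda>v. v 0 dvd v 1)"
    by (rule dioph_iff) (simp add: dvd_def)
  then show "dfun f \<Longrightarrow> dfun g \<Longrightarrow> ?thesis"
    by (rule dioph_app2)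
qed

lemma dioph_cong [dioph_intros]:
  assumes "dfun f" "dfun g" "dfun h"
  shows "dioph (\<lambda>v. [f v = g v] (mod h v))"
proof -
  have "dioph (\<lambda>v. \<exists>r s. g v + r * h v = f v + s * h v)"
    by (intro dioph_intros dfun_rename[of _ Suc] assms dfun_rename[of f "\<lambda>i. Suc (Suc i)"]
        dfun_rename[of g "\<lambda>i. Suc (Suc i)"] dfun_rename[of h "\<lambda>i. Suc (Suc i)"])
  then show ?thesis
    by (rule dioph_iff) (simp add: cong_iff_lin_nat)
qed

lemma dfun_graphI: "dioph (\<lambda>v. R (v 0) (\<lambda>i. v (Suc i))) \<Longrightarrow> (\<And>x v. R x v \<longleftrightarrow> x = f v) \<Longrightarrow> dfun f"
  by (simp add: dfun_def)

lemma dfun_div [dioph_intros]: "dfun f \<Longrightarrow> dfun g \<Longrightarrow> dfun (\<lambda>v. f v div g v)"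
proof -
  have "dfun (\<lambda>v. v 0 div v 1)"
  proof (rule dfun_graphI)
    \<comment> \<open>The first disjunct is division by zero, whose value is 0.\<close>
    show "dioph (\<lambda>v. (v (Suc 1) = 0 \<and> v 0 = 0) \<or> (v 0 * v (Suc 1) \<le> v (Suc 0) \<and> v (Suc 0) < Suc (v 0) * v (Suc 1)))"
      by (intro dioph_intros)
  next
    fix x and v :: "nat \<Rightarrow> nat"
    show "v 1 = 0 \<and> x = 0 \<or> x * v 1 \<le> v 0 \<and> v 0 < Suc x * v 1 \<longleftrightarrow> x = v 0 div v 1"
    proof (cases "v 1 = 0")
      case False
      then have "x * v 1 \<le> v 0 \<longleftrightarrow> x \<le> v 0 div v 1" "v 0 < Suc x * v 1 \<longleftrightarrow> v 0 div v 1 < Suc x"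
        by (simp_all only: less_eq_div_iff_mult_less_eq div_less_iff_less_mult neq0_conv)
      then show ?thesis
        using False by auto
    qed simp
  qed
  then show "dfun f \<Longrightarrow> dfun g \<Longrightarrow> ?thesis"
    by (rule dfun_app2)
qed

lemma dfun_diff [dioph_intros]: "dfun f \<Longrightarrow> dfun g \<Longrightarrow> dfun (\<lambda>v. f v - g v)"
proof -
  have "dfun (\<lambda>v. v 0 - v 1)"
  proof (rule dfun_graphI)
    show "dioph (\<lambda>v. v (Suc 0) \<le> v (Suc 1) \<and> v 0 = 0 \<or> v (Suc 0) = v 0 + v (Suc 1))"
      by (intro dioph_intros)
  qed auto
  then show "dfun f \<Longrightarrow> dfun g \<Longrightarrow> ?thesis"
    by (rule dfun_app2)
qed

lemma dfun_mod [dioph_intros]: "dfun f \<Longrightarrow> dfun g \<Longrightarrow> dfun (\<lambda>v. f v mod g v)"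
  unfolding modulo_nat_def by (intro dioph_intros)


section \<open>Solutions of the Pell equation\<close>

text \<open>These are the coefficients of \<open>(a + sqrt (a * a - 1)) ^ n = px a n + py a n * sqrt
  (a * a - 1)\<close>.\<close>

fun px :: "int \<Rightarrow> nat \<Rightarrow> int" and py :: "int \<Rightarrow> nat \<Rightarrow> int" where
  "px a 0 = 1"
| "py a 0 = 0"
| "px a (Suc n) = a * px a n + (a * a - 1) * py a n"
| "py a (Suc n) = px a n + a * py a n"

lemma pell_eq: "px a n * px a n - (a * a - 1) * (py a n * py a n) = 1"
proof (induction n)
  case (Suc n)
  then show ?case unfolding px.simps py.simps by algebra
qed simp

lemma pell_add:
  "px a (m + n) = px a m * px a n + (a * a - 1) * (py a m * py a n) \<and>
   py a (m + n) = px a m * py a n + py a m * px a n"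
proof (induction m)
  case (Suc m)
  show ?case
    unfolding add_Suc px.simps py.simps Suc[THEN conjunct1] Suc[THEN conjunct2]
    by (simp add: algebra_simps)
qed simp

lemmas px_add = pell_add[THEN conjunct1] and py_add = pell_add[THEN conjunct2]

lemma px_py_nonneg: "a \<ge> 1 \<Longrightarrow> px a n \<ge> 1 \<and> py a n \<ge> 0"
proof (induction n)
  case (Suc n)
  have "1 * 1 \<le> a * px a n" using Suc by (intro mult_mono) auto
  moreover have "1 * 1 \<le> a * a" using Suc by (intro mult_mono) auto
  then have "0 \<le> (a * a - 1) * py a n" using Suc by simp
  ultimately have "1 * 1 + 0 \<le> a * px a n + (a * a - 1) * py a n" by (intro add_mono)
  then show ?case using Suc by simp
qed simp

lemma px_ge_1: "a \<ge> 1 \<Longrightarrow> px a n \<ge> 1" and py_nonneg: "a \<ge> 1 \<Longrightarrow> py a n \<ge> 0"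
  using px_py_nonneg by auto

lemma px_Suc_ge:
  assumes "a \<ge> 1"
  shows "a * px a n \<le> px a (Suc n)"
proof -
  have "1 * 1 \<le> a * a" using assms by (intro mult_mono) auto
  then show ?thesis
    using py_nonneg[OF assms, of n] by simp
qed

lemma px_strict_mono:
  assumes "a \<ge> 2"
  shows "strict_mono (px a)"
  unfolding strict_mono_Suc_iff
proof
  fix n
  have "px a n < 2 * px a n" using px_ge_1[of a n] assms by simp
  also have "\<dots> \<le> a * px a n" using px_ge_1[of a n] assms by (intro mult_right_mono) auto
  also have "\<dots> \<le> px a (Suc n)" using assms by (intro px_Suc_ge) auto
  finally show "px a n < px a (Suc n)" .
qed

lemma py_Suc_ge: "a \<ge> 1 \<Longrightarrow> a * py a n < py a (Suc n)"
  using px_ge_1[of a n] by simp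

lemma py_strict_mono:
  assumes "a \<ge> 1"
  shows "strict_mono (py a)"
  unfolding strict_mono_Suc_iff
proof
  fix n
  have "1 * py a n \<le> a * py a n"
    using assms py_nonneg[of a n] by (intro mult_right_mono) auto
  also have "\<dots> < py a (Suc n)" using assms by (rule py_Suc_ge)
  finally show "py a n < py a (Suc n)" by simp
qed

lemma py_ge_index: "a \<ge> 1 \<Longrightarrow> int n \<le> py a n"
proof (induction n)
  case (Suc n)
  then show ?case using strict_monoD[OF py_strict_mono, of a n "Suc n"] by simp
qed simp

lemma py_ge_power: "a \<ge> 1 \<Longrightarrow> a ^ n \<le> py a (Suc n)"
proof (induction n)
  case (Suc n)
  have "a ^ Suc n \<le> a * py a (Suc n)" using Suc by simp
  also have "\<dots> \<le> py a (Suc (Suc n))" using py_Suc_ge[OF Suc.prems, of "Suc n"] by linarith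
  finally show ?case .
qed simp

lemma int_le_if_square_le: "x * x \<le> y * y \<Longrightarrow> 0 \<le> y \<Longrightarrow> x \<le> (y::int)"
  by (rule power2_le_imp_le) (simp_all only: power2_eq_square)

lemma int_less_if_square_less: "x * x < y * y \<Longrightarrow> 0 \<le> y \<Longrightarrow> x < (y::int)"
  by (rule power2_less_imp_less) (simp_all only: power2_eq_square)

text \<open>Descent: multiplication by the inverse \<open>a - sqrt (a * a - 1)\<close> of the
  fundamental solution yields a nonnegative solution with smaller \<open>y\<close>, until
  \<open>y = 0\<close>.\<close>

lemma pell_solution:
  assumes a: "a \<ge> 2" and "x \<ge> 0" "y \<ge> 0" "x * x - (a * a - 1) * (y * y) = 1"
  shows "\<exists>n. x = px a n \<and> y = py a n"
  using assms(2-)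
proof (induction "nat y" arbitrary: x y rule: less_induct)
  case less
  show ?case
  proof (cases "y = 0")
    case True
    then have "x * x = 1" using less by simp
    then have "x = 1" using less.prems(1) by (auto simp: square_eq_1_iff)
    then show ?thesis using True by (intro exI[of _ 0]) simp
  next
    case False
    with less have y: "y > 0" by simp
    define x' y' where "x' = a * x - (a * a - 1) * y" and "y' = a * y - x"
    have eq: "x' * x' - (a * a - 1) * (y' * y') = 1"
      using less.prems(3) unfolding x'_def y'_def by algebra
    have yy: "1 \<le> y * y" using y mult_mono[of 1 y 1 y] by simp
    have "x * x \<le> (a * y) * (a * y)"
      using less.prems(3) yy by (simp add: algebra_simps)
    then have "x \<le> a * y"
      by (rule int_le_if_square_le) (use y a in simp)
    moreover have "((a - 1) * y) * ((a - 1) * y) < x * x"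
    proof -
      have "2 * (y * y) \<le> a * (y * y)" using a yy by (intro mult_right_mono) auto
      moreover have "((a - 1) * y) * ((a - 1) * y) = a * a * (y * y) - 2 * (a * (y * y)) + y * y"
        by algebra
      moreover have "x * x = a * a * (y * y) - y * y + 1"
        using less.prems(3) by algebra
      ultimately show ?thesis using yy by linarith
    qed
    then have "(a - 1) * y < x"
      by (rule int_less_if_square_less) (rule less.prems(1))
    ultimately have y': "0 \<le> y'" "y' < y"
      by (auto simp: y'_def algebra_simps)
    have "((a * a - 1) * y) * ((a * a - 1) * y) \<le> (a * x) * (a * x)"
    proof -
      have "(a * x) * (a * x) - ((a * a - 1) * y) * ((a * a - 1) * y) = a * a + (a * a - 1) * (y * y)"
        using less.prems(3) by algebra
      moreover have "1 * 1 \<le> a * a" using a by (intro mult_mono) auto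
      then have "0 \<le> (a * a - 1) * (y * y)" using yy by simp
      moreover have "0 \<le> a * a" by simp
      ultimately show ?thesis by linarith
    qed
    then have "(a * a - 1) * y \<le> a * x"
      by (rule int_le_if_square_le) (use less.prems(1) a in simp)
    then have x': "0 \<le> x'" by (simp add: x'_def)
    have "nat y' < nat y" using y' y by simp
    then obtain n where n: "x' = px a n" "y' = py a n"
      using less.hyps x' y'(1) eq by blast
    have "x = px a (Suc n)" "y = py a (Suc n)"
      unfolding px.simps py.simps n[symmetric] x'_def y'_def by algebra+
    then show ?thesis by blast
  qed
qed

text \<open>Modulo \<open>a - 1\<close> the value \<open>py a n\<close> reveals its index. In
  \<open>py_diophantine\<close> an auxiliary base congruent to 1 makes use of this.\<close>

lemma px_py_cong_1: "[px a n = 1] (mod a - 1) \<and> [py a n = int n] (mod a - 1)"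
proof (induction n)
  case (Suc n)
  have a: "[a = 1] (mod a - 1)" by (simp add: cong_iff_dvd_diff)
  have d: "[a * a - 1 = 0] (mod a - 1)"
  proof -
    have "a * a - 1 = (a - 1) * (a + 1)" by (simp add: algebra_simps)
    then show ?thesis by (simp add: cong_0_iff)
  qed
  have "[px a (Suc n) = 1 * 1 + 0 * int n] (mod a - 1)"
    unfolding px.simps using Suc a d by (intro cong_add cong_mult) auto
  moreover have "[py a (Suc n) = 1 + 1 * int n] (mod a - 1)"
    unfolding py.simps using Suc a by (intro cong_add cong_mult) auto
  ultimately show ?case by simp
qed simp

lemma px_py_cong_base: "[a = b] (mod c) \<Longrightarrow> [px a n = px b n] (mod c) \<and> [py a n = py b n] (mod c)"
proof (induction n)
  case (Suc n)
  then show ?case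
    unfolding px.simps py.simps by (intro conjI cong_add cong_mult cong_diff) auto
qed simp

lemma coprime_px_py: "coprime (px a n) (py a n)"
proof (rule coprimeI)
  fix c assume "c dvd px a n" "c dvd py a n"
  then have "c dvd px a n * px a n - (a * a - 1) * (py a n * py a n)"
    by (intro dvd_diff) auto
  then show "is_unit c" by (simp add: pell_eq)
qed

lemma py_dvd_py_mult: "py a n dvd py a (n * k)"
  by (induction k) (auto simp: py_add)

text \<open>For \<open>t = n * q + r\<close> the addition formula and coprimality leave
  \<open>py a n dvd py a r\<close>, which is impossible for \<open>0 < r < n\<close> because
  \<open>py\<close> increases strictly.\<close>

lemma py_dvd_imp_dvd:
  assumes a: "a \<ge> 1" and n: "n > 0" and dvd: "py a n dvd py a t"
  shows "n dvd t"
proof -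
  define r q where "r = t mod n" and "q = t div n"
  have t: "t = n * q + r" by (simp add: r_def q_def)
  have "coprime (py a (n * q)) (px a (n * q))"
    using coprime_px_py coprime_commute by blast
  then have "coprime (py a n) (px a (n * q))"
    using py_dvd_py_mult coprime_divisors dvd_refl by blast
  moreover have "py a n dvd px a (n * q) * py a r"
    using dvd py_dvd_py_mult[of a n q] unfolding t py_add
    by (metis dvd_add_left_iff dvd_mult2)
  ultimately have "py a n dvd py a r"
    by (simp add: coprime_dvd_mult_right_iff)
  moreover have "py a r < py a n"
    using n by (intro strict_monoD[OF py_strict_mono[OF a]]) (simp add: r_def)
  ultimately have "\<not> 0 < py a r"
    using zdvd_imp_le by fastforce
  then have "r = 0"
    using strict_monoD[OF py_strict_mono[OF a], of 0 r] by (cases r) auto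
  then show ?thesis
    by (simp add: r_def mod_eq_0_iff_dvd)
qed

text \<open>Binomial expansion of the \<open>k\<close>-th power of
  \<open>px a n + py a n * sqrt (a * a - 1)\<close>: modulo the square of \<open>py a n\<close> only
  the linear term of \<open>py\<close> survives. The extra factor \<open>px a n\<close> avoids the
  exponent \<open>k - 1\<close>.\<close>

lemma px_py_mult_cong:
  "[px a (n * k) = px a n ^ k] (mod py a n) \<and>
   [px a n * py a (n * k) = int k * px a n ^ k * py a n] (mod py a n * py a n)"
proof (induction k)
  case (Suc k)
  have "[px a (n * Suc k) = px a n * px a n ^ k + (a * a - 1) * (0 * py a (n * k))] (mod py a n)"
    unfolding mult_Suc_right px_add using Suc
    by (intro cong_add cong_mult) (auto simp: cong_0_iff)
  moreover have "[px a n * py a (n * Suc k) = int (Suc k) * px a n ^ Suc k * py a n] (mod py a n * py a n)"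
  proof -
    have 1: "px a n * py a (n * Suc k) = px a n * (px a n * py a (n * k)) + px a n * (px a (n * k) * py a n)"
      by (simp add: py_add algebra_simps)
    have "py a n * py a n dvd (px a (n * k) - px a n ^ k) * py a n"
      using Suc by (intro mult_dvd_mono) (auto simp: cong_iff_dvd_diff)
    then have 2: "[px a (n * k) * py a n = px a n ^ k * py a n] (mod py a n * py a n)"
      by (simp only: cong_iff_dvd_diff left_diff_distrib)
    have "[px a n * py a (n * Suc k) = px a n * (int k * px a n ^ k * py a n) + px a n * (px a n ^ k * py a n)]
        (mod py a n * py a n)"
      unfolding 1 using Suc 2 by (intro cong_add cong_scalar_left) blast+
    then show ?thesis by (simp add: algebra_simps)
  qed
  ultimately show ?case by simp
qed simp

lemma coprime_py_px_power: "coprime (py a n * py a n) (px a n ^ k)"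
  using coprime_px_py[of a n] by (simp add: coprime_commute)

text \<open>For \<open>k = py a n\<close> the linear term of the expansion contains
  \<open>py a n\<close> twice.\<close>

lemma py_sq_dvd: "py a n * py a n dvd py a (n * nat (py a n))" if "a \<ge> 1"
proof -
  have "[px a n * py a (n * nat (py a n)) = 0] (mod py a n * py a n)"
    using px_py_mult_cong[of a n "nat (py a n)", THEN conjunct2] py_nonneg[OF that, of n]
    by (simp add: cong_def mult.assoc mult.left_commute[of "py a n"])
  then show ?thesis
    using coprime_py_px_power[of a n 1] by (simp add: cong_0_iff coprime_dvd_mult_right_iff)
qed

text \<open>This converts a divisibility between values into one that concerns an index: the value
  \<open>py a n\<close> divides \<open>t\<close> itself.\<close>

lemma py_sq_dvd_imp:
  assumes a: "a \<ge> 1" and n: "n > 0" and dvd: "py a n * py a n dvd py a t"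
  shows "py a n dvd int t"
proof -
  have "n dvd t"
    using py_dvd_imp_dvd[OF a n] dvd dvd_mult_left by blast
  then obtain k where t: "t = n * k" by auto
  have y: "py a n > 0"
    using strict_monoD[OF py_strict_mono[OF a], of 0 n] n by simp
  have "py a n * py a n dvd px a n * py a (n * k)"
    using dvd by (simp add: t)
  then have "py a n * py a n dvd int k * px a n ^ k * py a n"
    using cong_dvd_iff[OF px_py_mult_cong[of a n k, THEN conjunct2]] by blast
  then have "py a n dvd int k * px a n ^ k"
    using y by simp
  then have "py a n dvd int k"
    using coprime_py_px_power[of a n k] by (simp add: coprime_dvd_mult_left_iff)
  then show ?thesis
    by (simp add: t)
qed

lemma px_double: "[px a (2 * n) = -1] (mod px a n)" and py_double: "[py a (2 * n) = 0] (mod px a n)"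
proof -
  have "px a (2 * n) - (-1) = 2 * (px a n * px a n)"
    using pell_eq[of a n] unfolding mult_2 px_add by linarith
  then show "[px a (2 * n) = -1] (mod px a n)"
    unfolding cong_iff_dvd_diff by simp
  show "[py a (2 * n) = 0] (mod px a n)"
    unfolding mult_2 py_add by (simp add: cong_0_iff)
qed

lemma px_double_add: "[px a (2 * n + r) = - px a r] (mod px a n)"
proof -
  have "[px a (2 * n + r) = -1 * px a r + (a * a - 1) * (0 * py a r)] (mod px a n)"
    unfolding px_add by (intro cong_add cong_mult px_double py_double) auto
  then show ?thesis by simp
qed

lemma px_double_diff:
  assumes "r \<le> 2 * n"
  shows "[px a (2 * n - r) = - px a r] (mod px a n)"
proof -
  define s where "s = 2 * n - r"
  have s: "2 * n = s + r" using assms by (simp add: s_def)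
  have "px a s = px a (2 * n) * px a r - (a * a - 1) * (py a (2 * n) * py a r)"
    unfolding s px_add py_add using pell_eq[of a r] by algebra
  moreover have "[\<dots> = -1 * px a r - (a * a - 1) * (0 * py a r)] (mod px a n)"
    by (intro cong_diff cong_mult px_double py_double) auto
  ultimately show ?thesis by (simp add: s_def)
qed

text \<open>Modulo \<open>px a n\<close> the sequence changes sign under the shift by
  \<open>2 * n\<close> and under the reflection of \<open>j\<close> to \<open>2 * n - j\<close>, so
  every index folds into the range up to \<open>n\<close>. Here \<open>e\<close> is the accumulated
  sign and \<open>s\<close> the direction; \<open>(1 - e) * n\<close> is the half period
  \<open>2 * n\<close> precisely if the sign is negative.\<close>

lemma px_reduce:
  assumes "n > 0"
  shows "\<exists>j' e s. j' \<le> n \<and> e \<in> {1, -1} \<and> s \<in> {1, -1} \<and> [px a j = e * px a j'] (mod px a n) \<and>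
    4 * int n dvd int j - (1 - e) * int n - s * int j'"
proof (induction j rule: less_induct)
  case (less j)
  consider "j \<le> n" | "n < j" "j \<le> 2 * n" | "2 * n < j" by linarith
  then show ?case
  proof cases
    case 1
    then show ?thesis
      by (intro exI[of _ j] exI[of _ 1]) simp
  next
    case 2
    have "[px a (2 * n - (2 * n - j)) = - px a (2 * n - j)] (mod px a n)"
      by (rule px_double_diff) simp
    then show ?thesis
      using 2 by (intro exI[of _ "2 * n - j"] exI[of _ "-1"]) (simp add: of_nat_diff)
  next
    case 3
    then obtain j' e s where *: "j' \<le> n" "e \<in> {1, -1}" "s \<in> {1, -1}"
        "[px a (j - 2 * n) = e * px a j'] (mod px a n)"
        "4 * int n dvd int (j - 2 * n) - (1 - e) * int n - s * int j'"
      using less[of "j - 2 * n"] assms by auto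
    have "[px a (2 * n + (j - 2 * n)) = - px a (j - 2 * n)] (mod px a n)"
      by (rule px_double_add)
    moreover have "[- px a (j - 2 * n) = - (e * px a j')] (mod px a n)"
      using *(4) by (simp add: cong_minus_minus_iff)
    ultimately have "[px a (2 * n + (j - 2 * n)) = - (e * px a j')] (mod px a n)"
      by (rule cong_trans)
    then have "[px a j = - e * px a j'] (mod px a n)"
      using 3 by simp
    moreover have "4 * int n dvd int j - (1 - (- e)) * int n - s * int j'"
    proof -
      obtain q where "int (j - 2 * n) - (1 - e) * int n - s * int j' = 4 * int n * q"
        using *(5) by blast
      then have "int j - (1 - (- e)) * int n - s * int j' = 4 * int n * q + (1 - e) * (2 * int n)"
        using 3 by (simp add: of_nat_diff algebra_simps)
      then show ?thesis
        using *(2) by (auto simp flip: distrib_left)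
    qed
    ultimately show ?thesis
      using * by (intro exI[of _ j'] exI[of _ "- e"] exI[of _ s]) auto
  qed
qed


section \<open>Exponentiation is Diophantine\<close>

text \<open>The folded indices agree: as \<open>a \<ge> 3\<close>, all \<open>px a m\<close> with
  \<open>m < n\<close> lie below half the modulus, so two signed values among them that are
  congruent must be equal.\<close>

lemma px_cong_imp:
  assumes a: "a \<ge> 3" and n: "n > 0" and ij: "[px a i = px a j] (mod px a n)"
  shows "4 * int n dvd int i - int j \<or> 4 * int n dvd int i + int j"
proof -
  obtain k e s where i: "k \<le> n" "e \<in> {1, -1}" "s \<in> {1, -1}" "[px a i = e * px a k] (mod px a n)"
      "4 * int n dvd int i - (1 - e) * int n - s * int k"
    using px_reduce[OF n] by blast
  obtain l f t where j: "l \<le> n" "f \<in> {1, -1}" "t \<in> {1, -1}" "[px a j = f * px a l] (mod px a n)"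
      "4 * int n dvd int j - (1 - f) * int n - t * int l"
    using px_reduce[OF n] by blast
  have pos: "px a m \<ge> 1" for m
    using px_ge_1 a by simp
  have mono: "px a m < px a m' \<longleftrightarrow> m < m'" "px a m \<le> px a m' \<longleftrightarrow> m \<le> m'" for m m'
    using px_strict_mono[of a] a by (simp_all add: strict_mono_less strict_mono_less_eq)
  have small: "2 * px a m < px a n" if "m < n" for m
  proof -
    have "2 * px a m < 3 * px a m" using pos[of m] by simp
    also have "\<dots> \<le> a * px a m" using pos[of m] a by (intro mult_right_mono) auto
    also have "\<dots> \<le> px a (Suc m)" using a by (intro px_Suc_ge) auto
    also have "\<dots> \<le> px a n" using that unfolding mono by simp
    finally show ?thesis .
  qed
  have c: "[e * px a k = f * px a l] (mod px a n)"
    using i(4) j(4) ij cong_trans cong_sym by meson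
  have eq: "k = l \<and> (e = f \<or> k = n)"
  proof (cases "k < n \<and> l < n")
    case True
    have "px a n dvd e * px a k - f * px a l"
      using c by (simp add: cong_iff_dvd_diff)
    moreover have "\<bar>e * px a k - f * px a l\<bar> < px a n"
      using small[of k] small[of l] True i(2) j(2) pos[of k] pos[of l] by auto
    ultimately have 0: "e * px a k = f * px a l"
      using zdvd_not_zless[of "\<bar>e * px a k - f * px a l\<bar>" "px a n"] by auto
    then have "e = f"
      using i(2) j(2) pos[of k] pos[of l] by auto
    then have "px a k = px a l"
      using 0 i(2) by auto
    then have "k = l"
      using mono(2)[of k l] mono(2)[of l k] by simp
    then show ?thesis
      using \<open>e = f\<close> by simp
  next
    case False
    have *: "m' = n" if "[e' * px a n = f' * px a m'] (mod px a n)" "f' \<in> {1, -1}" "m' \<le> n" for e' f' m'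
    proof -
      have "px a n dvd f' * px a m'"
        using cong_dvd_iff[OF that(1)] by simp
      then have "px a n dvd px a m'"
        using that(2) by auto
      then have "px a n \<le> px a m'"
        using pos[of m'] by (intro zdvd_imp_le) auto
      then show ?thesis
        using mono that(3) by simp
    qed
    show ?thesis
      using False i(1) j(1) *[of e f l] *[of f e k] c cong_sym[OF c] i(2) j(2) by (auto simp: le_less)
  qed
  obtain p where p: "int i - (1 - e) * int n - s * int k = 4 * int n * p"
    using i(5) by blast
  obtain q where q: "int j - (1 - f) * int n - t * int l = 4 * int n * q"
    using j(5) by blast
  show ?thesis
  \<comment> \<open>For \<open>k = n\<close> the folded value is 0 modulo \<open>px a n\<close>, so
    the signs \<open>e\<close> and \<open>f\<close> are unrelated. But then \<open>i\<close> and
    \<open>j\<close> are odd multiples of \<open>n\<close>, and of two odd numbers either the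
    difference or the sum is divisible by 4.\<close>
  proof (cases "k = n")
    case True
    then have 1: "int i = int n * (1 - e + s + 4 * p)" "int j = int n * (1 - f + t + 4 * q)"
      using p q eq by (auto simp: algebra_simps)
    have "4 dvd (1 - e + s + 4 * p) - (1 - f + t + 4 * q) \<or> 4 dvd (1 - e + s + 4 * p) + (1 - f + t + 4 * q)"
      using i(2,3) j(2,3) by (elim insertE emptyE; simp; presburger)
    then have "int n * 4 dvd int n * ((1 - e + s + 4 * p) - (1 - f + t + 4 * q)) \<or>
        int n * 4 dvd int n * ((1 - e + s + 4 * p) + (1 - f + t + 4 * q))"
      by (metis mult_dvd_mono dvd_refl)
    then show ?thesis
      unfolding 1 by (simp only: distrib_left right_diff_distrib mult.commute)
  next
    case False
    then have ef: "e = f" "l = k" using eq by auto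
    show ?thesis
    proof (cases "s = t")
      case True
      then have "int i - int j = 4 * int n * (p - q)"
        using p q ef by (simp add: algebra_simps)
      then show ?thesis by simp
    next
      case False
      then have "t = - s" using i(3) j(3) by auto
      then have "int i + int j = 4 * int n * (p + q) + 2 * (1 - e) * int n"
        using p q ef by (simp add: algebra_simps)
      then show ?thesis using i(2) by (auto simp flip: distrib_left)
    qed
  qed
qed

text \<open>The three Pell equations yield indices \<open>i\<close>, \<open>n\<close>,
  \<open>j\<close> of \<open>(x, y)\<close>, \<open>(u, v)\<close>, \<open>(s, t)\<close>. From
  \<open>y * y dvd v\<close> follows that \<open>y\<close> divides \<open>n\<close>. The congruences
  modulo \<open>u\<close> give equal \<open>px\<close> at \<open>i\<close> and \<open>j\<close>
  modulo \<open>px a n\<close>, so \<open>i\<close> is \<open>j\<close> or \<open>- j\<close> modulo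
  \<open>4 * n\<close>, hence modulo \<open>4 * y\<close>. The congruences modulo
  \<open>4 * y\<close> identify \<open>j\<close> with \<open>k\<close>. As \<open>i\<close> and
  \<open>k\<close> are at most \<open>y\<close>, this forces \<open>i = k\<close>.\<close>

lemma py_diophantine:
  fixes a k y :: nat
  assumes a: "a \<ge> 3" and k: "k \<ge> 1"
  shows "int y = py (int a) k \<longleftrightarrow> k \<le> y \<and> (\<exists>x u v s t b :: nat.
    x * x + y * y = 1 + a * a * (y * y) \<and> u * u + v * v = 1 + a * a * (v * v) \<and>
    s * s + t * t = 1 + b * b * (t * t) \<and> 2 \<le> b \<and> 0 < v \<and> y * y dvd v \<and>
    [b = 1] (mod 4 * y) \<and> [b = a] (mod u) \<and> [s = x] (mod u) \<and> [t = k] (mod 4 * y))"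
    (is "?L \<longleftrightarrow> ?R")
proof
  have pell: "x * x + y * y = 1 + a * a * (y * y) \<longleftrightarrow>
      int x * int x - (int a * int a - 1) * (int y * int y) = 1" for x y a :: nat
  proof -
    have "x * x + y * y = 1 + a * a * (y * y) \<longleftrightarrow> int (x * x + y * y) = int (1 + a * a * (y * y))"
      by (simp only: of_nat_eq_iff)
    also have "\<dots> \<longleftrightarrow> int x * int x - (int a * int a - 1) * (int y * int y) = 1"
      by (simp add: algebra_simps)
    finally show ?thesis .
  qed
  {
    assume ?L
    define A where "A = int a"
    have A: "A \<ge> 3" using a by (simp add: A_def)
    have y1: "y \<ge> 1" and ky: "k \<le> y"
      using py_ge_index[of A k] A k \<open>?L\<close> by (auto simp: A_def)
    \<comment> \<open>The factor \<open>k * y\<close> makes \<open>y * y\<close> divide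
      \<open>v\<close>. The factor 2 makes \<open>v\<close> even and so \<open>u\<close> odd, hence
      \<open>u\<close> is coprime to \<open>4 * y\<close>, as the Chinese remainder theorem for the
      base \<open>b\<close> requires.\<close>
    define m where "m = 2 * (k * y)"
    define x where "x = nat (px A k)"
    define u where "u = nat (px A m)"
    define v where "v = nat (py A m)"
    have x: "int x = px A k" and u: "int u = px A m" and v: "int v = py A m"
      using px_ge_1[of A] py_nonneg[of A m] A by (auto simp: x_def u_def v_def order.trans[of 0 1])
    have Y: "py A k = int y" using \<open>?L\<close> by (simp add: A_def)
    have "int (y * y) dvd int v"
    proof -
      have "py A k * py A k dvd py A (k * nat (py A k))"
        using A by (intro py_sq_dvd) auto
      also have "\<dots> dvd py A (k * nat (py A k) * 2)"
        by (rule py_dvd_py_mult)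
      finally show ?thesis
        by (simp add: Y v m_def mult_ac)
    qed
    then have yv: "y * y dvd v" by (simp only: of_nat_dvd_iff)
    have v0: "v > 0"
    proof -
      have "1 * 1 \<le> k * y" using k y1 by (intro mult_le_mono)
      then have "int m > 0" by (simp add: m_def)
      then show ?thesis using py_ge_index[of A m] A v by simp
    qed
    have "even (int v)"
      unfolding v m_def mult_2 py_add by simp
    then have vev: "even v" by simp
    have "odd (int u * int u)"
    proof
      assume "even (int u * int u)"
      then have "even (int u * int u - (A * A - 1) * (int v * int v))"
        using vev by simp
      then show False
        using pell_eq[of A m] unfolding u[symmetric] v[symmetric] by simp
    qed
    then have "odd (u * u)" by simp
    then have "coprime u 4"
      by (metis coprime_power_right_iff coprime_right_2_iff_odd even_mult_iff numeral_Bit0 mult_2 power2_eq_square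
          coprime_mult_right_iff numeral_times_numeral num_double)
    moreover have "coprime (int u) (int v)"
      using coprime_px_py[of A m] by (simp add: u v)
    then have "coprime u v" by simp
    then have "coprime u y"
      using yv by (meson coprime_divisors dvd_refl dvd_trans dvd_triv_left)
    ultimately have "coprime (4 * y) u"
      by (simp add: coprime_commute)
    then obtain b0 where b0: "[b0 = 1] (mod 4 * y)" "[b0 = a] (mod u)"
      using binary_chinese_remainder_nat by blast
    \<comment> \<open>A multiple of both moduli is added to ensure \<open>b \<ge> 2\<close>.\<close>
    define b where "b = b0 + 2 * (4 * y * u)"
    have u0: "u \<ge> 1" using px_ge_1[of A m] A u by simp
    have "1 * 1 \<le> y * u" using y1 u0 by (intro mult_le_mono)
    moreover have "b = b0 + 8 * (y * u)" by (simp add: b_def)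
    ultimately have b: "b \<ge> 2" by linarith
    have "[b = b0 + 0] (mod 4 * y)" "[b = b0 + 0] (mod u)"
      unfolding b_def by (intro cong_add cong_refl; simp add: cong_0_iff)+
    then have b1: "[b = 1] (mod 4 * y)" and b2: "[b = a] (mod u)"
      using b0 cong_trans by auto
    define s where "s = nat (px (int b) k)"
    define t where "t = nat (py (int b) k)"
    have s: "int s = px (int b) k" and t: "int t = py (int b) k"
      using px_ge_1[of "int b" k] py_nonneg[of "int b" k] b by (auto simp: s_def t_def)
    have "[int s = int x] (mod int u)"
      unfolding s x using b2 px_py_cong_base[of "int b" A "int u" k] by (simp add: cong_int_iff A_def)
    moreover have "[int t = int k] (mod int (4 * y))"
    proof -
      have "[int b = int 1] (mod int (4 * y))"
        using b1 by (simp only: cong_int_iff)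
      then have "int (4 * y) dvd int b - 1"
        by (simp add: cong_iff_dvd_diff)
      then show ?thesis
        unfolding t using px_py_cong_1[of "int b" k] cong_dvd_modulus by blast
    qed
    ultimately have "[s = x] (mod u)" "[t = k] (mod 4 * y)"
      by (simp_all only: cong_int_iff)
    moreover have "x * x + y * y = 1 + a * a * (y * y)"
      unfolding pell x Y[symmetric] using pell_eq[of A k] by (simp only: A_def)
    moreover have "u * u + v * v = 1 + a * a * (v * v)"
      unfolding pell u v using pell_eq[of A m] by (simp add: A_def)
    moreover have "s * s + t * t = 1 + b * b * (t * t)"
      unfolding pell s t by (rule pell_eq)
    ultimately show ?R
      using ky b v0 yv b1 b2 by blast
  next
    assume ?R
    then obtain x u v s t b :: nat where *:
      "x * x + y * y = 1 + a * a * (y * y)" "u * u + v * v = 1 + a * a * (v * v)"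
      "s * s + t * t = 1 + b * b * (t * t)" "2 \<le> b" "0 < v" "y * y dvd v"
      "[b = 1] (mod 4 * y)" "[b = a] (mod u)" "[s = x] (mod u)" "[t = k] (mod 4 * y)" "k \<le> y"
      by blast
    define A where "A = int a"
    have A: "A \<ge> 3" using a by (simp add: A_def)
    obtain i where i: "int x = px A i" "int y = py A i"
      using pell_solution[of A "int x" "int y"] *(1) A unfolding pell A_def by auto
    obtain n where n: "int u = px A n" "int v = py A n"
      using pell_solution[of A "int u" "int v"] *(2) A unfolding pell A_def by auto
    obtain j where j: "int s = px (int b) j" "int t = py (int b) j"
      using pell_solution[of "int b" "int s" "int t"] *(3,4) unfolding pell by auto
    have y: "y > 0" using *(11) k by simp
    have i0: "i > 0" using i(2) y by (cases i) auto
    have n0: "n > 0" using n(2) *(5) by (cases n) auto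
    have yn: "int y dvd int n"
    proof -
      have "int (y * y) dvd int v" using *(6) by (simp only: of_nat_dvd_iff)
      then have "py A i * py A i dvd py A n" by (simp add: i n)
      then show ?thesis
        using py_sq_dvd_imp[of A i n] A i0 i by simp
    qed
    have "[int j = int k] (mod int (4 * y))"
    proof -
      have "[int b = int 1] (mod int (4 * y))"
        using *(7) by (simp only: cong_int_iff)
      then have "int (4 * y) dvd int b - 1"
        by (simp add: cong_iff_dvd_diff)
      then have "[int t = int j] (mod int (4 * y))"
        unfolding j using px_py_cong_1[of "int b" j] cong_dvd_modulus by blast
      moreover have "[int t = int k] (mod int (4 * y))"
        using *(10) by (simp only: cong_int_iff)
      ultimately show ?thesis
        using cong_trans cong_sym by blast
    qed
    then have jk: "4 * int y dvd int j - int k"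
      by (simp add: cong_iff_dvd_diff)
    have "[px A i = px A j] (mod px A n)"
    proof -
      have "[int s = int x] (mod int u)" "[int b = A] (mod int u)"
        using *(8,9) by (simp_all add: cong_int_iff A_def)
      then show ?thesis
        using px_py_cong_base[of "int b" A "int u" j] unfolding i j n
        by (meson cong_sym cong_trans)
    qed
    then have "4 * int n dvd int i - int j \<or> 4 * int n dvd int i + int j"
      using px_cong_imp[of A n i j] A n0 by simp
    moreover have "4 * int y dvd 4 * int n" using yn by simp
    ultimately have "4 * int y dvd int i - int j \<or> 4 * int y dvd int i + int j"
      using dvd_trans by blast
    then have ik: "4 * int y dvd int i - int k \<or> 4 * int y dvd int i + int k"
      using dvd_add[of "4 * int y" "int i - int j" "int j - int k"]
        dvd_diff[of "4 * int y" "int i + int j" "int j - int k"] jk by auto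
    have iy: "int i \<le> int y" using py_ge_index[of A i] i A by simp
    have "i = k"
    proof (rule ccontr)
      assume "i \<noteq> k"
      have "\<not> 4 * int y dvd int i + int k"
        using iy *(11) y i0 zdvd_imp_le[of "4 * int y" "int i + int k"] by auto
      moreover have "\<not> 4 * int y dvd int i - int k"
        using iy *(11) y \<open>i \<noteq> k\<close> dvd_imp_le_int[of "int i - int k" "4 * int y"] by auto
      ultimately show False using ik by blast
    qed
    then show ?L using i by (simp add: A_def)
  }
qed

text \<open>The shift by 3 builds in the hypothesis \<open>a \<ge> 3\<close>, so that all natural
  arguments are admissible.\<close>

definition yp :: "nat \<Rightarrow> nat \<Rightarrow> nat" where "yp a k = nat (py (int a + 3) k)"
definition xp :: "nat \<Rightarrow> nat \<Rightarrow> nat" where "xp a k = nat (px (int a + 3) k)"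

lemma int_yp: "int (yp a k) = py (int a + 3) k" and int_xp: "int (xp a k) = px (int a + 3) k"
  using py_nonneg[of "int a + 3" k] px_ge_1[of "int a + 3" k] by (simp_all add: yp_def xp_def)

lemma dfun_yp [dioph_intros]: "dfun f \<Longrightarrow> dfun g \<Longrightarrow> dfun (\<lambda>v. yp (f v) (g v))"
proof -
  have "dfun (\<lambda>v. yp (v 0) (v 1))"
  proof (rule dfun_graphI)
    let ?a = "\<lambda>v::nat\<Rightarrow>nat. v (Suc 0) + 3" and ?k = "\<lambda>v::nat\<Rightarrow>nat. v (Suc 1)" and ?y = "\<lambda>v::nat\<Rightarrow>nat. v 0"
    show "dioph (\<lambda>v. ?k v = 0 \<and> ?y v = 0 \<or> 1 \<le> ?k v \<and> ?k v \<le> ?y v \<and> (\<exists>xx u w s t b.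
      xx * xx + ?y v * ?y v = 1 + ?a v * ?a v * (?y v * ?y v) \<and> u * u + w * w = 1 + ?a v * ?a v * (w * w) \<and>
      s * s + t * t = 1 + b * b * (t * t) \<and> 2 \<le> b \<and> 0 < w \<and> ?y v * ?y v dvd w \<and>
      [b = 1] (mod 4 * ?y v) \<and> [b = ?a v] (mod u) \<and> [s = xx] (mod u) \<and> [t = ?k v] (mod 4 * ?y v)))"
      by (intro dioph_intros)
  next
    fix x and v :: "nat \<Rightarrow> nat"
    have "x = yp (v 0) (v 1) \<longleftrightarrow> int x = int (yp (v 0) (v 1))"
      by simp
    also have "\<dots> \<longleftrightarrow> int x = py (int (v 0 + 3)) (v 1)"
      by (simp add: int_yp)
    also have "\<dots> \<longleftrightarrow> (v 1 = 0 \<and> x = 0 \<or> 1 \<le> v 1 \<and> int x = py (int (v 0 + 3)) (v 1))"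
      by (cases "v 1") auto
    finally show "(v 1 = 0 \<and> x = 0 \<or> 1 \<le> v 1 \<and> v 1 \<le> x \<and> (\<exists>xx u w s t b.
      xx * xx + x * x = 1 + (v 0 + 3) * (v 0 + 3) * (x * x) \<and> u * u + w * w = 1 + (v 0 + 3) * (v 0 + 3) * (w * w) \<and>
      s * s + t * t = 1 + b * b * (t * t) \<and> 2 \<le> b \<and> 0 < w \<and> x * x dvd w \<and>
      [b = 1] (mod 4 * x) \<and> [b = v 0 + 3] (mod u) \<and> [s = xx] (mod u) \<and> [t = v 1] (mod 4 * x)))
      \<longleftrightarrow> x = yp (v 0) (v 1)"
      using py_diophantine[of "v 0 + 3" "v 1" x] by (cases "v 1 = 0") auto
  qed
  then show "dfun f \<Longrightarrow> dfun g \<Longrightarrow> ?thesis"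
    by (rule dfun_app2)
qed

lemma nat_square_cancel: "x * x = y * y \<Longrightarrow> x = (y::nat)"
  by (metis power2_eq_iff_nonneg power2_eq_square zero_le)

text \<open>Once \<open>y\<close> is known, the Pell equation determines the nonnegative
  \<open>x\<close>.\<close>

lemma dfun_xp [dioph_intros]: "dfun f \<Longrightarrow> dfun g \<Longrightarrow> dfun (\<lambda>v. xp (f v) (g v))"
proof -
  have "dfun (\<lambda>v. xp (v 0) (v 1))"
  proof (rule dfun_graphI)
    let ?a = "\<lambda>v::nat\<Rightarrow>nat. v (Suc 0) + 3" and ?y = "\<lambda>v. yp (v (Suc 0)) (v (Suc 1))"
    show "dioph (\<lambda>v. v 0 * v 0 + ?y v * ?y v = 1 + ?a v * ?a v * (?y v * ?y v))"
      by (intro dioph_intros)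
  next
    fix x and v :: "nat \<Rightarrow> nat"
    let ?x = "xp (v 0) (v 1)" and ?y = "yp (v 0) (v 1)"
    have "int (?x * ?x + ?y * ?y) = int (1 + (v 0 + 3) * (v 0 + 3) * (?y * ?y))"
      using pell_eq[of "int (v 0) + 3" "v 1"] by (simp add: int_xp int_yp algebra_simps)
    then have "?x * ?x + ?y * ?y = 1 + (v 0 + 3) * (v 0 + 3) * (?y * ?y)"
      by (simp only: of_nat_eq_iff)
    then show "x * x + ?y * ?y = 1 + (v 0 + 3) * (v 0 + 3) * (?y * ?y) \<longleftrightarrow> x = ?x"
      using nat_square_cancel[of x ?x] by auto
  qed
  then show "dfun f \<Longrightarrow> dfun g \<Longrightarrow> ?thesis"
    by (rule dfun_app2)
qed

text \<open>Modulo \<open>2 * a * n - n * n - 1\<close> the number \<open>n - a\<close> is a square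
  root of \<open>a * a - 1\<close>. Substituting it for the root turns
  \<open>a + sqrt (a * a - 1)\<close> into \<open>n\<close>, and its \<open>k\<close>-th power into
  \<open>n ^ k\<close>.\<close>

lemma px_py_power: "2 * a * n - n * n - 1 dvd px a k - py a k * (a - n) - n ^ k"
proof (induction k)
  case (Suc k)
  have "px a (Suc k) - py a (Suc k) * (a - n) - n ^ Suc k =
      n * (px a k - py a k * (a - n) - n ^ k) + py a k * (2 * a * n - n * n - 1)"
    by (simp add: algebra_simps)
  then show ?case using Suc by simp
qed simp

text \<open>The congruence of \<open>px_py_power\<close> determines \<open>n ^ k\<close> once the
  modulus exceeds it. A base that large is supplied by the Pell sequence itself, which grows
  exponentially: \<open>yp n (k + 2)\<close> is at least \<open>(n + 3) ^ (k + 1)\<close>.\<close>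

lemma power_eq_iff_pell:
  fixes n k m :: nat
  assumes n: "n \<ge> 1"
  defines "a \<equiv> yp n (k + 2)"
  shows "m = n ^ k \<longleftrightarrow> m + n * n + 1 < 2 * (a + 3) * n \<and>
    [xp a k + n * yp a k = (a + 3) * yp a k + m] (mod 2 * (a + 3) * n - (n * n + 1))"
proof -
  define A where "A = int a + 3"
  define M where "M = 2 * A * int n - int n * int n - 1"
  have "int n ^ Suc k \<le> (int n + 3) ^ Suc k"
    by (intro power_mono) auto
  also have "\<dots> \<le> int a"
    using py_ge_power[of "int n + 3" "Suc k"] by (simp add: a_def int_yp)
  finally have 1: "int n ^ Suc k \<le> int a" .
  have "(int n + 3) ^ 1 \<le> (int n + 3) ^ Suc k"
    by (intro power_increasing) auto
  also have "\<dots> \<le> int a"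
    using py_ge_power[of "int n + 3" "Suc k"] by (simp add: a_def int_yp)
  finally have 2: "int n + 3 \<le> int a" by simp
  have "int n ^ k \<le> int n ^ Suc k" using n by (intro power_increasing) auto
  with 1 have 3: "int n ^ k \<le> int a" by linarith
  have 4: "A * 1 \<le> A * int n" "(int n + 1) * int n \<le> A * int n"
    using n 2 by (intro mult_left_mono mult_right_mono; simp add: A_def)+
  have M: "int n ^ k < M"
  proof -
    have "(int n + 1) * int n = int n * int n + int n" "M = A * int n + A * int n - int n * int n - 1"
      by (simp_all add: M_def algebra_simps)
    then show ?thesis
      using 3 4 n A_def by linarith
  qed
  have bnd: "m + n * n + 1 < 2 * (a + 3) * n \<longleftrightarrow> int m < M"
  proof -
    have "m + n * n + 1 < 2 * (a + 3) * n \<longleftrightarrow> int (m + n * n + 1) < int (2 * (a + 3) * n)"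
      by (simp only: of_nat_less_iff)
    also have "\<dots> \<longleftrightarrow> int m < M" by (simp add: M_def A_def algebra_simps)
    finally show ?thesis .
  qed
  have M0: "int n ^ k \<ge> 0" by simp
  have "n * n + 1 \<le> 2 * (a + 3) * n"
  proof -
    have "0 \<le> M" using M M0 by linarith
    then have "int (n * n + 1) \<le> int (2 * (a + 3) * n)"
      by (simp add: M_def A_def algebra_simps)
    then show ?thesis by (simp only: of_nat_le_iff)
  qed
  then have intM: "int (2 * (a + 3) * n - (n * n + 1)) = M"
    by (simp add: of_nat_diff M_def A_def algebra_simps)
  have "[xp a k + n * yp a k = (a + 3) * yp a k + m] (mod 2 * (a + 3) * n - (n * n + 1)) \<longleftrightarrow>
      [int (xp a k + n * yp a k) = int ((a + 3) * yp a k + m)] (mod M)"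
    unfolding intM[symmetric] cong_int_iff ..
  also have "\<dots> \<longleftrightarrow> M dvd px A k - py A k * (A - int n) - int m"
    by (simp add: cong_iff_dvd_diff int_xp int_yp A_def algebra_simps)
  also have "\<dots> \<longleftrightarrow> M dvd int n ^ k - int m"
  proof -
    have "M dvd px A k - py A k * (A - int n) - int n ^ k"
      unfolding M_def by (rule px_py_power)
    then have "M dvd (px A k - py A k * (A - int n) - int n ^ k) + (int n ^ k - int m) \<longleftrightarrow> M dvd int n ^ k - int m"
      by (simp only: dvd_add_right_iff)
    moreover have "(px A k - py A k * (A - int n) - int n ^ k) + (int n ^ k - int m) =
        px A k - py A k * (A - int n) - int m"
      by linarith
    ultimately show ?thesis by (simp only:)
  qed
  finally have c: "[xp a k + n * yp a k = (a + 3) * yp a k + m] (mod 2 * (a + 3) * n - (n * n + 1)) \<longleftrightarrow>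
      M dvd int n ^ k - int m" .
  have "int m < M \<and> M dvd int n ^ k - int m \<longleftrightarrow> int m = int n ^ k"
  proof
    assume *: "int m < M \<and> M dvd int n ^ k - int m"
    then have "\<bar>int n ^ k - int m\<bar> < M" using M M0 by linarith
    then show "int m = int n ^ k"
      using * dvd_imp_le_int[of "int n ^ k - int m" M] by force
  qed (use M in auto)
  then show ?thesis
    unfolding bnd c by (simp flip: of_nat_power)
qed

lemma dfun_power [dioph_intros]: "dfun f \<Longrightarrow> dfun g \<Longrightarrow> dfun (\<lambda>v. f v ^ g v)"
proof -
  have "dfun (\<lambda>v. v 0 ^ v 1)"
  proof (rule dfun_graphI)
    let ?n = "\<lambda>v::nat\<Rightarrow>nat. v (Suc 0)" and ?k = "\<lambda>v::nat\<Rightarrow>nat. v (Suc 1)" and ?m = "\<lambda>v::nat\<Rightarrow>nat. v 0"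
    let ?a = "\<lambda>v. yp (v (Suc 0)) (v (Suc 1) + 2)"
    show "dioph (\<lambda>v. ?n v = 0 \<and> ?k v = 0 \<and> ?m v = 1 \<or> ?n v = 0 \<and> 1 \<le> ?k v \<and> ?m v = 0 \<or>
      1 \<le> ?n v \<and> ?m v + ?n v * ?n v + 1 < 2 * (?a v + 3) * ?n v \<and>
      [xp (?a v) (?k v) + ?n v * yp (?a v) (?k v) = (?a v + 3) * yp (?a v) (?k v) + ?m v]
        (mod 2 * (?a v + 3) * ?n v - (?n v * ?n v + 1)))"
      by (intro dioph_intros)
  next
    fix m and v :: "nat \<Rightarrow> nat"
    let ?n = "v 0" and ?k = "v 1"
    let ?a = "yp ?n (?k + 2)"
    show "(?n = 0 \<and> ?k = 0 \<and> m = 1 \<or> ?n = 0 \<and> 1 \<le> ?k \<and> m = 0 \<or>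
      1 \<le> ?n \<and> m + ?n * ?n + 1 < 2 * (?a + 3) * ?n \<and>
      [xp ?a ?k + ?n * yp ?a ?k = (?a + 3) * yp ?a ?k + m] (mod 2 * (?a + 3) * ?n - (?n * ?n + 1)))
      \<longleftrightarrow> m = ?n ^ ?k"
      using power_eq_iff_pell[of ?n m ?k] by (cases "?n = 0"; cases "?k = 0") (auto simp: power_0_left)
  qed
  then show "dfun f \<Longrightarrow> dfun g \<Longrightarrow> ?thesis"
    by (rule dfun_app2)
qed


section \<open>Binomial coefficients and factorials\<close>

lemma digit_extract:
  fixes c :: "nat \<Rightarrow> nat"
  assumes "\<And>i. i < N \<Longrightarrow> c i < u" "k < N"
  shows "(\<Sum>i<N. c i * u ^ i) div u ^ k mod u = c k"
  using assms
proof (induction k arbitrary: c N)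
  case (Suc k)
  then obtain N' where N: "N = Suc N'" by (cases N) auto
  have u: "u > 0" using Suc.prems by fastforce
  have eq: "(\<Sum>i<N. c i * u ^ i) = c 0 + u * (\<Sum>i<N'. c (Suc i) * u ^ i)"
    unfolding N by (simp add: sum.lessThan_Suc_shift sum_distrib_left mult_ac del: sum.lessThan_Suc)
  have "(\<Sum>i<N. c i * u ^ i) div u = (\<Sum>i<N'. c (Suc i) * u ^ i)"
    unfolding eq using Suc.prems(1)[of 0] N u by simp
  then have "(\<Sum>i<N. c i * u ^ i) div u ^ Suc k mod u = (\<Sum>i<N'. c (Suc i) * u ^ i) div u ^ k mod u"
    by (simp add: div_mult2_eq)
  also have "\<dots> = c (Suc k)"
    using Suc.prems N by (intro Suc.IH) auto
  finally show ?case .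
next
  case 0
  then obtain N' where N: "N = Suc N'" by (cases N) auto
  have eq: "(\<Sum>i<N. c i * u ^ i) = c 0 + u * (\<Sum>i<N'. c (Suc i) * u ^ i)"
    unfolding N by (simp add: sum.lessThan_Suc_shift sum_distrib_left mult_ac del: sum.lessThan_Suc)
  show ?case
    unfolding eq using 0 by simp
qed

text \<open>With \<open>u = 2 ^ n + 1\<close> every coefficient of \<open>(u + 1) ^ n\<close> is
  below \<open>u\<close>, so the binomial coefficients are its digits in base
  \<open>u\<close>.\<close>

lemma binomial_eq_digit: "n choose k = (2 ^ n + 2) ^ n div (2 ^ n + 1) ^ k mod (2 ^ n + 1 :: nat)"
proof -
  define u :: nat where "u = 2 ^ n + 1"
  have "(u + 1) ^ n = (\<Sum>i\<le>n. (n choose i) * u ^ i)"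
    using binomial[of u 1 n] by simp
  \<comment> \<open>The zero coefficients are added so that digit \<open>k\<close> exists also for
    \<open>k > n\<close>.\<close>
  also have "\<dots> = (\<Sum>i<Suc (n + k). (n choose i) * u ^ i)"
    by (rule sum.mono_neutral_left) auto
  finally have "(u + 1) ^ n div u ^ k mod u = (n choose k)"
    using binomial_le_pow2[of n] by (simp only:) (rule digit_extract, auto simp: u_def less_Suc_eq_le)
  then show ?thesis by (simp add: u_def)
qed

lemma dfun_binomial [dioph_intros]: "dfun f \<Longrightarrow> dfun g \<Longrightarrow> dfun (\<lambda>v. f v choose g v)"
  unfolding binomial_eq_digit by (intro dioph_intros)

lemma Suc_times_choose_Suc: "Suc k * (n choose Suc k) = (n - k) * (n choose k)"
  using binomial_absorption[of k n] binomial_absorb_comp[of n k] by simp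

lemma power_le_fact_times_binomial: "k \<le> n \<Longrightarrow> (r - n) ^ k \<le> fact k * (r choose k)"
proof (induction k)
  case (Suc k)
  have "(r - n) * (r - n) ^ k \<le> (r - k) * (fact k * (r choose k))"
    using Suc by (intro mult_le_mono) auto
  also have "\<dots> = fact k * (Suc k * (r choose Suc k))"
    unfolding Suc_times_choose_Suc by simp
  finally show ?case by (simp add: algebra_simps)
qed simp

text \<open>Bernoulli's inequality for \<open>(1 - n / r) ^ k\<close>, cleared of
  denominators.\<close>

lemma bernoulli_nat:
  fixes r n k :: nat
  assumes "n \<le> r"
  shows "r ^ Suc k \<le> r * (r - n) ^ k + k * n * r ^ k"
proof (induction k)
  case (Suc k)
  have "r ^ Suc (Suc k) \<le> r * (r * (r - n) ^ k + k * n * r ^ k)"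
    using Suc by simp
  also have "\<dots> = r * ((r - n) * (r - n) ^ k) + n * (r * (r - n) ^ k) + k * n * r ^ Suc k"
  proof -
    have "r * (r * (r - n) ^ k) = ((r - n) + n) * (r * (r - n) ^ k)"
      using assms by simp
    then show ?thesis by (simp only: distrib_left distrib_right mult_ac power_Suc)
  qed
  also have "n * (r * (r - n) ^ k) \<le> n * (r * r ^ k)"
    by (intro mult_le_mono power_mono) auto
  finally show ?case by (simp add: algebra_simps)
qed simp

text \<open>The quotient of \<open>r ^ n\<close> by \<open>r choose n\<close> tends to
  \<open>fact n\<close> from above as \<open>r\<close> grows. An error below 1 is guaranteed by
  \<open>(fact n + 1) * (n * n) < r\<close>, and \<open>fact n + 1 \<le> 2 * (n + 1) ^ n\<close>
  leads to the chosen \<open>r\<close>.\<close>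

lemma fact_eq_div_binomial:
  fixes n :: nat
  defines "r \<equiv> 2 * (n + 1) ^ (n + 2)"
  shows "fact n = r ^ n div (r choose n)"
proof (rule div_nat_eqI[symmetric])
  show "(r choose n) * fact n \<le> r ^ n"
    by (rule binomial_fact_pow)
  have "fact n \<le> n ^ n"
    using fact_le_power[where 'a = nat, of n] by simp
  also have "\<dots> \<le> (n + 1) ^ n" by (intro power_mono) auto
  finally have "fact n + 1 \<le> 2 * (n + 1) ^ n"
    using one_le_power[of "n + 1" n] by linarith
  then have "(fact n + 1) * (n * n) \<le> 2 * (n + 1) ^ n * (n * n)"
    by (rule mult_le_mono1)
  also have "\<dots> < 2 * (n + 1) ^ n * ((n + 1) * (n + 1))"
    by (intro mult_strict_left_mono) auto
  also have "\<dots> = r" unfolding r_def power_add power2_eq_square by (simp only: mult.assoc)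
  finally have r: "(fact n + 1) * (n * n) < r" .
  have "n \<le> n + 1" by simp
  also have "\<dots> \<le> (n + 1) ^ (n + 2)" using power_increasing[of 1 "n + 2" "n + 1"] by simp
  finally have nr: "n \<le> r" by (simp add: r_def)
  have r0: "r > 0" by (simp add: r_def)
  define G where "G = (r - n) ^ n"
  have "(fact n + 1) * (r * r ^ n) \<le> (fact n + 1) * (r * G + n * n * r ^ n)"
    using bernoulli_nat[OF nr, of n] by (intro mult_le_mono) (simp_all add: G_def)
  also have "\<dots> = r * ((fact n + 1) * G) + ((fact n + 1) * (n * n)) * r ^ n"
    by (simp only: distrib_left mult_ac)
  also have "\<dots> < r * ((fact n + 1) * G) + r * r ^ n"
    using r r0 by simp
  finally have "r * (fact n * r ^ n) < r * ((fact n + 1) * G)"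
    by (simp add: algebra_simps)
  then have "fact n * r ^ n < (fact n + 1) * G"
    using r0 by simp
  also have "\<dots> \<le> (fact n + 1) * (fact n * (r choose n))"
    unfolding G_def by (intro mult_le_mono2 power_le_fact_times_binomial) simp
  also have "\<dots> = fact n * ((r choose n) * Suc (fact n))"
    by (simp add: algebra_simps)
  finally show "r ^ n < (r choose n) * Suc (fact n)"
    by simp
qed

lemma dfun_fact [dioph_intros]: "dfun f \<Longrightarrow> dfun (\<lambda>v. fact (f v))"
  unfolding fact_eq_div_binomial by (intro dioph_intros)

lemma prod_diff_eq_fact_choose: "(\<Prod>j<i. a - j) = fact i * (a choose i)"
proof (induction i)
  case (Suc i)
  have "fact (Suc i) * (a choose Suc i) = fact i * (Suc i * (a choose Suc i))"
    by (simp add: algebra_simps)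
  then show ?case unfolding Suc_times_choose_Suc using Suc by simp
qed simp

text \<open>A prime that divides the binomial coefficient divides one of the factors
  \<open>a - j\<close> with \<open>j \<le> u\<close>.\<close>

lemma prime_dvd_choose:
  assumes p: "prime p" "p dvd (a choose Suc u)"
  shows "\<exists>w\<le>u. [a = w] (mod p)"
proof (cases "a \<le> u")
  case False
  have "p dvd (\<Prod>j<Suc u. a - j)"
    unfolding prod_diff_eq_fact_choose using p(2) by (rule dvd_mult)
  then obtain j where j: "j < Suc u" "p dvd a - j"
    using p(1) by (auto simp: prime_dvd_prod_iff simp del: prod.lessThan_Suc)
  then have "[a = j] (mod p)" using False by (simp add: cong_altdef_nat)
  then show ?thesis using j by (intro exI[of _ j]) simp
qed auto

text \<open>The moduli satisfy \<open>T - 1 - k = Suc k * m k\<close>, so \<open>T - 1\<close> has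
  residue \<open>k\<close> modulo \<open>m k\<close>, and the product of the moduli is a single
  binomial coefficient. As \<open>T\<close> is the square of \<open>fact Q\<close>, one factor
  \<open>fact Q\<close> survives the division by \<open>Suc k\<close>; so \<open>m k\<close> is -1
  modulo \<open>fact Q\<close> and has no prime factor up to \<open>Q\<close>.\<close>

locale crt_moduli =
  fixes Q T y :: nat and m :: "nat \<Rightarrow> nat"
  assumes Q: "3 \<le> Q" and y: "y \<le> Q"
    and T_def: "T = fact Q * fact Q" and m_def: "m k = fact Q * fact Q div Suc k - 1"
begin

lemma T_eq: "k < y \<Longrightarrow> T = Suc k * Suc (m k)" and fact_dvd_Suc_m: "k < y \<Longrightarrow> fact Q dvd Suc (m k)"
proof -
  assume k: "k < y"
  then have "Suc k dvd fact Q" using y by (intro dvd_fact) auto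
  then obtain c where c: "fact Q = Suc k * c" ..
  then have "c > 0" by (metis fact_nonzero mult_0_right neq0_conv)
  have "fact Q * fact Q = Suc k * (c * fact Q)"
    using c by (metis mult.assoc)
  then have "fact Q * fact Q div Suc k = c * fact Q"
    by (metis nat.distinct(2) nonzero_mult_div_cancel_left)
  moreover have "c * fact Q > 0" using \<open>c > 0\<close> by simp
  ultimately have m: "Suc (m k) = c * fact Q"
    unfolding m_def by simp
  show "T = Suc k * Suc (m k)"
    unfolding m T_def mult.assoc[symmetric] c[symmetric] ..
  show "fact Q dvd Suc (m k)"
    unfolding m by simp
qed

lemma m_gt_1:
  assumes "k < y"
  shows "m k > 1"
proof -
  have "fact 3 \<le> (fact Q :: nat)" using Q by (rule fact_mono_nat)
  then have "6 \<le> (fact Q :: nat)" by (simp add: fact_numeral)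
  then show ?thesis
    using dvd_imp_le[OF fact_dvd_Suc_m[OF assms]] by simp
qed

lemma coprime_fact:
  assumes "k < y"
  shows "coprime (m k) (fact Q)"
proof (rule coprimeI)
  fix d assume d: "d dvd m k" "d dvd fact Q"
  then have "d dvd m k + 1"
    using fact_dvd_Suc_m[OF assms] dvd_trans by auto
  then show "is_unit d" using d by (simp only: dvd_add_right_iff)
qed

text \<open>A common divisor of two moduli divides the difference of \<open>T - 1 - k\<close> and
  \<open>T - 1 - l\<close>, hence \<open>fact Q\<close>, to which \<open>m k\<close> is
  coprime.\<close>

lemma coprime_m: "k < y \<Longrightarrow> l < y \<Longrightarrow> k \<noteq> l \<Longrightarrow> coprime (m k) (m l)"
proof (induction k l rule: linorder_wlog)
  case (le k l)
  show ?case
  proof (rule coprimeI)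
    fix d assume d: "d dvd m k" "d dvd m l"
    have "Suc k * m k = Suc l * m l + (l - k)"
      using T_eq[of k] T_eq[of l] le by simp
    moreover have "d dvd Suc k * m k" "d dvd Suc l * m l"
      using d by auto
    ultimately have "d dvd l - k"
      by (metis dvd_add_right_iff)
    also have "l - k dvd fact Q"
      using le y by (intro dvd_fact) auto
    finally show "is_unit d"
      using d(1) coprime_fact[of k] le coprime_common_divisor by blast
  qed
next
  case (sym k l)
  then show ?case by (metis coprime_commute)
qed

lemma prod_m: "(\<Prod>k<y. m k) = (T - 1) choose y"
proof -
  have "j \<le> y \<Longrightarrow> (\<Prod>k<j. m k) = (T - 1) choose j" for j
  proof (induction j)
    case (Suc j)
    have "T - 1 - j = Suc j * m j"
      using T_eq[of j] Suc.prems by simp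
    then have "Suc j * ((T - 1) choose Suc j) = Suc j * (m j * ((T - 1) choose j))"
      unfolding Suc_times_choose_Suc by (simp only: mult.assoc)
    then show ?case using Suc by (simp del: binomial_Suc_Suc mult_Suc)
  qed simp
  then show ?thesis by simp
qed

lemma cong_m: "k < y \<Longrightarrow> [T - 1 = k] (mod m k)"
proof -
  assume "k < y"
  then have "T - 1 = k + m k * Suc k"
    using T_eq[of k] by simp
  then show ?thesis
    by (simp only: cong_def mod_mult_self2)
qed

text \<open>The factor \<open>a - w\<close> of the falling product is divisible by
  \<open>m k\<close>, and the denominator \<open>fact (Suc u)\<close> divides \<open>fact Q\<close>,
  so it cannot cancel any of it.\<close>

lemma dvd_choose:
  assumes k: "k < y" and u: "u < Q" and w: "w \<le> u" and a: "[a = w] (mod m k)"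
  shows "m k dvd (a choose Suc u)"
proof (cases "a \<le> u")
  case False
  have "m k dvd a - w"
    using a False w by (simp add: cong_altdef_nat cong_sym_eq)
  also have "a - w dvd (\<Prod>j\<le>u. a - j)"
    using w by (intro dvd_prodI) auto
  also have "(\<Prod>j\<le>u. a - j) = fact (Suc u) * (a choose Suc u)"
    using prod_diff_eq_fact_choose[where i = "Suc u"] by (simp only: lessThan_Suc_atMost)
  finally have *: "m k dvd fact (Suc u) * (a choose Suc u)" .
  have "fact (Suc u) dvd (fact Q :: nat)"
    using u by (intro fact_dvd) auto
  then have "coprime (m k) (fact (Suc u))"
    using coprime_fact[OF k] coprime_divisors dvd_refl by blast
  then show ?thesis using * by (simp only: coprime_dvd_mult_right_iff)
qed (simp add: binomial_eq_0 del: binomial_Suc_Suc)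

end


section \<open>Bounded universal quantification\<close>

lemma dfun_tval: "(\<And>x. dfun (e x)) \<Longrightarrow> dfun (\<lambda>v. tval (\<lambda>x. e x v) t)"
  by (induction t) (simp_all add: dioph_intros)

lemma dioph_all_const:
  fixes N :: nat
  shows "(\<And>i. i < N \<Longrightarrow> dioph (P i)) \<Longrightarrow> dioph (\<lambda>v. \<forall>i<N. P i v)"
proof (induction N)
  case 0
  then show ?case by (simp add: dioph_const)
next
  case (Suc N)
  then have "dioph (\<lambda>v. (\<forall>i<N. P i v) \<and> P N v)" by (intro dioph_conj) auto
  then show ?case by (rule dioph_iff) (auto simp: less_Suc_eq)
qed

abbreviation ienv :: "(nat \<Rightarrow> nat) \<Rightarrow> nat \<Rightarrow> (nat \<Rightarrow> nat) \<Rightarrow> nat + nat \<Rightarrow> nat" where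
  "ienv v k w \<equiv> case_sum (case_nat k v) w"

text \<open>In the notation of \<^locale>\<open>crt_moduli\<close>, each \<open>m k\<close> divides \<open>T - 1 - k\<close>. So a congruence
  modulo \<open>(T - 1) choose y\<close>, the product of the \<open>m k\<close>, expresses all the equations at once when the index
  is replaced by \<open>T - 1\<close>; and a prime factor of \<open>m k\<close> exceeds \<open>Q\<close>, which turns the congruence
  back into an equation.\<close>

lemma bounded_all_iff:
  fixes p q :: "(nat + nat) tm" and v :: "nat \<Rightarrow> nat"
  assumes N: "\<And>i. Inr i \<in> set_tm p \<union> set_tm q \<Longrightarrow> i < N"
  shows "(\<forall>k<y. \<exists>w. tval (ienv v k w) p = tval (ienv v k w) q) \<longleftrightarrow>
    (\<exists>a u Q T M. u < Q \<and> 3 \<le> Q \<and> y \<le> Q \<and> tval (ienv v y (\<lambda>_. u)) p < Q \<and> tval (ienv v y (\<lambda>_. u)) q < Q \<and>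
      T = fact Q * fact Q \<and> M = (T - 1) choose y \<and> (\<forall>i<N. M dvd (a i choose Suc u)) \<and>
      [tval (ienv v (T - 1) a) p = tval (ienv v (T - 1) a) q] (mod M))"
    (is "?L \<longleftrightarrow> ?R")
proof
  have env_cong: "[tval (ienv v k w) t = tval (ienv v k' w') t] (mod n)"
    if "t \<in> {p, q}" "[k = k'] (mod n)" "\<And>i. i < N \<Longrightarrow> [w i = w' i] (mod n)" for k k' w w' t and n :: nat
    using that N by (intro tval_mod) (auto split: sum.split nat.split)
  have env_mono: "tval (ienv v k w) t \<le> tval (ienv v k' w') t"
    if "t \<in> {p, q}" "k \<le> k'" "\<And>i. i < N \<Longrightarrow> w i \<le> w' i" for k k' w w' t
    using that N by (intro tval_mono) (auto split: sum.split nat.split)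
  {
    assume ?L
    then obtain w where w: "\<And>k. k < y \<Longrightarrow> tval (ienv v k (w k)) p = tval (ienv v k (w k)) q"
      by metis
    define u where "u = (\<Sum>k<y. \<Sum>i<N. w k i)"
    have u: "w k i \<le> u" if "k < y" "i < N" for k i
    proof -
      have "w k i \<le> (\<Sum>i<N. w k i)" using that by (intro member_le_sum) auto
      also have "\<dots> \<le> u" unfolding u_def using that by (intro member_le_sum[of k "{..<y}" "\<lambda>k. \<Sum>i<N. w k i"]) auto
      finally show ?thesis .
    qed
    \<comment> \<open>\<open>Q\<close> exceeds the largest witness and, by monotonicity, all values
      of \<open>p\<close> and \<open>q\<close> that occur below \<open>y\<close>; \<open>y\<close>
      and 3 are the demands of \<open>crt_moduli\<close>.\<close>
    define Q where "Q = u + y + 3 + tval (ienv v y (\<lambda>_. u)) p + tval (ienv v y (\<lambda>_. u)) q"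
    define T :: nat where "T = fact Q * fact Q"
    define m where "m k = fact Q * fact Q div Suc k - 1" for k :: nat
    interpret crt_moduli Q T y m
      by unfold_locales (auto simp: Q_def T_def m_def)
    \<comment> \<open>For each unknown \<open>i\<close> one number \<open>a i\<close> stores the
      witnesses for all \<open>k < y\<close> as residues.\<close>
    have "\<exists>x. \<forall>k\<in>{..<y}. [x = w k i] (mod m k)" for i
      by (rule chinese_remainder_nat) (auto intro: coprime_m)
    then obtain a where a: "\<And>i k. k < y \<Longrightarrow> [a i = w k i] (mod m k)"
      by (metis lessThan_iff)
    define M where "M = (T - 1) choose y"
    have M: "M = (\<Prod>k<y. m k)"
      by (simp add: M_def prod_m)
    have "M dvd (a i choose Suc u)" if i: "i < N" for i
    proof -
      have "[(a i choose Suc u) = 0] (mod M)"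
        unfolding M
      proof (rule coprime_cong_prod_nat)
        fix k assume "k \<in> {..<y}"
        then have "m k dvd (a i choose Suc u)"
          using u i a by (intro dvd_choose[of k u "w k i"]) (auto simp: Q_def)
        then show "[(a i choose Suc u) = 0] (mod m k)" by (simp only: cong_0_iff)
      qed (auto intro: coprime_m)
      then show ?thesis by (simp only: cong_0_iff)
    qed
    moreover have "[tval (ienv v (T - 1) a) p = tval (ienv v (T - 1) a) q] (mod M)"
      unfolding M
    proof (rule coprime_cong_prod_nat)
      fix k assume "k \<in> {..<y}"
      then have k: "k < y" by simp
      have *: "[tval (ienv v (T - 1) a) t = tval (ienv v k (w k)) t] (mod m k)" if "t \<in> {p, q}" for t
        using that k cong_m a by (intro env_cong) auto
      show "[tval (ienv v (T - 1) a) p = tval (ienv v (T - 1) a) q] (mod m k)"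
        using *[of p] *[of q] w[OF k] cong_trans cong_sym by (metis insertI1 insertI2)
    qed (auto intro: coprime_m)
    moreover have "u < Q" "3 \<le> Q" "y \<le> Q" "tval (ienv v y (\<lambda>_. u)) p < Q" "tval (ienv v y (\<lambda>_. u)) q < Q"
      by (simp_all add: Q_def)
    ultimately show ?R
      using T_def M_def by blast
  next
    assume ?R
    then obtain a u Q T M where *: "u < Q" "3 \<le> Q" "y \<le> Q" "tval (ienv v y (\<lambda>_. u)) p < Q"
      "tval (ienv v y (\<lambda>_. u)) q < Q" "T = fact Q * fact Q" "M = (T - 1) choose y"
      "\<And>i. i < N \<Longrightarrow> M dvd (a i choose Suc u)"
      "[tval (ienv v (T - 1) a) p = tval (ienv v (T - 1) a) q] (mod M)"
      by blast
    define m where "m k = fact Q * fact Q div Suc k - 1" for k :: nat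
    interpret crt_moduli Q T y m
      by unfold_locales (use * in \<open>auto simp: m_def\<close>)
    show ?L
    proof (intro allI impI)
      fix k assume k: "k < y"
      \<comment> \<open>The passage to a prime is essential: if it divides
        \<open>a i choose Suc u\<close>, it divides one factor of the falling product, which gives a
        residue of at most \<open>u\<close>.\<close>
      obtain r where r: "prime r" "r dvd m k"
        using m_gt_1[OF k] prime_factor_nat[of "m k"] by auto
      have "m k dvd M"
        unfolding *(7) prod_m[symmetric] using k by (intro dvd_prodI) auto
      then have rM: "r dvd M" using r dvd_trans by blast
      have rQ: "Q < r"
      proof (rule ccontr)
        assume "\<not> Q < r"
        then have "r dvd fact Q" using r prime_ge_1_nat by (intro dvd_fact) auto
        then show False
          using coprime_fact[OF k] r coprime_common_divisor not_prime_unit by blast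
      qed
      have "\<exists>w\<le>u. [a i = w] (mod r)" if "i < N" for i
        using prime_dvd_choose[OF r(1)] *(8)[OF that] rM dvd_trans by blast
      then obtain w where w: "\<And>i. i < N \<Longrightarrow> w i \<le> u \<and> [a i = w i] (mod r)"
        by metis
      have Tk: "[T - 1 = k] (mod r)"
        using cong_m[OF k] r(2) cong_dvd_modulus_nat by blast
      have 1: "[tval (ienv v (T - 1) a) t = tval (ienv v k w) t] (mod r)" if "t \<in> {p, q}" for t
        using that Tk w by (intro env_cong) auto
      have "tval (ienv v k w) t < r" if "t \<in> {p, q}" for t
      proof -
        have "tval (ienv v k w) t \<le> tval (ienv v y (\<lambda>_. u)) t"
          using that w k by (intro env_mono) auto
        then show ?thesis using that *(4,5) rQ by auto
      qed
      moreover have "[tval (ienv v (T - 1) a) p = tval (ienv v (T - 1) a) q] (mod r)"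
        using *(9) rM cong_dvd_modulus_nat by blast
      then have "[tval (ienv v k w) p = tval (ienv v k w) q] (mod r)"
        using 1[of p] 1[of q] cong_trans cong_sym by (metis insertI1 insertI2)
      ultimately have "tval (ienv v k w) p = tval (ienv v k w) q"
        by (simp add: cong_def)
      then show "\<exists>w. tval (ienv v k w) p = tval (ienv v k w) q" by blast
    qed
  }
qed

lemma dioph_bounded_all_aux:
  assumes "dioph (\<lambda>v. P (v 0) (\<lambda>i. v (Suc i)))"
  shows "dioph (\<lambda>v. \<forall>k<v 0. P k (\<lambda>i. v (Suc i)))"
proof -
  obtain p q :: "(nat + nat) tm" where pq: "\<And>v. P (v 0) (\<lambda>i. v (Suc i)) \<longleftrightarrow>
      (\<exists>w. tval (case_sum v w) p = tval (case_sum v w) q)"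
    using assms by (auto simp: dioph_def)
  have "finite (Inr -` (set_tm p \<union> set_tm q) :: nat set)"
    by (intro finite_vimageI) (auto simp: finite_set_tm)
  then obtain N where N: "\<And>i. Inr i \<in> set_tm p \<union> set_tm q \<Longrightarrow> i < N"
    by (metis finite_nat_set_iff_bounded vimageI)
  have dfun_env: "dfun (\<lambda>v. tval (case_sum (case_nat (k v) (\<lambda>i. v (s i))) (\<lambda>i. f i v)) t)"
    if "dfun k" "\<And>i. dfun (f i)" for k t s and f :: "nat \<Rightarrow> (nat \<Rightarrow> nat) \<Rightarrow> nat"
  proof -
    have "dfun (\<lambda>v. tval (\<lambda>x. case_sum (case_nat (k v) (\<lambda>i. v (s i))) (\<lambda>i. f i v) x) t)"
    proof (rule dfun_tval)
      fix x :: "nat + nat"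
      show "dfun (\<lambda>v. case_sum (case_nat (k v) (\<lambda>i. v (s i))) (\<lambda>i. f i v) x)"
        using that by (cases x; cases "projl x") (auto intro: dfun_var)
    qed
    then show ?thesis by simp
  qed
  have P: "P k v \<longleftrightarrow> (\<exists>w. tval (case_sum (case_nat k v) w) p = tval (case_sum (case_nat k v) w) q)" for k v
    using pq[of "case_nat k v"] by simp
  show ?thesis
    unfolding P
    \<comment> \<open>The numbers \<open>a i\<close> are quantified as one sequence; the conjunction
      over \<open>i < N\<close> has constant length, since \<open>N\<close> depends on
      \<open>p\<close> and \<open>q\<close> only.\<close>
    by (subst bounded_all_iff[OF N], assumption) (intro dioph_ex_fun dioph_ex dioph_conj dioph_all_const dioph_intros dfun_env)
qed

lemma dioph_bounded_all [dioph_intros]: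
  assumes "dioph (\<lambda>v. P (v 0) (\<lambda>i. v (Suc i)))" "dfun f"
  shows "dioph (\<lambda>v. \<forall>k<f v. P k v)"
proof -
  have "dioph (\<lambda>v. \<exists>y. y = f v \<and> (\<forall>k<y. P k v))"
    by (intro dioph_ex dioph_conj dioph_bounded_all_aux assms(1)) (use assms(2) in \<open>simp add: dfun_def\<close>)
  then show ?thesis by simp
qed


section \<open>A Diophantine undecidable set\<close>

text \<open>A polynomial pairing; it is injective because \<open>(a + b) * (a + b) + a\<close> stays
  below the square of \<open>Suc (a + b)\<close>.\<close>

definition pr :: "nat \<Rightarrow> nat \<Rightarrow> nat" where "pr a b = (a + b) * (a + b) + a"

lemma pr_eq_iff [simp]: "pr a b = pr c d \<longleftrightarrow> a = c \<and> b = d"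
proof
  have less: "pr a b < pr c d" if "a + b < c + d" for a b c d
  proof -
    have "pr a b < Suc (a + b) * Suc (a + b)" by (simp add: pr_def)
    also have "\<dots> \<le> (c + d) * (c + d)" using that by (intro mult_le_mono) auto
    also have "\<dots> \<le> pr c d" by (simp add: pr_def)
    finally show ?thesis .
  qed
  assume *: "pr a b = pr c d"
  then have "a + b = c + d"
    using less[of a b c d] less[of c d a b] by (metis less_irrefl linorder_neqE_nat)
  moreover from this have "a = c"
    using * by (simp add: pr_def)
  ultimately show "a = c \<and> b = d" by simp
qed simp

lemma dfun_pr [dioph_intros]: "dfun f \<Longrightarrow> dfun g \<Longrightarrow> dfun (\<lambda>v. pr (f v) (g v))"
  unfolding pr_def by (intro dioph_intros)

abbreviation cons_code :: "nat \<Rightarrow> nat \<Rightarrow> nat" where "cons_code x xs \<equiv> Suc (pr x xs)"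

fun code_list :: "nat list \<Rightarrow> nat" where
  "code_list [] = 0"
| "code_list (x # xs) = cons_code x (code_list xs)"

lemma code_list_eq [simp]:
  "0 = code_list xs \<longleftrightarrow> xs = []"
  "cons_code x r = code_list xs \<longleftrightarrow> (\<exists>ys. xs = x # ys \<and> r = code_list ys)"
  by (cases xs; auto)+

fun code_recf :: "recf \<Rightarrow> nat" where
  "code_recf Zero = pr 2 0"
| "code_recf Succ = pr 3 0"
| "code_recf (Proj i) = pr 4 i"
| "code_recf (Comp f gs) = pr 5 (pr (code_recf f) (code_list (map code_recf gs)))"
| "code_recf (PrimRec f g) = pr 6 (pr (code_recf f) (code_recf g))"
| "code_recf (Mu f) = pr 7 (code_recf f)"

lemma code_recf_eq [simp]:
  "pr 2 0 = code_recf f \<longleftrightarrow> f = Zero"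
  "pr 3 0 = code_recf f \<longleftrightarrow> f = Succ"
  "pr 4 i = code_recf f \<longleftrightarrow> f = Proj i"
  "pr 5 (pr a b) = code_recf f \<longleftrightarrow> (\<exists>g gs. f = Comp g gs \<and> a = code_recf g \<and> b = code_list (map code_recf gs))"
  "pr 6 (pr a b) = code_recf f \<longleftrightarrow> (\<exists>g h. f = PrimRec g h \<and> a = code_recf g \<and> b = code_recf h)"
  "pr 7 a = code_recf f \<longleftrightarrow> (\<exists>g. f = Mu g \<and> a = code_recf g)"
  by (cases f; auto)+

section \<open>A deduction system for \<open>computes\<close>\<close>

abbreviation judgement :: "nat \<Rightarrow> nat \<Rightarrow> nat \<Rightarrow> nat \<Rightarrow> nat" where
  "judgement t a b c \<equiv> pr t (pr a (pr b c))"

abbreviation "jcomp \<equiv> judgement 2"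
abbreviation "jcomps \<equiv> judgement 3"
abbreviation "jnth \<equiv> judgement 4"
abbreviation "jpos \<equiv> judgement 5"

text \<open>Besides evaluation (\<open>jcomp\<close>) there are judgements for evaluating a list of
  functions (\<open>jcomps\<close>), looking up an entry (\<open>jnth\<close>) and being defined and
  nonzero at all arguments below a bound (\<open>jpos\<close>). They break composition, projection
  and minimisation into rules with at most two premises.\<close>

definition rule0 :: "nat \<Rightarrow> bool" where
  "rule0 j \<longleftrightarrow>
    (\<exists>xs. j = jcomp (pr 2 0) xs 0) \<or>
    (\<exists>x. j = jcomp (pr 3 0) (cons_code x 0) (Suc x)) \<or>
    (\<exists>xs. j = jcomps 0 xs 0) \<or>
    (\<exists>x xs. j = jnth 0 (cons_code x xs) x) \<or>
    (\<exists>f xs. j = jpos f 0 xs)"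

definition rule1 :: "nat \<Rightarrow> nat \<Rightarrow> bool" where
  "rule1 p j \<longleftrightarrow>
    (\<exists>i xs y. p = jnth i xs y \<and> j = jcomp (pr 4 i) xs y) \<or>
    (\<exists>i xs x y. p = jnth i xs y \<and> j = jnth (Suc i) (cons_code x xs) y) \<or>
    (\<exists>f g xs y. p = jcomp f xs y \<and> j = jcomp (pr 6 (pr f g)) (cons_code 0 xs) y)"

definition rule2 :: "nat \<Rightarrow> nat \<Rightarrow> nat \<Rightarrow> bool" where
  "rule2 p q j \<longleftrightarrow>
    (\<exists>f gs xs ys z. p = jcomps gs xs ys \<and> q = jcomp f ys z \<and> j = jcomp (pr 5 (pr f gs)) xs z) \<or>
    (\<exists>f g n xs y z. p = jcomp (pr 6 (pr f g)) (cons_code n xs) y \<and>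
      q = jcomp g (cons_code n (cons_code y xs)) z \<and>
      j = jcomp (pr 6 (pr f g)) (cons_code (Suc n) xs) z) \<or>
    (\<exists>f n xs. p = jcomp f (cons_code n xs) 0 \<and> q = jpos f n xs \<and> j = jcomp (pr 7 f) xs n) \<or>
    (\<exists>g gs xs y ys. p = jcomp g xs y \<and> q = jcomps gs xs ys \<and>
      j = jcomps (cons_code g gs) xs (cons_code y ys)) \<or>
    (\<exists>f n xs y. p = jpos f n xs \<and> q = jcomp f (cons_code n xs) (Suc y) \<and> j = jpos f (Suc n) xs)"

inductive ded :: "nat \<Rightarrow> bool" where
  ded0: "rule0 j \<Longrightarrow> ded j"
| ded1: "ded p \<Longrightarrow> rule1 p j \<Longrightarrow> ded j"
| ded2: "ded p \<Longrightarrow> ded q \<Longrightarrow> rule2 p q j \<Longrightarrow> ded j"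

text \<open>The rules also derive judgements about numbers that code no function or no list;
  soundness constrains only the judgements whose components are codes.\<close>

definition sound :: "nat \<Rightarrow> bool" where
  "sound j \<longleftrightarrow>
    (\<forall>f xs y. j = jcomp (code_recf f) (code_list xs) y \<longrightarrow> computes f xs y) \<and>
    (\<forall>gs xs c. j = jcomps (code_list (map code_recf gs)) (code_list xs) c \<longrightarrow>
      (\<exists>ys. c = code_list ys \<and> list_all2 (\<lambda>g y. computes g xs y) gs ys)) \<and>
    (\<forall>i xs y. j = jnth i (code_list xs) y \<longrightarrow> i < length xs \<and> xs ! i = y) \<and>
    (\<forall>f n xs. j = jpos (code_recf f) n (code_list xs) \<longrightarrow> (\<forall>m<n. \<exists>y. y \<noteq> 0 \<and> computes f (m # xs) y))"

lemma sound_judgement [simp]: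
  "sound (jcomp a b y) \<longleftrightarrow> (\<forall>f xs. a = code_recf f \<and> b = code_list xs \<longrightarrow> computes f xs y)"
  "sound (jcomps a b c) \<longleftrightarrow> (\<forall>gs xs. a = code_list (map code_recf gs) \<and> b = code_list xs \<longrightarrow>
    (\<exists>ys. c = code_list ys \<and> list_all2 (\<lambda>g y. computes g xs y) gs ys))"
  "sound (jnth i b y) \<longleftrightarrow> (\<forall>xs. b = code_list xs \<longrightarrow> i < length xs \<and> xs ! i = y)"
  "sound (jpos a n b) \<longleftrightarrow> (\<forall>f xs. a = code_recf f \<and> b = code_list xs \<longrightarrow>
    (\<forall>m<n. \<exists>y. y \<noteq> 0 \<and> computes f (m # xs) y))"
  by (simp_all add: sound_def)

lemma ded_sound: "ded j \<Longrightarrow> sound j"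
proof (induction rule: ded.induct)
  case (ded0 j)
  then show ?case
    unfolding rule0_def by (elim disjE exE; simp; auto intro: computes.intros)
next
  case (ded1 p j)
  from ded1.hyps(2) ded1.IH show ?case
    unfolding rule1_def
    by (elim disjE exE conjE; simp; auto intro: computes.proj computes.primrec_0)
next
  case (ded2 p q j)
  from ded2.hyps(3) ded2.IH show ?case
    unfolding rule2_def
  proof (elim disjE exE conjE, goal_cases)
    case (1 f gs xs ys z)
    then show ?case by simp (blast intro: computes.comp)
  next
    case (2 f g n xs y z)
    have "computes (PrimRec f' g') (Suc n # ys) z"
      if "f = code_recf f'" "g = code_recf g'" "xs = code_list ys" for f' g' ys
      using 2 that by (intro computes.primrec_Suc[of f' g' n ys y]) auto
    with 2 show ?case by auto
  next
    case (3 f n xs)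
    have "computes (Mu f') ys n" if "f = code_recf f'" "xs = code_list ys" for f' ys
      using 3 that by (intro computes.mu) auto
    with 3 show ?case by auto
  next
    case (4 g gs xs y ys)
    have "\<exists>zs. cons_code y ys = code_list zs \<and> list_all2 (\<lambda>g y. computes g ws y) (g' # gs') zs"
      if *: "g = code_recf g'" "gs = code_list (map code_recf gs')" "xs = code_list ws" for g' gs' ws
    proof -
      have "computes g' ws y" using 4 * by auto
      moreover obtain zs where "ys = code_list zs" "list_all2 (\<lambda>g y. computes g ws y) gs' zs"
      proof -
        have "sound (jcomps gs xs ys)" using 4 by (simp only:)
        then have "\<exists>zs. ys = code_list zs \<and> list_all2 (\<lambda>g y. computes g ws y) gs' zs"
          unfolding * sound_judgement by blast
        then show thesis using that by blast
      qed
      ultimately show ?thesis by (intro exI[of _ "y # zs"]) simp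
    qed
    with 4 show ?case by (auto simp: Cons_eq_map_conv)
  next
    case (5 f n xs y)
    have "\<exists>y. y \<noteq> 0 \<and> computes f' (m # ys) y"
      if "f = code_recf f'" "xs = code_list ys" "m < Suc n" for f' ys m
    proof (cases "m = n")
      case True
      have "computes f' (n # ys) (Suc y)" using 5 that(1,2) by auto
      then show ?thesis using True by blast
    next
      case False
      then show ?thesis using 5 that by auto
    qed
    with 5 show ?case by auto
  qed
qed

lemma ded_nth: "i < length xs \<Longrightarrow> ded (jnth i (code_list xs) (xs ! i))"
proof (induction xs arbitrary: i)
  case (Cons x xs)
  show ?case
  proof (cases i)
    case 0
    then show ?thesis by (intro ded0) (auto simp: rule0_def)
  next
    case (Suc i')
    then have "ded (jnth i' (code_list xs) (xs ! i'))" using Cons by simp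
    then show ?thesis by (rule ded1) (auto simp: rule1_def Suc)
  qed
qed simp

lemma ded_comps:
  "list_all2 (\<lambda>g y. ded (jcomp (code_recf g) (code_list xs) y)) gs ys \<Longrightarrow>
    ded (jcomps (code_list (map code_recf gs)) (code_list xs) (code_list ys))"
proof (induction rule: list_all2_induct)
  case Nil
  show ?case by (intro ded0) (auto simp: rule0_def)
next
  case (Cons g gs y ys)
  have "ded (jcomp (code_recf g) (code_list xs) y)" by (rule Cons)
  moreover have "ded (jcomps (code_list (map code_recf gs)) (code_list xs) (code_list ys))" by (rule Cons)
  ultimately show ?case by (rule ded2) (auto simp: rule2_def)
qed

lemma ded_pos:
  "(\<And>m. m < n \<Longrightarrow> \<exists>y. y \<noteq> 0 \<and> ded (jcomp (code_recf f) (code_list (m # xs)) y)) \<Longrightarrow>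
    ded (jpos (code_recf f) n (code_list xs))"
proof (induction n)
  case 0
  show ?case by (intro ded0) (auto simp: rule0_def)
next
  case (Suc n)
  then obtain y where y: "ded (jcomp (code_recf f) (code_list (n # xs)) (Suc y))"
    by (metis lessI not0_implies_Suc)
  have "ded (jpos (code_recf f) n (code_list xs))"
    using Suc by simp
  from this y show ?case by (rule ded2) (auto simp: rule2_def)
qed

lemma ded_complete: "computes f xs y \<Longrightarrow> ded (jcomp (code_recf f) (code_list xs) y)"
proof (induction rule: computes.induct)
  case (zero xs)
  show ?case by (intro ded0) (auto simp: rule0_def)
next
  case (succ x)
  show ?case by (intro ded0) (auto simp: rule0_def)
next
  case (proj i xs)
  from ded_nth[OF this] show ?case by (rule ded1) (auto simp: rule1_def)
next
  case (comp xs gs ys f z)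
  have "ded (jcomps (code_list (map code_recf gs)) (code_list xs) (code_list ys))"
    by (rule ded_comps) (rule list_all2_mono[OF comp.IH(1)], simp)
  then show ?case
    using comp.IH(2) by (rule ded2) (auto simp: rule2_def)
next
  case (primrec_0 f xs y g)
  from primrec_0.IH show ?case by (rule ded1) (auto simp: rule1_def)
next
  case (primrec_Suc f g n xs y z)
  from primrec_Suc.IH show ?case by (rule ded2) (auto simp: rule2_def)
next
  case (mu f n xs)
  have "ded (jpos (code_recf f) n (code_list xs))"
    using mu.IH(2) by (intro ded_pos) blast
  with mu.IH(1) show ?case by (rule ded2) (auto simp: rule2_def)
qed

lemma ded_iff_computes: "ded (jcomp (code_recf f) (code_list xs) y) \<longleftrightarrow> computes f xs y"
  using ded_complete ded_sound by (auto simp: sound_def)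

section \<open>Derivations as sequences of digits\<close>

definition step :: "nat set \<Rightarrow> nat \<Rightarrow> bool" where
  "step A j \<longleftrightarrow> rule0 j \<or> (\<exists>p\<in>A. rule1 p j) \<or> (\<exists>p\<in>A. \<exists>q\<in>A. rule2 p q j)"

lemma step_mono: "A \<subseteq> B \<Longrightarrow> step A j \<Longrightarrow> step B j"
  unfolding step_def by blast

text \<open>The latest conclusion stands first, so the premises of an entry have larger
  positions.\<close>

fun derivation :: "nat list \<Rightarrow> bool" where
  "derivation [] \<longleftrightarrow> True"
| "derivation (j # js) \<longleftrightarrow> derivation js \<and> step (set js) j"

lemma derivation_append: "derivation js \<Longrightarrow> derivation ks \<Longrightarrow> derivation (js @ ks)"
  by (induction js) (auto elim: step_mono[rotated])

lemma ded_derivation: "ded j \<Longrightarrow> \<exists>js. derivation js \<and> j \<in> set js"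
proof (induction rule: ded.induct)
  case (ded0 j)
  then have "derivation [j]" by (simp add: step_def)
  then show ?case by (intro exI[of _ "[j]"]) simp
next
  case (ded1 p j)
  then obtain js where "derivation js" "p \<in> set js" by blast
  then have "derivation (j # js)" using ded1.hyps by (auto simp: step_def)
  then show ?case by (intro exI[of _ "j # js"]) simp
next
  case (ded2 p q j)
  then obtain js ks where "derivation js" "p \<in> set js" "derivation ks" "q \<in> set ks" by blast
  then have "derivation (j # js @ ks)" using ded2.hyps by (auto simp: step_def intro!: derivation_append)
  then show ?case by (intro exI[of _ "j # js @ ks"]) simp
qed

lemma derivation_nth: "derivation js \<Longrightarrow> i < length js \<Longrightarrow> step (set (drop (Suc i) js)) (js ! i)"
  by (induction js arbitrary: i) (auto simp: less_Suc_eq_0_disj)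

definition digit :: "nat \<Rightarrow> nat \<Rightarrow> nat \<Rightarrow> nat" where "digit c u i = c div u ^ i mod u"

lemma dfun_digit [dioph_intros]: "dfun f \<Longrightarrow> dfun g \<Longrightarrow> dfun h \<Longrightarrow> dfun (\<lambda>v. digit (f v) (g v) (h v))"
  unfolding digit_def by (intro dioph_intros)

lemma digits_exist: "\<exists>c u. \<forall>i<length xs. digit c u i = xs ! i"
proof -
  define u where "u = Suc (sum_list xs)"
  have "digit (\<Sum>i<length xs. xs ! i * u ^ i) u i = xs ! i" if "i < length xs" for i
    unfolding digit_def using that
    by (intro digit_extract[where c = "(!) xs"]) (auto simp: u_def less_Suc_eq_le elem_le_sum_list)
  then show ?thesis by blast
qed

text \<open>The right-hand side has a single universal quantifier, bounded by the length
  \<open>l\<close>; everything else is existential and hence within reach of the closure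
  rules.\<close>

lemma ded_iff_digits:
  "ded j \<longleftrightarrow> (\<exists>c u l. (\<forall>i<l. rule0 (digit c u i) \<or>
      (\<exists>a. i < a \<and> a < l \<and> rule1 (digit c u a) (digit c u i)) \<or>
      (\<exists>a b. i < a \<and> a < l \<and> i < b \<and> b < l \<and> rule2 (digit c u a) (digit c u b) (digit c u i))) \<and>
    (\<exists>i. i < l \<and> j = digit c u i))"
proof
  assume "ded j"
  then obtain js where js: "derivation js" "j \<in> set js"
    using ded_derivation by blast
  obtain c u where cu: "\<And>i. i < length js \<Longrightarrow> digit c u i = js ! i"
    using digits_exist by blast
  have in_drop: "x \<in> set (drop (Suc i) js) \<Longrightarrow> \<exists>a. i < a \<and> a < length js \<and> x = digit c u a" for x i
  proof -
    assume "x \<in> set (drop (Suc i) js)"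
    then obtain k where "k < length js - Suc i" "x = js ! (Suc i + k)"
      by (auto simp: in_set_conv_nth)
    then show ?thesis by (intro exI[of _ "Suc i + k"]) (simp add: cu)
  qed
  have "rule0 (digit c u i) \<or>
      (\<exists>a. i < a \<and> a < length js \<and> rule1 (digit c u a) (digit c u i)) \<or>
      (\<exists>a b. i < a \<and> a < length js \<and> i < b \<and> b < length js \<and> rule2 (digit c u a) (digit c u b) (digit c u i))"
    if "i < length js" for i
    using derivation_nth[OF js(1) that] in_drop[of _ i] unfolding step_def cu[OF that] by metis
  moreover have "\<exists>i. i < length js \<and> j = digit c u i"
    using js(2) cu by (metis in_set_conv_nth)
  ultimately show "\<exists>c u l. (\<forall>i<l. rule0 (digit c u i) \<or>
      (\<exists>a. i < a \<and> a < l \<and> rule1 (digit c u a) (digit c u i)) \<or>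
      (\<exists>a b. i < a \<and> a < l \<and> i < b \<and> b < l \<and> rule2 (digit c u a) (digit c u b) (digit c u i))) \<and>
    (\<exists>i. i < l \<and> j = digit c u i)"
    by blast
next
  assume "\<exists>c u l. (\<forall>i<l. rule0 (digit c u i) \<or>
      (\<exists>a. i < a \<and> a < l \<and> rule1 (digit c u a) (digit c u i)) \<or>
      (\<exists>a b. i < a \<and> a < l \<and> i < b \<and> b < l \<and> rule2 (digit c u a) (digit c u b) (digit c u i))) \<and>
    (\<exists>i. i < l \<and> j = digit c u i)"
  then obtain c u l k where *: "\<And>i. i < l \<Longrightarrow> rule0 (digit c u i) \<or>
      (\<exists>a. i < a \<and> a < l \<and> rule1 (digit c u a) (digit c u i)) \<or>
      (\<exists>a b. i < a \<and> a < l \<and> i < b \<and> b < l \<and> rule2 (digit c u a) (digit c u b) (digit c u i))"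
    and k: "k < l" "j = digit c u k"
    by blast
  have "i < l \<Longrightarrow> ded (digit c u i)" for i
  proof (induction "l - i" arbitrary: i rule: less_induct)
    case less
    then have "a < l \<Longrightarrow> i < a \<Longrightarrow> ded (digit c u a)" for a
      by simp
    then show ?case
      using *[OF less.prems] by (metis ded0 ded1 ded2)
  qed
  then show "ded j" using k by simp
qed

lemma dioph_rules [dioph_intros]:
  "dfun f \<Longrightarrow> dioph (\<lambda>v. rule0 (f v))"
  "dfun f \<Longrightarrow> dfun g \<Longrightarrow> dioph (\<lambda>v. rule1 (f v) (g v))"
  "dfun f \<Longrightarrow> dfun g \<Longrightarrow> dfun h \<Longrightarrow> dioph (\<lambda>v. rule2 (f v) (g v) (h v))"
proof -
  have "dioph (\<lambda>v. rule0 (v 0))"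
    unfolding rule0_def by (intro dioph_intros)
  then show "dfun f \<Longrightarrow> dioph (\<lambda>v. rule0 (f v))" by (rule dioph_app1)
  have "dioph (\<lambda>v. rule1 (v 0) (v 1))"
    unfolding rule1_def by (intro dioph_intros)
  then show "dfun f \<Longrightarrow> dfun g \<Longrightarrow> dioph (\<lambda>v. rule1 (f v) (g v))" by (rule dioph_app2)
  have "dioph (\<lambda>v. rule2 (v 0) (v 1) (v 2))"
    unfolding rule2_def by (intro dioph_intros)
  then show "dfun f \<Longrightarrow> dfun g \<Longrightarrow> dfun h \<Longrightarrow> dioph (\<lambda>v. rule2 (f v) (g v) (h v))"
    by (rule dioph_app3)
qed

lemma dioph_ded: "dfun f \<Longrightarrow> dioph (\<lambda>v. ded (f v))"
proof -
  have "dioph (\<lambda>v. ded (v 0))"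
    unfolding ded_iff_digits by (intro dioph_intros)
  then show "dfun f \<Longrightarrow> ?thesis" by (rule dioph_app1)
qed

definition diagonal :: "nat set" where
  "diagonal = {n. ded (jcomp n (code_list [n]) 0)}"

lemma dioph_diagonal: "dioph (\<lambda>v. v 0 \<in> diagonal)"
  unfolding diagonal_def mem_Collect_eq code_list.simps by (intro dioph_intros dioph_ded)

text \<open>At its own code, \<open>f\<close> returns 0 iff the code lies in
  \<open>diagonal\<close>, which is where it would have to return 1.\<close>

lemma diagonal_undecidable: "\<not> (\<forall>n. computes f [n] (if n \<in> diagonal then 1 else 0))"
proof
  assume *: "\<forall>n. computes f [n] (if n \<in> diagonal then 1 else 0)"
  let ?n = "code_recf f"
  have "?n \<in> diagonal \<longleftrightarrow> computes f [?n] 0"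
    by (simp only: diagonal_def mem_Collect_eq ded_iff_computes)
  then show False
    using *[rule_format, of ?n] computes_deterministic[of f "[?n]" 0 1] by (auto split: if_splits)
qed


section \<open>Sums of four squares\<close>

definition sum4sq :: "int \<Rightarrow> bool" where
  "sum4sq n \<longleftrightarrow> (\<exists>a b c d. n = a * a + b * b + c * c + d * d)"

lemma euler_four_square:
  fixes a b c d :: int
  shows "(a * a + b * b + c * c + d * d) * (a' * a' + b' * b' + c' * c' + d' * d') =
    (a * a' + b * b' + c * c' + d * d') * (a * a' + b * b' + c * c' + d * d') +
    (a * b' - b * a' + c * d' - d * c') * (a * b' - b * a' + c * d' - d * c') +
    (a * c' - b * d' - c * a' + d * b') * (a * c' - b * d' - c * a' + d * b') +
    (a * d' + b * c' - c * b' - d * a') * (a * d' + b * c' - c * b' - d * a')"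
  by (simp add: algebra_simps)

lemma sum4sq_mult: "sum4sq m \<Longrightarrow> sum4sq n \<Longrightarrow> sum4sq (m * n)"
  unfolding sum4sq_def using euler_four_square by metis

lemma balanced_residue:
  fixes m x :: int
  assumes "m > 0"
  shows "\<exists>y t. x = y + m * t \<and> \<bar>2 * y\<bar> \<le> m"
proof -
  define h where "h = m div 2"
  define r where "r = (x + h) mod m"
  have r: "0 \<le> r" "r < m" using assms by (auto simp: r_def)
  have "x = (r - h) + m * ((x + h) div m)"
    using mod_mult_div_eq[of "x + h" m] unfolding r_def by linarith
  moreover have "\<bar>2 * (r - h)\<bar> \<le> m"
    using r unfolding h_def by presburger
  ultimately show ?thesis by blast
qed

text \<open>Every residue satisfies \<open>\<bar>2 * y\<bar> \<le> m\<close>, and the extreme case that all four residues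
  are \<open>m / 2\<close> up to sign is refuted like the case that all are 0; so even \<open>m\<close> need no separate
  treatment.\<close>

lemma sum4sq_descent:
  fixes p m :: int
  assumes p: "prime p" and m: "1 < m" "m < p" and sq: "sum4sq (m * p)"
  shows "\<exists>r. 0 < r \<and> r < m \<and> sum4sq (r * p)"
proof -
  obtain a b c d where abcd: "m * p = a * a + b * b + c * c + d * d"
    using sq by (auto simp: sum4sq_def)
  obtain a' s where a: "a = a' + m * s" "\<bar>2 * a'\<bar> \<le> m" using balanced_residue[of m a] m by auto
  obtain b' t where b: "b = b' + m * t" "\<bar>2 * b'\<bar> \<le> m" using balanced_residue[of m b] m by auto
  obtain c' u where c: "c = c' + m * u" "\<bar>2 * c'\<bar> \<le> m" using balanced_residue[of m c] m by auto
  obtain d' v where d: "d = d' + m * v" "\<bar>2 * d'\<bar> \<le> m" using balanced_residue[of m d] m by auto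
  define N where "N = a' * a' + b' * b' + c' * c' + d' * d'"
  \<comment> \<open>This is the cofactor in \<open>N = m * r\<close>; the sum of the squares of the
    residues is divisible by \<open>m\<close> because that of \<open>a\<close>, \<open>b\<close>,
    \<open>c\<close>, \<open>d\<close> is.\<close>
  define r where "r = p - (2 * (a' * s + b' * t + c' * u + d' * v) + m * (s * s + t * t + u * u + v * v))"
  have N: "N = m * r"
    using abcd unfolding a b c d N_def r_def by algebra
  have sq_le: "4 * (x * x) \<le> m * m" if "\<bar>2 * x\<bar> \<le> m" for x
  proof -
    have "\<bar>2 * x\<bar> * \<bar>2 * x\<bar> \<le> m * m" using that m by (intro mult_mono) auto
    then show ?thesis by (simp add: abs_mult_self_eq flip: abs_mult)
  qed
  note le = sq_le[OF a(2)] sq_le[OF b(2)] sq_le[OF c(2)] sq_le[OF d(2)]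
  have "m * r \<le> m * m" using le unfolding N[symmetric] N_def by linarith
  then have r_le: "r \<le> m" using m by simp
  have "0 \<le> m * r" unfolding N[symmetric] N_def by simp
  then have r_ge: "0 \<le> r" using m by (simp add: zero_le_mult_iff)
  have ndvd: "\<not> m * m dvd m * p"
  proof
    assume "m * m dvd m * p"
    then have "m dvd p" using m by simp
    then show False using p m by (metis abs_of_nonneg less_le less_trans prime_int_altdef zero_less_one order_less_irrefl)
  qed
  have dvd_if: "m * m dvd m * p" if *: "m * m dvd N" "m dvd 2 * a'" "m dvd 2 * b'" "m dvd 2 * c'" "m dvd 2 * d'"
  proof -
    have eq: "m * p = N + m * (2 * a' * s + 2 * b' * t + 2 * c' * u + 2 * d' * v) + m * m * (s * s + t * t + u * u + v * v)"
      unfolding abcd a b c d N_def by algebra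
    have "m dvd 2 * a' * s + 2 * b' * t + 2 * c' * u + 2 * d' * v"
      by (intro dvd_add *(2-5)[THEN dvd_mult2])
    then have "m * m dvd m * (2 * a' * s + 2 * b' * t + 2 * c' * u + 2 * d' * v)"
      by (intro mult_dvd_mono) auto
    moreover have "m * m dvd m * m * (s * s + t * t + u * u + v * v)"
      by (rule dvd_triv_left)
    ultimately show ?thesis
      unfolding eq using *(1) by (intro dvd_add)
  qed
  have "r \<noteq> 0"
  proof
    assume "r = 0"
    then have "N = 0" using N by simp
    then have "a' * a' = 0" "b' * b' = 0" "c' * c' = 0" "d' * d' = 0"
      unfolding N_def using zero_le_square[of a'] zero_le_square[of b'] zero_le_square[of c'] zero_le_square[of d']
      by linarith+
    then show False using dvd_if ndvd \<open>N = 0\<close> by simp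
  qed
  moreover have "r \<noteq> m"
  proof
    assume "r = m"
    then have "N = m * m" using N by simp
    then have "4 * (a' * a') = m * m" "4 * (b' * b') = m * m" "4 * (c' * c') = m * m" "4 * (d' * d') = m * m"
      unfolding N_def using le by linarith+
    then have "m * m dvd (2 * a') * (2 * a')" "m * m dvd (2 * b') * (2 * b')"
      "m * m dvd (2 * c') * (2 * c')" "m * m dvd (2 * d') * (2 * d')"
      by simp_all
    then have "m dvd 2 * a'" "m dvd 2 * b'" "m dvd 2 * c'" "m dvd 2 * d'"
      by (simp_all only: power2_eq_square[symmetric] pow_divides_pow_iff zero_less_numeral)
    then show False using dvd_if ndvd \<open>N = m * m\<close> by simp
  qed
  moreover have "sum4sq (r * p)"
  proof -
    \<comment> \<open>Euler's identity writes \<open>(m * p) * (m * r)\<close> as four squares.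
      Since the residues are congruent to \<open>a\<close>, \<open>b\<close>, \<open>c\<close>,
      \<open>d\<close>, each of its four forms is divisible by \<open>m\<close>; up to sign the
      quotients are \<open>z1\<close> to \<open>z4\<close>, and \<open>m * m\<close>
      cancels.\<close>
    define z1 where "z1 = p - (a * s + b * t + c * u + d * v)"
    define z2 where "z2 = a * t - b * s + c * v - d * u"
    define z3 where "z3 = a * u - b * v - c * s + d * t"
    define z4 where "z4 = a * v + b * u - c * t - d * s"
    have a': "a' = a - m * s" "b' = b - m * t" "c' = c - m * u" "d' = d - m * v"
      using a b c d by auto
    have 1: "a * a' + b * b' + c * c' + d * d' = m * z1"
      using abcd unfolding a' z1_def by algebra
    have 2: "a * b' - b * a' + c * d' - d * c' = - m * z2"
      unfolding a' z2_def by algebra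
    have 3: "a * c' - b * d' - c * a' + d * b' = - m * z3"
      unfolding a' z3_def by algebra
    have 4: "a * d' + b * c' - c * b' - d * a' = - m * z4"
      unfolding a' z4_def by algebra
    have "(m * p) * (m * r) = (m * z1) * (m * z1) + (- m * z2) * (- m * z2) + (- m * z3) * (- m * z3) + (- m * z4) * (- m * z4)"
      unfolding abcd N[symmetric] N_def euler_four_square 1 2 3 4 ..
    then have "(m * m) * (r * p) = (m * m) * (z1 * z1 + z2 * z2 + z3 * z3 + z4 * z4)"
      by algebra
    then have "r * p = z1 * z1 + z2 * z2 + z3 * z3 + z4 * z4" using m by simp
    then show ?thesis by (auto simp: sum4sq_def)
  qed
  ultimately show ?thesis using r_le r_ge by (intro exI[of _ r]) auto
qed

lemma sum4sq_if_multiple: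
  fixes p :: int
  assumes p: "prime p"
  shows "0 < m \<Longrightarrow> m < p \<Longrightarrow> sum4sq (m * p) \<Longrightarrow> sum4sq p"
proof (induction "nat m" arbitrary: m rule: less_induct)
  case less
  show ?case
  proof (cases "m = 1")
    case False
    then obtain r where "0 < r" "r < m" "sum4sq (r * p)"
      using sum4sq_descent[OF p, of m] less.prems by auto
    then show ?thesis using less.hyps[of r] less.prems by auto
  qed (use less in simp)
qed

lemma inj_on_square_mod:
  fixes p :: int
  assumes p: "prime p" and h: "2 * h < p"
  shows "inj_on (\<lambda>x. x * x mod p) {0..h}"
proof (rule inj_onI)
  fix x y assume xy: "x \<in> {0..h}" "y \<in> {0..h}" "x * x mod p = y * y mod p"
  then have "p dvd x * x - y * y" by (simp add: mod_eq_dvd_iff)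
  also have "x * x - y * y = (x - y) * (x + y)" by (simp add: algebra_simps)
  finally have "p dvd x - y \<or> p dvd x + y"
    using p prime_dvd_mult_iff by blast
  moreover have "\<bar>x - y\<bar> < p" "\<bar>x + y\<bar> < p" using xy h by auto
  ultimately have "x - y = 0 \<or> x + y = 0"
    using dvd_imp_le_int by (metis abs_of_nonneg less_le_not_le prime_ge_0_int p)
  then show "x = y" using xy by auto
qed

text \<open>Pigeonhole: the residues of \<open>x * x\<close> and those of \<open>- 1 - y * y\<close>
  are \<open>h + 1\<close> each, together \<open>p + 1\<close>, so the two sets meet.\<close>

lemma prime_dvd_two_squares_plus_one:
  fixes p :: int
  assumes p: "prime p" and odd: "odd p"
  defines "h \<equiv> (p - 1) div 2"
  shows "\<exists>x\<in>{0..h}. \<exists>y\<in>{0..h}. p dvd x * x + y * y + 1"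
proof -
  have p2: "p > 2" using p odd prime_ge_2_int[OF p] by (cases "p = 2") auto
  have h: "2 * h + 1 = p" using odd by (auto simp: h_def elim: oddE)
  define A where "A = (\<lambda>x. x * x mod p) ` {0..h}"
  define B where "B = (\<lambda>x. (- 1 - x) mod p) ` A"
  have inj: "inj_on (\<lambda>x. x * x mod p) {0..h}"
    using h by (intro inj_on_square_mod p) auto
  have A_sub: "A \<subseteq> {0..<p}" using p2 by (auto simp: A_def)
  have inj2: "inj_on (\<lambda>x. (- 1 - x) mod p) A"
  proof (rule inj_onI)
    fix x y assume xy: "x \<in> A" "y \<in> A" "(- 1 - x) mod p = (- 1 - y) mod p"
    then have "p dvd (- 1 - x) - (- 1 - y)" by (simp only: mod_eq_dvd_iff)
    then have "p dvd y - x" by simp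
    moreover have "x \<in> {0..<p}" "y \<in> {0..<p}" using xy A_sub by blast+
    then have "\<bar>y - x\<bar> < p" by auto
    ultimately show "x = y" using dvd_imp_le_int[of "y - x" p] p2 by force
  qed
  have cA: "card A = nat (h + 1)" unfolding A_def card_image[OF inj] by simp
  have cB: "card B = nat (h + 1)" unfolding B_def card_image[OF inj2] cA ..
  have B_sub: "B \<subseteq> {0..<p}" using p2 by (auto simp: B_def)
  have "A \<inter> B \<noteq> {}"
  proof
    assume "A \<inter> B = {}"
    then have "card (A \<union> B) = nat (h + 1) + nat (h + 1)"
      by (subst card_Un_disjoint) (simp_all add: cA cB, simp_all add: A_def B_def)
    moreover have "card (A \<union> B) \<le> card {0..<p}"
      using A_sub B_sub by (intro card_mono) auto
    ultimately show False using h p2 by simp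
  qed
  then obtain x y where xy: "x \<in> {0..h}" "y \<in> {0..h}" "x * x mod p = (- 1 - y * y mod p) mod p"
  proof -
    assume "A \<inter> B \<noteq> {}"
    then obtain z where "z \<in> A" "z \<in> B" by blast
    then obtain x w where "x \<in> {0..h}" "z = x * x mod p" "w \<in> A" "z = (- 1 - w) mod p"
      unfolding B_def unfolding A_def by blast
    moreover from \<open>w \<in> A\<close> obtain y where "y \<in> {0..h}" "w = y * y mod p"
      unfolding A_def by blast
    ultimately show thesis using that by simp
  qed
  have "(- 1 - y * y mod p) mod p = (- 1 - y * y) mod p"
    by (rule mod_diff_right_eq)
  with xy have "p dvd x * x - (- 1 - y * y)"
    by (simp only: mod_eq_dvd_iff)
  then have "p dvd x * x + y * y + 1" by (simp add: algebra_simps)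
  with xy show ?thesis by blast
qed

lemma sum4sq_prime:
  fixes p :: int
  assumes p: "prime p"
  shows "sum4sq p"
proof (cases "odd p")
  case False
  then have "p = 2" using p primes_dvd_imp_eq[of 2 p] by auto
  then have "p = 1 * 1 + 1 * 1 + 0 * 0 + 0 * 0" by simp
  then show ?thesis unfolding sum4sq_def by blast
next
  case True
  obtain x y where xy: "x \<in> {0..(p - 1) div 2}" "y \<in> {0..(p - 1) div 2}" "p dvd x * x + y * y + 1"
    using prime_dvd_two_squares_plus_one[OF p True] by blast
  then obtain m where m: "x * x + y * y + 1 = p * m" by blast
  have p2: "p \<ge> 2" using p prime_ge_2_int by blast
  have le: "2 * x \<le> p - 1" "2 * y \<le> p - 1" "0 \<le> x" "0 \<le> y" using xy by auto
  have "(2 * x) * (2 * x) \<le> (p - 1) * (p - 1)" "(2 * y) * (2 * y) \<le> (p - 1) * (p - 1)"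
    using le p2 by (intro mult_mono; simp)+
  moreover have "(p - 1) * (p - 1) = p * p - 2 * p + 1" by algebra
  ultimately have "4 * (p * m) < 4 * (p * p)"
    unfolding m[symmetric] using p2 mult_mono[of 2 p 2 p] by (simp add: algebra_simps)
  then have "m < p" using p2 by simp
  moreover have "0 < p * m" unfolding m[symmetric] using zero_le_square[of x] zero_le_square[of y] by linarith
  then have "0 < m" using p2 by (simp add: zero_less_mult_iff)
  moreover have "sum4sq (m * p)"
    unfolding sum4sq_def by (intro exI[of _ x] exI[of _ y] exI[of _ 1] exI[of _ 0]) (use m in \<open>simp add: mult.commute\<close>)
  ultimately show ?thesis using sum4sq_if_multiple[OF p] by blast
qed

lemma four_squares: "sum4sq (int n)"
proof (induction n rule: less_induct)
  case (less n)
  consider "n = 0" | "n = 1" | "n > 1" by linarith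
  then show ?case
  proof cases
    case 3
    then obtain p where p: "prime p" "p dvd n" using prime_factor_nat[of n] by auto
    then obtain k where k: "n = p * k" by blast
    have "k < n" using k p(1) 3 prime_gt_1_nat[of p] by (cases "k = 0") auto
    then show ?thesis
      using p(1) less[OF \<open>k < n\<close>] unfolding k of_nat_mult by (intro sum4sq_mult[OF sum4sq_prime]) auto
  next
    case 1
    then have "int n = 0 * 0 + 0 * 0 + 0 * 0 + 0 * 0" by simp
    then show ?thesis unfolding sum4sq_def by blast
  next
    case 2
    then have "int n = 1 * 1 + 0 * 0 + 0 * 0 + 0 * 0" by simp
    then show ?thesis unfolding sum4sq_def by blast
  qed
qed


section \<open>Products of four abelian subgroups\<close>

definition hmat :: "int \<Rightarrow> int \<Rightarrow> int \<Rightarrow> int ^ 3 ^ 3" where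
  "hmat a b c = vector [vector [1, a, c], vector [0, 1, b], vector [0, 0, 1]]"

lemma hmat_mult: "hmat a b c ** hmat a' b' c' = hmat (a + a') (b + b') (c + c' + a * b')"
  by (simp add: hmat_def vec_eq_iff forall_3 matrix_matrix_mult_def sum_3)

lemma hmat_one: "hmat 0 0 0 = mat 1"
  by (simp add: hmat_def vec_eq_iff forall_3 mat_def)

lemma hmat_carrier: "hmat a b c \<in> carrier heisenberg"
  by (simp add: hmat_def heisenberg_def)

lemma hmat_eq_iff: "hmat a b c = hmat a' b' c' \<longleftrightarrow> a = a' \<and> b = b' \<and> c = c'"
  by (auto simp: hmat_def vec_eq_iff forall_3)

definition hvec :: "nat \<Rightarrow> (nat \<Rightarrow> int) \<Rightarrow> (nat \<Rightarrow> int) \<Rightarrow> (nat \<Rightarrow> int) \<Rightarrow> nat \<Rightarrow> int ^ 3 ^ 3" where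
  "hvec d a b c = (\<lambda>j\<in>{..<d}. hmat (a j) (b j) (c j))"

lemma hvec_carrier: "hvec d a b c \<in> carrier (heisenberg_power d)"
  by (auto simp: hvec_def heisenberg_power_def hmat_carrier)

lemma hvec_mult: "hvec d a b c \<otimes>\<^bsub>heisenberg_power d\<^esub> hvec d a' b' c' =
    hvec d (\<lambda>j. a j + a' j) (\<lambda>j. b j + b' j) (\<lambda>j. c j + c' j + a j * b' j)"
  by (auto simp: hvec_def heisenberg_power_def heisenberg_def fun_eq_iff hmat_mult)

lemma hvec_one: "\<one>\<^bsub>heisenberg_power d\<^esub> = hvec d (\<lambda>_. 0) (\<lambda>_. 0) (\<lambda>_. 0)"
  by (auto simp: hvec_def heisenberg_power_def heisenberg_def fun_eq_iff hmat_one)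

lemma hvec_eq_iff: "hvec d a b c = hvec d a' b' c' \<longleftrightarrow> (\<forall>j<d. a j = a' j \<and> b j = b' j \<and> c j = c' j)"
  by (auto simp: hvec_def fun_eq_iff hmat_eq_iff)

lemma hvec_cong: "(\<And>j. a j = a' j) \<Longrightarrow> (\<And>j. b j = b' j) \<Longrightarrow> (\<And>j. c j = c' j) \<Longrightarrow> hvec d a b c = hvec d a' b' c'"
  by (simp add: hvec_eq_iff)

lemma hvec_central_power:
  "hvec d (\<lambda>_. 0) (\<lambda>_. 0) c [^]\<^bsub>heisenberg_power d\<^esub> (n::nat) = hvec d (\<lambda>_. 0) (\<lambda>_. 0) (\<lambda>j. int n * c j)"
proof -
  interpret group "heisenberg_power d" by (rule group_heisenberg_power)
  show ?thesis
    by (induction n) (auto simp: hvec_one hvec_mult algebra_simps intro!: hvec_cong)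
qed

definition additive_form :: "(('i \<Rightarrow> int) \<Rightarrow> int) \<Rightarrow> bool" where
  "additive_form l \<longleftrightarrow> (\<forall>x y. l (\<lambda>i. x i + y i) = l x + l y)"

lemma additive_form_add: "additive_form l \<Longrightarrow> l (\<lambda>i. x i + y i) = l x + l y"
  by (simp add: additive_form_def)

lemma additive_form_zero: "additive_form l \<Longrightarrow> l (\<lambda>i. 0) = 0"
  using additive_form_add[of l "\<lambda>_. 0" "\<lambda>_. 0"] by simp

lemma additive_form_minus: "additive_form l \<Longrightarrow> l (\<lambda>i. - x i) = - l x"
  using additive_form_add[of l x "\<lambda>i. - x i"] additive_form_zero[of l] by simp

text \<open>By \<open>ab\<close>, in each coordinate one of the two superdiagonal forms vanishes
  identically. The commutator term disappears, and the set is a homomorphic image of an additive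
  group.\<close>

lemma subgroup_hvec:
  fixes a b c :: "nat \<Rightarrow> ('i \<Rightarrow> int) \<Rightarrow> int" and d :: nat
  assumes a: "\<And>j. additive_form (a j)" and b: "\<And>j. additive_form (b j)" and c: "\<And>j. additive_form (c j)"
    and ab: "\<And>j x y. a j x * b j y = 0"
  defines "A \<equiv> {hvec d (\<lambda>j. a j x) (\<lambda>j. b j x) (\<lambda>j. c j x) | x :: 'i \<Rightarrow> int. True}"
  shows "subgroup A (heisenberg_power d) \<and> comm_group (heisenberg_power d\<lparr>carrier := A\<rparr>)"
proof -
  interpret group "heisenberg_power d" by (rule group_heisenberg_power)
  let ?h = "\<lambda>x. hvec d (\<lambda>j. a j x) (\<lambda>j. b j x) (\<lambda>j. c j x)"
  have mult: "?h x \<otimes>\<^bsub>heisenberg_power d\<^esub> ?h y = ?h (\<lambda>i. x i + y i)" for x y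
    by (simp add: hvec_mult ab additive_form_add a b c)
  have one: "\<one>\<^bsub>heisenberg_power d\<^esub> = ?h (\<lambda>_. 0)"
    by (simp add: hvec_one additive_form_zero a b c)
  have inv: "inv\<^bsub>heisenberg_power d\<^esub> (?h x) = ?h (\<lambda>i. - x i)" for x
    by (rule inv_equality) (simp_all add: mult one hvec_carrier)
  have sub: "subgroup A (heisenberg_power d)"
  proof (rule subgroupI)
    show "A \<subseteq> carrier (heisenberg_power d)" by (auto simp: A_def hvec_carrier)
    show "A \<noteq> {}" by (auto simp: A_def)
    show "inv\<^bsub>heisenberg_power d\<^esub> x \<in> A" if "x \<in> A" for x
      using that inv unfolding A_def by blast
    show "x \<otimes>\<^bsub>heisenberg_power d\<^esub> y \<in> A" if "x \<in> A" "y \<in> A" for x y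
      using that mult unfolding A_def by blast
  qed
  have "comm_group (heisenberg_power d\<lparr>carrier := A\<rparr>)"
  proof (rule group.group_comm_groupI)
    show "group (heisenberg_power d\<lparr>carrier := A\<rparr>)"
      using sub group_axioms by (rule subgroup.subgroup_is_group)
    show "x \<otimes>\<^bsub>heisenberg_power d\<lparr>carrier := A\<rparr>\<^esub> y = y \<otimes>\<^bsub>heisenberg_power d\<lparr>carrier := A\<rparr>\<^esub> x"
      if "x \<in> carrier (heisenberg_power d\<lparr>carrier := A\<rparr>)" "y \<in> carrier (heisenberg_power d\<lparr>carrier := A\<rparr>)" for x y
      using that by (auto simp: A_def mult add.commute)
  qed
  with sub show ?thesis by blast
qed

lemma set_mult4:
  "g \<in> A <#>\<^bsub>G\<^esub> B <#>\<^bsub>G\<^esub> C <#>\<^bsub>G\<^esub> D \<longleftrightarrow>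
    (\<exists>a\<in>A. \<exists>b\<in>B. \<exists>c\<in>C. \<exists>d\<in>D. g = a \<otimes>\<^bsub>G\<^esub> b \<otimes>\<^bsub>G\<^esub> c \<otimes>\<^bsub>G\<^esub> d)"
  by (auto simp: set_mult_def)

lemma bex_range: "(\<exists>a\<in>{f x |x. True}. P a) \<longleftrightarrow> (\<exists>x. P (f x))"
  by blast

text \<open>In each coordinate the conditions on the entries above the diagonal force the third and fourth factor
  to cancel the first and second one, which leaves the commutator \<open>l x * m y\<close> and a free central part.\<close>

lemma hvec_in_product_iff:
  fixes l m k :: "nat \<Rightarrow> ('i \<Rightarrow> int) \<Rightarrow> int"
  assumes l: "\<And>j. additive_form (l j)" and m: "\<And>j. additive_form (m j)"
  shows "hvec d (\<lambda>_. 0) (\<lambda>_. 0) t \<in>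
      {hvec d (\<lambda>j. l j x) (\<lambda>j. 0) (\<lambda>j. 0) | x. True} <#>\<^bsub>heisenberg_power d\<^esub>
      {hvec d (\<lambda>j. 0) (\<lambda>j. m j y) (\<lambda>j. 0) | y. True} <#>\<^bsub>heisenberg_power d\<^esub>
      {hvec d (\<lambda>j. l j x) (\<lambda>j. 0) (\<lambda>j. 0) | x. True} <#>\<^bsub>heisenberg_power d\<^esub>
      {hvec d (\<lambda>j. 0) (\<lambda>j. m j (\<lambda>i. x (Inl i))) (\<lambda>j. k j (\<lambda>i. x (Inr i))) | x. True}
    \<longleftrightarrow> (\<exists>x y z. \<forall>j<d. l j x * m j y + k j z = t j)"
    (is "?t \<in> ?P \<longleftrightarrow> _")
proof -
  have "?t \<in> ?P \<longleftrightarrow> (\<exists>x y x' w. ?t = hvec d (\<lambda>j. l j x) (\<lambda>j. 0) (\<lambda>j. 0) \<otimes>\<^bsub>heisenberg_power d\<^esub>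
      hvec d (\<lambda>j. 0) (\<lambda>j. m j y) (\<lambda>j. 0) \<otimes>\<^bsub>heisenberg_power d\<^esub>
      hvec d (\<lambda>j. l j x') (\<lambda>j. 0) (\<lambda>j. 0) \<otimes>\<^bsub>heisenberg_power d\<^esub>
      hvec d (\<lambda>j. 0) (\<lambda>j. m j (\<lambda>i. w (Inl i))) (\<lambda>j. k j (\<lambda>i. w (Inr i))))"
    unfolding set_mult4 bex_range ..
  also have "\<dots> \<longleftrightarrow> (\<exists>x y x' w. \<forall>j<d. l j x + l j x' = 0 \<and> m j y + m j (\<lambda>i. w (Inl i)) = 0 \<and>
      l j x * m j y + k j (\<lambda>i. w (Inr i)) + (l j x + l j x') * m j (\<lambda>i. w (Inl i)) = t j)"
    unfolding hvec_mult hvec_eq_iff by (simp add: eq_commute[of 0] eq_commute[of "t _"])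
  also have "\<dots> \<longleftrightarrow> (\<exists>x y z. \<forall>j<d. l j x * m j y + k j z = t j)"
  proof
    assume "\<exists>x y x' w. \<forall>j<d. l j x + l j x' = 0 \<and> m j y + m j (\<lambda>i. w (Inl i)) = 0 \<and>
      l j x * m j y + k j (\<lambda>i. w (Inr i)) + (l j x + l j x') * m j (\<lambda>i. w (Inl i)) = t j"
    then obtain x y x' and w :: "'i + 'i \<Rightarrow> int" where
      *: "\<forall>j<d. l j x + l j x' = 0 \<and> m j y + m j (\<lambda>i. w (Inl i)) = 0 \<and>
        l j x * m j y + k j (\<lambda>i. w (Inr i)) + (l j x + l j x') * m j (\<lambda>i. w (Inl i)) = t j"
      by blast
    then show "\<exists>x y z. \<forall>j<d. l j x * m j y + k j z = t j"
      by (intro exI[of _ x] exI[of _ y] exI[of _ "\<lambda>i. w (Inr i)"]) auto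
  next
    assume "\<exists>x y z. \<forall>j<d. l j x * m j y + k j z = t j"
    then obtain x y z where *: "\<forall>j<d. l j x * m j y + k j z = t j" by blast
    then show "\<exists>x y x' w. \<forall>j<d. l j x + l j x' = 0 \<and> m j y + m j (\<lambda>i. w (Inl i)) = 0 \<and>
      l j x * m j y + k j (\<lambda>i. w (Inr i)) + (l j x + l j x') * m j (\<lambda>i. w (Inl i)) = t j"
      \<comment> \<open>The sum type of indices lets the fourth factor undo \<open>y\<close> and
        choose its central part \<open>z\<close> independently.\<close>
      by (intro exI[of _ x] exI[of _ y] exI[of _ "\<lambda>i. - x i"] exI[of _ "case_sum (\<lambda>i. - y i) z"])
        (simp add: additive_form_minus l m)
  qed
  finally show ?thesis .
qed


section \<open>Diophantine sets in powers of the Heisenberg group\<close>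

datatype 'i quad = Times 'i 'i 'i | Plus 'i 'i 'i

primrec holds :: "('i \<Rightarrow> int) \<Rightarrow> 'i quad \<Rightarrow> bool" where
  "holds x (Times a b c) \<longleftrightarrow> x a * x b = x c"
| "holds x (Plus a b c) \<longleftrightarrow> x a + x b = x c"

primrec quad_indices :: "'i quad \<Rightarrow> 'i list" where
  "quad_indices (Times a b c) = [a, b, c]"
| "quad_indices (Plus a b c) = [a, b, c]"

text \<open>The equations contain no constants: numerals are reached from the unknown
  \<open>Cst 1\<close> by addition, and \<open>0 + 0 = 0\<close> pins down the unknown
  \<open>Cst 0\<close>.\<close>

primrec cst_eqs :: "nat \<Rightarrow> 'a tm quad list" where
  "cst_eqs 0 = [Plus (Cst 0) (Cst 0) (Cst 0)]"
| "cst_eqs (Suc c) = Plus (Cst c) (Cst 1) (Cst (Suc c)) # cst_eqs c"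

text \<open>The unknowns are indexed by terms, each standing for the value of its term.\<close>

primrec tm_eqs :: "'a tm \<Rightarrow> 'a tm quad list" where
  "tm_eqs (Var v) = []"
| "tm_eqs (Cst c) = cst_eqs c"
| "tm_eqs (Add s t) = Plus s t (Add s t) # tm_eqs s @ tm_eqs t"
| "tm_eqs (Mul s t) = Times s t (Mul s t) # tm_eqs s @ tm_eqs t"

lemma cst_eqs_sound: "x (Cst 1) = 1 \<Longrightarrow> \<forall>e\<in>set (cst_eqs c). holds x e \<Longrightarrow> x (Cst c) = int c"
proof (induction c)
  case (Suc c)
  then have "x (Cst c) + x (Cst 1) = x (Cst (Suc c))" "x (Cst c) = int c" by auto
  then show ?case using Suc.prems(1) by linarith
qed simp

lemma tm_eqs_sound:
  "x (Cst 1) = 1 \<Longrightarrow> \<forall>e\<in>set (tm_eqs t). holds x e \<Longrightarrow> x t = tval (\<lambda>v. x (Var v)) t"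
proof (induction t)
  case (Cst c)
  then show ?case using cst_eqs_sound[of x c] by simp
next
  case (Add s t)
  then have "x s + x t = x (Add s t)" by simp
  then show ?case using Add by (auto simp: ball_Un)
next
  case (Mul s t)
  then have "x s * x t = x (Mul s t)" by simp
  then show ?case using Mul by (auto simp: ball_Un)
qed simp

lemma holds_cst_eqs: "e \<in> set (cst_eqs c) \<Longrightarrow> holds (tval f) e"
  by (induction c) auto

lemma holds_tm_eqs: "e \<in> set (tm_eqs t) \<Longrightarrow> holds (tval f) e"
  by (induction t) (auto dest: holds_cst_eqs)

text \<open>Natural unknowns become sums of four squares of integer unknowns; the parameters are all
  identified with the variable 0.\<close>

primrec int_tm :: "(nat + nat) tm \<Rightarrow> nat tm" where
  "int_tm (Var v) = (case v of Inl _ \<Rightarrow> Var 0 | Inr i \<Rightarrow>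
    Add (Add (Add (Mul (Var (Suc (4 * i + 0))) (Var (Suc (4 * i + 0)))) (Mul (Var (Suc (4 * i + 1))) (Var (Suc (4 * i + 1)))))
      (Mul (Var (Suc (4 * i + 2))) (Var (Suc (4 * i + 2))))) (Mul (Var (Suc (4 * i + 3))) (Var (Suc (4 * i + 3)))))"
| "int_tm (Cst c) = Cst c"
| "int_tm (Add s t) = Add (int_tm s) (int_tm t)"
| "int_tm (Mul s t) = Mul (int_tm s) (int_tm t)"

lemma tval_int_tm:
  assumes "f 0 = int n"
    "\<And>i. int (w i) = f (Suc (4 * i + 0)) * f (Suc (4 * i + 0)) + f (Suc (4 * i + 1)) * f (Suc (4 * i + 1)) +
      f (Suc (4 * i + 2)) * f (Suc (4 * i + 2)) + f (Suc (4 * i + 3)) * f (Suc (4 * i + 3))"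
  shows "tval f (int_tm t) = int (tval (case_sum (\<lambda>_. n) w) t)"
  by (induction t) (auto simp: assms split: sum.split)

theorem dioph_quadratic:
  assumes "dioph P"
  shows "\<exists>es :: nat tm quad list. \<forall>n. P (\<lambda>_. n) \<longleftrightarrow>
    (\<exists>x. x (Cst 1) = 1 \<and> x (Var 0) = int n \<and> (\<forall>e\<in>set es. holds x e))"
proof -
  obtain p q :: "(nat + nat) tm" where pq: "\<And>v. P v \<longleftrightarrow> (\<exists>w. tval (case_sum v w) p = tval (case_sum v w) q)"
    using assms by (auto simp: dioph_def)
  let ?p = "int_tm p" and ?q = "int_tm q"
  \<comment> \<open>The equation of the two polynomials is written as a sum with the unknown for
    0.\<close>
  let ?es = "Plus ?p (Cst 0) ?q # tm_eqs ?p @ tm_eqs ?q @ tm_eqs (Cst 0)"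
  have "P (\<lambda>_. n) \<longleftrightarrow> (\<exists>x. x (Cst 1) = 1 \<and> x (Var 0) = int n \<and> (\<forall>e\<in>set ?es. holds x e))" for n
  proof
    assume "P (\<lambda>_. n)"
    then obtain w where w: "tval (case_sum (\<lambda>_. n) w) p = tval (case_sum (\<lambda>_. n) w) q"
      using pq by blast
    have "\<exists>s :: nat \<Rightarrow> int. int (w i) = s 0 * s 0 + s 1 * s 1 + s 2 * s 2 + s 3 * s 3" for i
    proof -
      obtain a b c d where abcd: "int (w i) = a * a + b * b + c * c + d * d"
        using four_squares[of "w i"] by (auto simp: sum4sq_def)
      show ?thesis
        by (rule exI[of _ "\<lambda>k. if k = 0 then a else if k = 1 then b else if k = 2 then c else d"])
          (simp add: abcd)
    qed
    then have "\<exists>s :: nat \<Rightarrow> nat \<Rightarrow> int.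
        \<forall>i. int (w i) = s i 0 * s i 0 + s i 1 * s i 1 + s i 2 * s i 2 + s i 3 * s i 3"
      by (intro choice allI)
    then obtain s :: "nat \<Rightarrow> nat \<Rightarrow> int" where
      s: "\<forall>i. int (w i) = s i 0 * s i 0 + s i 1 * s i 1 + s i 2 * s i 2 + s i 3 * s i 3" ..
    define f where "f v = (if v = 0 then int n else s ((v - 1) div 4) ((v - 1) mod 4))" for v
    have f: "f (Suc (4 * i + r)) = s i r" if "r < 4" for i r
      using that by (simp add: f_def)
    have f0: "f 0 = int n" by (simp add: f_def)
    have *: "tval f (int_tm t) = int (tval (case_sum (\<lambda>_. n) w) t)" for t
      by (rule tval_int_tm) (simp_all add: f[of 0, simplified] f[of 1, simplified] f[of 2, simplified] f[of 3, simplified] f0 s[rule_format])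
    show "\<exists>x. x (Cst 1) = 1 \<and> x (Var 0) = int n \<and> (\<forall>e\<in>set ?es. holds x e)"
      by (intro exI[of _ "tval f"]) (auto simp: f0 * w dest: holds_tm_eqs)
  next
    assume "\<exists>x. x (Cst 1) = 1 \<and> x (Var 0) = int n \<and> (\<forall>e\<in>set ?es. holds x e)"
    then obtain x where x: "x (Cst 1) = 1" "x (Var 0) = int n" "\<forall>e\<in>set ?es. holds x e"
      by blast
    define f where "f v = x (Var v)" for v
    define w where "w i = nat (f (Suc (4 * i + 0)) * f (Suc (4 * i + 0)) + f (Suc (4 * i + 1)) * f (Suc (4 * i + 1)) +
      f (Suc (4 * i + 2)) * f (Suc (4 * i + 2)) + f (Suc (4 * i + 3)) * f (Suc (4 * i + 3)))" for i
    have *: "tval f (int_tm t) = int (tval (case_sum (\<lambda>_. n) w) t)" for t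
      by (rule tval_int_tm) (simp_all add: f_def x w_def)
    have "x ?p = tval f ?p" "x ?q = tval f ?q" "x (Cst 0) = tval f (Cst 0)"
      unfolding f_def using x by (intro tm_eqs_sound; simp)+
    moreover have "x ?p + x (Cst 0) = x ?q" using x(3) by simp
    ultimately have "tval (case_sum (\<lambda>_. n) w) p = tval (case_sum (\<lambda>_. n) w) q"
      by (simp add: *)
    then show "P (\<lambda>_. n)" using pq by blast
  qed
  then show ?thesis by blast
qed

type_synonym 'i copy = "(('i \<Rightarrow> int) \<Rightarrow> int) \<times> (('i \<Rightarrow> int) \<Rightarrow> int) \<times> (('i \<Rightarrow> int) \<Rightarrow> int)"

text \<open>A triple \<open>(l, m, k)\<close> stands for the bilinear condition \<open>l x * m y + k z = t\<close> that
  one coordinate of the direct product imposes.\<close>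

fun copy_value :: "('i \<Rightarrow> int) \<Rightarrow> ('i \<Rightarrow> int) \<Rightarrow> ('i \<Rightarrow> int) \<Rightarrow> 'i copy \<Rightarrow> int" where
  "copy_value x y z (l, m, k) = l x * m y + k z"

text \<open>A sum is multiplied by the unit of the second vector, so that the common sign of
  \<open>x\<close> and \<open>y\<close> cancels there just as in a product.\<close>

primrec quad_copy :: "'i \<Rightarrow> 'i quad \<Rightarrow> 'i copy" where
  "quad_copy u (Times a b c) = (\<lambda>x. x a, \<lambda>x. x b, \<lambda>x. - x c)"
| "quad_copy u (Plus a b c) = (\<lambda>x. x a + x b, \<lambda>x. x u, \<lambda>x. - x c)"

text \<open>The two conditions \<open>x i * y u = z i\<close> and \<open>x u * y i = z i\<close> tie
  together the three vectors, which the factors choose independently.\<close>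

definition link_copies :: "'i \<Rightarrow> 'i \<Rightarrow> 'i copy list" where
  "link_copies u i = [(\<lambda>x. x i, \<lambda>x. x u, \<lambda>x. - x i), (\<lambda>x. x u, \<lambda>x. x i, \<lambda>x. - x i)]"

definition rest_copies :: "'i \<Rightarrow> 'i \<Rightarrow> 'i quad list \<Rightarrow> 'i copy list" where
  "rest_copies u v es =
    concat (map (link_copies u) (u # v # concat (map quad_indices es))) @ map (quad_copy u) es"

text \<open>The condition \<open>x u * y u = 1\<close> makes both factors equal to the same sign, and a bilinear
  system does not change when \<open>x\<close> and \<open>y\<close> are multiplied by this sign.\<close>

lemma bilinear_system_iff:
  "(\<exists>x y z. x u * y u = 1 \<and> z v = n \<and> (\<forall>c\<in>set (rest_copies u v es). copy_value x y z c = 0))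
    \<longleftrightarrow> (\<exists>x. x u = 1 \<and> x v = n \<and> (\<forall>e\<in>set es. holds x e))"
proof
  assume "\<exists>x y z. x u * y u = 1 \<and> z v = n \<and> (\<forall>c\<in>set (rest_copies u v es). copy_value x y z c = 0)"
  then obtain x y z where 1: "x u * y u = 1" and n: "z v = n"
    and rest: "\<And>c. c \<in> set (rest_copies u v es) \<Longrightarrow> copy_value x y z c = 0"
    by blast
  define s where "s = x u"
  have s: "s * s = 1" "y u = s" "x u = s"
    using 1 by (auto simp: s_def zmult_eq_1_iff)
  have link: "z i = s * x i \<and> z i = s * y i" if "i \<in> set (u # v # concat (map quad_indices es))" for i
  proof -
    have "set (link_copies u i) \<subseteq> set (rest_copies u v es)"
      using that unfolding rest_copies_def by auto
    then have "(\<lambda>x. x i, \<lambda>x. x u, \<lambda>x. - x i) \<in> set (rest_copies u v es)"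
      "(\<lambda>x. x u, \<lambda>x. x i, \<lambda>x. - x i) \<in> set (rest_copies u v es)"
      by (auto simp: link_copies_def)
    from this[THEN rest] show ?thesis by (simp add: s mult.commute)
  qed
  have "z u = 1" using link[of u] s by simp
  moreover have "holds z e" if e: "e \<in> set es" for e
  proof -
    have idx: "i \<in> set (u # v # concat (map quad_indices es))" if "i \<in> set (quad_indices e)" for i
      using that e by auto
    have qc: "copy_value x y z (quad_copy u e) = 0"
      using e by (intro rest) (simp add: rest_copies_def)
    show ?thesis
    proof (cases e)
      case (Times a b c)
      have "z a = s * x a"
        by (rule link[THEN conjunct1], rule idx) (simp add: Times)
      moreover have "z b = s * y b"
        by (rule link[THEN conjunct2], rule idx) (simp add: Times)
      moreover have "x a * y b = z c"
        using qc Times by simp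
      moreover have "(s * x a) * (s * y b) = (s * s) * (x a * y b)" by algebra
      ultimately show ?thesis using Times s by simp
    next
      case (Plus a b c)
      have "z a = s * x a"
        by (rule link[THEN conjunct1], rule idx) (simp add: Plus)
      moreover have "z b = s * x b"
        by (rule link[THEN conjunct1], rule idx) (simp add: Plus)
      moreover have "(x a + x b) * s = z c"
        using qc Plus s by simp
      ultimately show ?thesis using Plus by (simp add: algebra_simps)
    qed
  qed
  ultimately show "\<exists>x. x u = 1 \<and> x v = n \<and> (\<forall>e\<in>set es. holds x e)"
    using n by blast
next
  assume "\<exists>x. x u = 1 \<and> x v = n \<and> (\<forall>e\<in>set es. holds x e)"
  then obtain x where x: "x u = 1" "x v = n" "\<And>e. e \<in> set es \<Longrightarrow> holds x e" by blast
  have "copy_value x x x (quad_copy u e) = 0" if "e \<in> set es" for e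
    using x(3)[OF that] x(1) by (cases e) auto
  then have "copy_value x x x c = 0" if "c \<in> set (rest_copies u v es)" for c
    using that x(1) by (auto simp: rest_copies_def link_copies_def)
  with x show "\<exists>x y z. x u * y u = 1 \<and> z v = n \<and> (\<forall>c\<in>set (rest_copies u v es). copy_value x y z c = 0)"
    by (intro exI[of _ x]) auto
qed

lemma additive_rest_copies:
  "(l, m, k) \<in> set (rest_copies u v es) \<Longrightarrow> additive_form l \<and> additive_form m \<and> additive_form k"
proof -
  have "additive_form l \<and> additive_form m \<and> additive_form k" if "(l, m, k) = quad_copy u e" for e
    using that by (cases e) (auto simp: additive_form_def)
  then show "(l, m, k) \<in> set (rest_copies u v es) \<Longrightarrow> ?thesis"
    by (auto simp: rest_copies_def link_copies_def) (auto simp: additive_form_def)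
qed

text \<open>Only coordinates 0 and 1 have a nonzero central target, namely 1 and \<open>n\<close>,
  which \<open>h\<close> and \<open>g [^] n\<close> supply. The third subgroup is the first one
  again.\<close>

theorem dioph_heisenberg:
  assumes "dioph P"
  shows "\<exists>d G1 G2 G3 G4 g h.
    (\<forall>A\<in>{G1, G2, G3, G4}. subgroup A (heisenberg_power d) \<and>
        comm_group (heisenberg_power d\<lparr>carrier := A\<rparr>)) \<and>
    g \<in> carrier (heisenberg_power d) \<and> h \<in> carrier (heisenberg_power d) \<and>
    (\<forall>n. g [^]\<^bsub>heisenberg_power d\<^esub> n \<otimes>\<^bsub>heisenberg_power d\<^esub> h \<in>
        G1 <#>\<^bsub>heisenberg_power d\<^esub> G2 <#>\<^bsub>heisenberg_power d\<^esub> G3 <#>\<^bsub>heisenberg_power d\<^esub> G4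
      \<longleftrightarrow> P (\<lambda>_. n :: nat))"
proof -
  obtain es :: "nat tm quad list" where es: "\<And>n. P (\<lambda>_. n) \<longleftrightarrow>
      (\<exists>x. x (Cst 1) = 1 \<and> x (Var 0) = int n \<and> (\<forall>e\<in>set es. holds x e))"
    using dioph_quadratic[OF assms] by blast
  define cs :: "nat tm copy list" where
    "cs = (\<lambda>x. x (Cst 1), \<lambda>x. x (Cst 1), \<lambda>x. 0) # (\<lambda>x. 0, \<lambda>x. 0, \<lambda>x. x (Var 0)) #
      rest_copies (Cst 1) (Var 0) es"
  define d where "d = length cs"
  \<comment> \<open>Zero forms beyond \<open>d\<close> make additivity hold for all
    \<open>j\<close>, as \<open>subgroup_hvec\<close> and \<open>hvec_in_product_iff\<close>
    assume.\<close>
  define cp where "cp j = (if j < d then cs ! j else (\<lambda>_. 0, \<lambda>_. 0, \<lambda>_. 0))" for j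
  define l m k where "l j = fst (cp j)" and "m j = fst (snd (cp j))" and "k j = snd (snd (cp j))" for j
  have cs: "additive_form l' \<and> additive_form m' \<and> additive_form k'" if "(l', m', k') \<in> set cs" for l' m' k'
    using that additive_rest_copies[of l' m' k'] by (auto simp: cs_def) (auto simp: additive_form_def)
  have "cp j \<in> set cs \<or> cp j = (\<lambda>_. 0, \<lambda>_. 0, \<lambda>_. 0)" for j
    by (simp add: cp_def d_def)
  then have add: "additive_form (l j) \<and> additive_form (m j) \<and> additive_form (k j)" for j
    unfolding l_def m_def k_def using cs[of "fst (cp j)" "fst (snd (cp j))" "snd (snd (cp j))"]
    by (force simp: additive_form_def[of "\<lambda>_. 0"])
  define t where "t n j = (if j = 0 then 1 else if j = 1 then int n else 0)" for n j :: nat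
  define G1 where "G1 = {hvec d (\<lambda>j. l j x) (\<lambda>j. 0) (\<lambda>j. 0) | x. True}"
  define G2 where "G2 = {hvec d (\<lambda>j. 0) (\<lambda>j. m j y) (\<lambda>j. 0) | y. True}"
  define G4 where "G4 = {hvec d (\<lambda>j. 0) (\<lambda>j. m j (\<lambda>i. x (Inl i))) (\<lambda>j. k j (\<lambda>i. x (Inr i))) | x. True}"
  have zero: "additive_form (\<lambda>_. 0)" by (simp add: additive_form_def)
  have "subgroup G1 (heisenberg_power d) \<and> comm_group (heisenberg_power d\<lparr>carrier := G1\<rparr>)"
    unfolding G1_def using add zero by (intro subgroup_hvec) auto
  moreover have "subgroup G2 (heisenberg_power d) \<and> comm_group (heisenberg_power d\<lparr>carrier := G2\<rparr>)"
    unfolding G2_def using add zero by (intro subgroup_hvec) auto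
  moreover have "subgroup G4 (heisenberg_power d) \<and> comm_group (heisenberg_power d\<lparr>carrier := G4\<rparr>)"
    unfolding G4_def using add zero by (intro subgroup_hvec) (auto simp: additive_form_def)
  moreover define g where "g = hvec d (\<lambda>_. 0) (\<lambda>_. 0) (\<lambda>j. if j = 1 then 1 else 0)"
  moreover define h where "h = hvec d (\<lambda>_. 0) (\<lambda>_. 0) (\<lambda>j. if j = 0 then 1 else 0)"
  moreover have "g [^]\<^bsub>heisenberg_power d\<^esub> n \<otimes>\<^bsub>heisenberg_power d\<^esub> h \<in>
        G1 <#>\<^bsub>heisenberg_power d\<^esub> G2 <#>\<^bsub>heisenberg_power d\<^esub> G1 <#>\<^bsub>heisenberg_power d\<^esub> G4
      \<longleftrightarrow> P (\<lambda>_. n)" for n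
  proof -
    have "g [^]\<^bsub>heisenberg_power d\<^esub> n \<otimes>\<^bsub>heisenberg_power d\<^esub> h = hvec d (\<lambda>_. 0) (\<lambda>_. 0) (t n)"
      unfolding g_def h_def hvec_central_power hvec_mult by (intro hvec_cong) (auto simp: t_def)
    moreover have "hvec d (\<lambda>_. 0) (\<lambda>_. 0) (t n) \<in>
        G1 <#>\<^bsub>heisenberg_power d\<^esub> G2 <#>\<^bsub>heisenberg_power d\<^esub> G1 <#>\<^bsub>heisenberg_power d\<^esub> G4
      \<longleftrightarrow> (\<exists>x y z. \<forall>j<d. l j x * m j y + k j z = t n j)"
      unfolding G1_def G2_def G4_def using add by (intro hvec_in_product_iff) auto
    moreover have "(\<forall>j<d. l j x * m j y + k j z = t n j) \<longleftrightarrow> x (Cst 1) * y (Cst 1) = 1 \<and> z (Var 0) = int n \<and>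
        (\<forall>c\<in>set (rest_copies (Cst 1) (Var 0) es). copy_value x y z c = 0)" for x y z
    proof -
      have "l j x * m j y + k j z = copy_value x y z (cs ! j)" if "j < d" for j
        using that by (cases "cs ! j") (simp add: l_def m_def k_def cp_def)
      then have "(\<forall>j<d. l j x * m j y + k j z = t n j) \<longleftrightarrow> (\<forall>j<d. copy_value x y z (cs ! j) = t n j)"
        by auto
      also have "\<dots> \<longleftrightarrow> x (Cst 1) * y (Cst 1) = 1 \<and> z (Var 0) = int n \<and>
          (\<forall>j<length (rest_copies (Cst 1) (Var 0) es). copy_value x y z (rest_copies (Cst 1) (Var 0) es ! j) = 0)"
        unfolding d_def cs_def by (auto simp: All_less_Suc2 t_def)
      finally show ?thesis by (simp add: all_set_conv_all_nth)
    qed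
    ultimately show ?thesis
      unfolding es bilinear_system_iff[symmetric] by simp
  qed
  moreover have "g \<in> carrier (heisenberg_power d)" "h \<in> carrier (heisenberg_power d)"
    by (simp_all add: g_def h_def hvec_carrier)
  ultimately show ?thesis by blast
qed


section \<open>Words and recursive functions\<close>

lemma (in group) letter_value_closed:
  "set gs \<subseteq> carrier G \<Longrightarrow> x \<in> {..<length gs} <+> {..<length gs} \<Longrightarrow> letter_value G gs x \<in> carrier G"
  by (auto simp: subset_iff)

lemma (in group) word_value_closed:
  "set gs \<subseteq> carrier G \<Longrightarrow> w \<in> words_over gs \<Longrightarrow> word_value G gs w \<in> carrier G"
  by (induction w) (auto simp: word_value_def words_over_def intro!: letter_value_closed m_closed)

lemma (in group) word_value_append:
  assumes "set gs \<subseteq> carrier G" "w \<in> words_over gs" "w' \<in> words_over gs"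
  shows "word_value G gs (w @ w') = word_value G gs w \<otimes> word_value G gs w'"
  using assms(2)
proof (induction w)
  case Nil
  then show ?case using word_value_closed[OF assms(1,3)] by (simp add: word_value_def)
next
  case (Cons x w)
  then have "w \<in> words_over gs" "x \<in> {..<length gs} <+> {..<length gs}" by (auto simp: words_over_def)
  then have "letter_value G gs x \<in> carrier G" "word_value G gs w \<in> carrier G"
    using assms(1) letter_value_closed word_value_closed by auto
  then show ?case
    using Cons.IH[OF \<open>w \<in> words_over gs\<close>] word_value_closed[OF assms(1,3)]
    by (simp add: word_value_def m_assoc)
qed

lemma words_over_append: "w \<in> words_over gs \<Longrightarrow> w' \<in> words_over gs \<Longrightarrow> w @ w' \<in> words_over gs"
  by (simp add: words_over_def)

lemma (in group) word_exists:
  assumes "set gs \<subseteq> carrier G" "g \<in> generate G (set gs)"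
  shows "\<exists>w\<in>words_over gs. word_value G gs w = g"
  using assms(2)
proof (induction rule: generate.induct)
  case one
  show ?case by (rule bexI[of _ "[]"]) (simp_all add: word_value_def words_over_def)
next
  case (incl h)
  then obtain i where i: "i < length gs" "h = gs ! i" by (auto simp: in_set_conv_nth)
  moreover have "h \<in> carrier G" using incl assms(1) by blast
  ultimately show ?case by (intro bexI[of _ "[Inl i]"]) (simp_all add: word_value_def words_over_def InlI)
next
  case (inv h)
  then obtain i where i: "i < length gs" "h = gs ! i" by (auto simp: in_set_conv_nth)
  moreover have "h \<in> carrier G" using inv assms(1) by blast
  ultimately show ?case by (intro bexI[of _ "[Inr i]"]) (simp_all add: word_value_def words_over_def InrI)
next
  case (eng h1 h2)
  then obtain w1 w2 where "w1 \<in> words_over gs" "word_value G gs w1 = h1" "w2 \<in> words_over gs" "word_value G gs w2 = h2"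
    by blast
  then show ?case
    using assms(1) by (intro bexI[of _ "w1 @ w2"]) (simp_all add: word_value_append words_over_append)
qed

fun repeat_word :: "word \<Rightarrow> word \<Rightarrow> nat \<Rightarrow> word" where
  "repeat_word w w' 0 = w'"
| "repeat_word w w' (Suc n) = w @ repeat_word w w' n"

lemma repeat_word_over: "w \<in> words_over gs \<Longrightarrow> w' \<in> words_over gs \<Longrightarrow> repeat_word w w' n \<in> words_over gs"
  by (induction n) (auto intro: words_over_append)

lemma (in group) repeat_word_value:
  assumes "set gs \<subseteq> carrier G" "w \<in> words_over gs" "w' \<in> words_over gs"
  shows "word_value G gs (repeat_word w w' n) = word_value G gs w [^] n \<otimes> word_value G gs w'"
proof (induction n)
  case 0
  then show ?case using word_value_closed[OF assms(1,3)] by simp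
next
  case (Suc n)
  have w: "word_value G gs w \<in> carrier G" "word_value G gs w' \<in> carrier G"
    using assms word_value_closed by blast+
  have "word_value G gs (repeat_word w w' (Suc n)) = word_value G gs w \<otimes> (word_value G gs w [^] n \<otimes> word_value G gs w')"
    using Suc assms by (simp add: word_value_append repeat_word_over)
  also have "\<dots> = word_value G gs w [^] Suc n \<otimes> word_value G gs w'"
    unfolding nat_pow_Suc2[OF w(1)] using w by (simp only: m_assoc nat_pow_closed)
  finally show ?case .
qed

section \<open>Recursive functions that write words\<close>

fun const_recf :: "nat \<Rightarrow> recf" where
  "const_recf 0 = Zero"
| "const_recf (Suc c) = Comp Succ [const_recf c]"

lemma computes_const: "computes (const_recf c) xs c"
  by (induction c) (auto intro!: computes.intros)

definition add_recf :: recf where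
  "add_recf = PrimRec (Proj 0) (Comp Succ [Proj 1])"

lemma computes_proj: "i < length xs \<Longrightarrow> y = xs ! i \<Longrightarrow> computes (Proj i) xs y"
  using computes.proj by simp

lemma computes_comp1: "computes g xs y \<Longrightarrow> computes f [y] z \<Longrightarrow> computes (Comp f [g]) xs z"
  by (rule computes.comp[of xs "[g]" "[y]"]) auto

lemma computes_comp2:
  "computes g xs y \<Longrightarrow> computes g' xs y' \<Longrightarrow> computes f [y, y'] z \<Longrightarrow> computes (Comp f [g, g']) xs z"
  by (rule computes.comp[of xs "[g, g']" "[y, y']"]) auto

lemma computes_add: "computes add_recf [m, n] (m + n)"
proof (induction m)
  case 0
  show ?case unfolding add_recf_def by (auto intro!: computes.primrec_0 computes_proj)
next
  case (Suc m)
  have "computes (Comp Succ [Proj 1]) [m, m + n, n] (Suc (m + n))"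
    by (rule computes_comp1[OF computes_proj computes.succ]) auto
  with Suc show ?case
    unfolding add_recf_def by (auto intro: computes.primrec_Suc)
qed

definition triangle_recf :: recf where
  "triangle_recf = PrimRec Zero (Comp add_recf [Proj 1, Comp Succ [Proj 0]])"

lemma computes_triangle: "computes triangle_recf [n] (triangle n)"
proof (induction n)
  case 0
  show ?case unfolding triangle_recf_def by (auto intro!: computes.intros)
next
  case (Suc n)
  have "computes (Comp add_recf [Proj 1, Comp Succ [Proj 0]]) [n, triangle n] (triangle n + Suc n)"
    by (rule computes_comp2[OF computes_proj computes_comp1[OF computes_proj computes.succ] computes_add]) auto
  with Suc show ?case
    unfolding triangle_recf_def by (auto intro: computes.primrec_Suc)
qed

text \<open>On list codes this prepends the fixed entry \<open>c\<close>: a nonempty list is coded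
  by \<open>Suc\<close> of the pair of head and tail code, and \<open>prod_encode (c, r)\<close> is
  \<open>triangle (c + r) + c\<close>.\<close>

definition push_recf :: "nat \<Rightarrow> recf" where
  "push_recf c = Comp Succ [Comp add_recf [Comp triangle_recf [Comp add_recf [const_recf c, Proj 0]], const_recf c]]"

lemma computes_push: "computes (push_recf c) [r] (Suc (prod_encode (c, r)))"
proof -
  have "computes (Comp add_recf [const_recf c, Proj 0]) [r] (c + r)"
    by (rule computes_comp2[OF computes_const computes_proj computes_add]) auto
  then have "computes (Comp add_recf [Comp triangle_recf [Comp add_recf [const_recf c, Proj 0]], const_recf c]) [r]
      (triangle (c + r) + c)"
    by (rule computes_comp2[OF computes_comp1[OF _ computes_triangle] computes_const computes_add])
  then show ?thesis
    unfolding push_recf_def prod_encode_def by (auto intro: computes_comp1 computes.succ)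
qed

fun pushes_recf :: "nat list \<Rightarrow> recf" where
  "pushes_recf [] = Proj 0"
| "pushes_recf (c # cs) = Comp (push_recf c) [pushes_recf cs]"

lemma computes_pushes: "computes (pushes_recf cs) [list_encode xs] (list_encode (cs @ xs))"
proof (induction cs)
  case Nil
  show ?case by (auto intro!: computes_proj)
next
  case (Cons c cs)
  then show ?case by (auto intro: computes_comp1 computes_push)
qed

definition repeat_recf :: "word \<Rightarrow> word \<Rightarrow> recf" where
  "repeat_recf w w' = PrimRec (const_recf (word_code w')) (Comp (pushes_recf (map sum_encode w)) [Proj 1])"

lemma computes_repeat: "computes (repeat_recf w w') [n] (word_code (repeat_word w w' n))"
proof (induction n)
  case 0
  show ?case unfolding repeat_recf_def by (auto intro!: computes.primrec_0 computes_const)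
next
  case (Suc n)
  let ?r = "repeat_word w w' n"
  have "computes (Comp (pushes_recf (map sum_encode w)) [Proj 1]) [n, word_code ?r] (word_code (repeat_word w w' (Suc n)))"
    by (rule computes_comp1[where y = "word_code ?r"])
      (auto simp: word_code_def intro!: computes_proj computes_pushes)
  with Suc show ?case
    unfolding repeat_recf_def by (rule computes.primrec_Suc)
qed

theorem theorem6p6:
  shows "\<exists>d G1 G2 G3 G4.
    (\<forall>A\<in>{G1, G2, G3, G4}. subgroup A (heisenberg_power d) \<and>
        comm_group (heisenberg_power d\<lparr>carrier := A\<rparr>)) \<and>
    (\<forall>gs. generating_list (heisenberg_power d) gs \<longrightarrow>
      \<not> decidable_on word_code (words_over gs)
          (\<lambda>w. word_value (heisenberg_power d) gs w \<in>
            G1 <#>\<^bsub>heisenberg_power d\<^esub> G2 <#>\<^bsub>heisenberg_power d\<^esub> G3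
              <#>\<^bsub>heisenberg_power d\<^esub> G4))"
proof -
  obtain d G1 G2 G3 G4 g h where
    G: "\<forall>A\<in>{G1, G2, G3, G4}. subgroup A (heisenberg_power d) \<and>
        comm_group (heisenberg_power d\<lparr>carrier := A\<rparr>)"
    and gh: "g \<in> carrier (heisenberg_power d)" "h \<in> carrier (heisenberg_power d)"
    and mem: "\<And>n. g [^]\<^bsub>heisenberg_power d\<^esub> n \<otimes>\<^bsub>heisenberg_power d\<^esub> h \<in>
        G1 <#>\<^bsub>heisenberg_power d\<^esub> G2 <#>\<^bsub>heisenberg_power d\<^esub> G3 <#>\<^bsub>heisenberg_power d\<^esub> G4
      \<longleftrightarrow> (n::nat) \<in> diagonal"
    using dioph_heisenberg[OF dioph_diagonal] by metis
  interpret group "heisenberg_power d" by (rule group_heisenberg_power)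
  let ?M = "G1 <#>\<^bsub>heisenberg_power d\<^esub> G2 <#>\<^bsub>heisenberg_power d\<^esub> G3 <#>\<^bsub>heisenberg_power d\<^esub> G4"
  have "\<not> decidable_on word_code (words_over gs) (\<lambda>w. word_value (heisenberg_power d) gs w \<in> ?M)"
    if gs: "generating_list (heisenberg_power d) gs" for gs
  proof
    assume "decidable_on word_code (words_over gs) (\<lambda>w. word_value (heisenberg_power d) gs w \<in> ?M)"
    then obtain f where f: "\<And>w. w \<in> words_over gs \<Longrightarrow>
        computes f [word_code w] (if word_value (heisenberg_power d) gs w \<in> ?M then 1 else 0)"
      by (auto simp: decidable_on_def)
    have sub: "set gs \<subseteq> carrier (heisenberg_power d)"
      and gen: "generate (heisenberg_power d) (set gs) = carrier (heisenberg_power d)"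
      using gs by (auto simp: generating_list_def)
    obtain w w' where w: "w \<in> words_over gs" "word_value (heisenberg_power d) gs w = g"
      and w': "w' \<in> words_over gs" "word_value (heisenberg_power d) gs w' = h"
      using word_exists[OF sub] gh gen by metis
    \<comment> \<open>Only the words \<open>w\<close> and \<open>w'\<close> depend on the
      generators. Composing the supposed decision function with the one that writes the word for
      \<open>g [^] n \<otimes> h\<close> would decide \<open>diagonal\<close>.\<close>
    have "computes (Comp f [repeat_recf w w']) [n] (if n \<in> diagonal then 1 else 0)" for n
      using f[OF repeat_word_over[OF w(1) w'(1), of n]] computes_repeat[of w w' n]
      unfolding repeat_word_value[OF sub w(1) w'(1)] w(2) w'(2) mem
      by (rule computes_comp1[rotated])
    then show False using diagonal_undecidable by blast
  qed
  with G show ?thesis by blast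
qed

end
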